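(* Let $k\in\{2,\dots,N\}$ with $k>N/2$ and let $\Omega\subset\mathbb{R}^N$ be a bounded domain with $C^2$ boundary which is strictly $(k-1)$-convex. Write $\lambda_1^-=\lambda_1^-(S_k,\Sigma_k)$. Let $\{\lambda_n\}_{n\in\mathbb{N}}$ be a sequence with $0<\lambda_n<\lambda_1^-$ and $\lambda_n\nearrow\lambda_1^-$ as $n\to+\infty$, and let $\{v_n\}_{n\in\mathbb{N}}\subset C(\overline\Omega)$ be the sequence of $k$-convex ($\Sigma_k$-admissible) solutions of $$S_k(D^2v_n)=1-\lambda_n v_n|v_n|^{k-1}\ \text{ in }\Omega,\qquad v_n=0\ \text{ on }\partial\Omega .$$ Then the normalized sequence $w_n:=v_n/\|v_n\|_\infty$ admits a subsequence which converges uniformly on $\overline\Omega$ to a principal eigenfunction $\psi_1\in C(\overline\Omega)$, that is, to a $\Sigma_k$-admissible solution of $$S_k(D^2\psi_1)+\lambda_1^-\psi_1|\psi_1|^{k-1}=0\ \text{ in }\Omega,\qquad \psi_1=0\ \text{ on }\partial\Omega,$$ and $\psi_1<0$ in $\Omega$.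
   Context: Notation. $\mathcal{S}(N)$ is the space of real symmetric $N\times N$ matrices; $\lambda(A)\in\mathbb{R}^N$ is the vector of eigenvalues of $A$; $\sigma_j(\lambda)=\sum_{1\le i_1<\dots<i_j\le N}\lambda_{i_1}\cdots\lambda_{i_j}$; $S_k(A)=\sigma_k(\lambda(A))$; $\Gamma_k=\{\lambda\in\mathbb{R}^N:\sigma_j(\lambda)>0,\ j=1,\dots,k\}$; $\Sigma_k=\{A\in\mathcal{S}(N):\lambda(A)\in\overline{\Gamma}_k\}$. $\mathrm{USC}(\Omega)$ denotes upper semicontinuous functions with values in $[-\infty,+\infty)$. $\|\cdot\|_\infty$ is the sup norm on $\Omega$. $k$-convexity. $\psi\in\mathrm{USC}(\Omega)$ is $k$-convex in $\Omega$ if for every $x_0\in\Omega$ and every $\varphi$ of class $C^2$ near $x_0$ such that $\psi-\varphi$ has a local maximum at $x_0$, one has $D^2\varphi(x_0)\in\Sigma_k$. Admissible solutions. $u\in C(\overline\Omega)$ is a $\Sigma_k$-admissible (or $k$-convex) solution of $S_k(D^2u)=g(x,u)$ in $\Omega$ if for every $x_0\in\Omega$ and every $\varphi$ of class $C^2$ near $x_0$: (i) if $u-\varphi$ has a local maximum at $x_0$, then $S_k(D^2\varphi(x_0))\ge g(x_0,u(x_0))$ and $D^2\varphi(x_0)\in\Sigma_k$; (ii) if $u-\varphi$ has a local minimum at $x_0$, then $S_k(D^2\varphi(x_0))\le g(x_0,u(x_0))$ or $D^2\varphi(x_0)\notin\Sigma_k$. Principal eigenvalue. $\Phi_k^-(\Omega)=\{\psi\in\mathrm{USC}(\Omega):\psi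 \text{ is } k\text{-convex and negative in }\Omega\}$; $\Lambda_k$ is the set of $\lambda\in\mathbb{R}$ for which there exists $\psi\in\Phi_k^-(\Omega)$ with $S_k(D^2\psi)+\lambda\psi|\psi|^{k-1}\ge 0$ in $\Omega$ in the viscosity sense, i.e. whenever $x_0\in\Omega$, $\varphi$ is $C^2$ near $x_0$ and $\psi-\varphi$ has a local maximum at $x_0$, one has $S_k(D^2\varphi(x_0))+\lambda\psi(x_0)|\psi(x_0)|^{k-1}\ge0$. Set $\lambda_1^-(S_k,\Sigma_k)=\sup\Lambda_k$. Strict $(k-1)$-convexity ($k\ge2$). A bounded domain $\Omega$ with $C^2$ boundary is strictly $(k-1)$-convex if $\sigma_j(\kappa_1(y),\dots,\kappa_{N-1}(y))>0$ for all $y\in\partial\Omega$ and $j=1,\dots,k-1$, where $\kappa_i(y)$ are the principal curvatures of $\partial\Omega$ at $y$ relative to the inner unit normal (so that they are positive for balls) and $\sigma_j$ denotes here the elementary symmetric function on $\mathbb{R}^{N-1}$. *)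

theory Defs
  imports "HOL-Analysis.Analysis"
begin

section \<open>Elementary symmetric functions and the cones\<close>

definition esym :: "'i set \<Rightarrow> nat \<Rightarrow> ('i \<Rightarrow> real) \<Rightarrow> real" where
  "esym I j l = (\<Sum>J | J \<subseteq> I \<and> card J = j. \<Prod>i\<in>J. l i)"

definition Gamma :: "nat \<Rightarrow> (real^'n) set" where
  "Gamma k = {l. \<forall>j\<in>{1..k}. esym UNIV j (($) l) > 0}"

text \<open>The eigenvalues repeated according to algebraic multiplicity, in an unspecified order
  (only symmetric functions of them are used). They exist for symmetric \<open>A\<close>.\<close>

definition eigenvalues :: "real^'n^'n \<Rightarrow> real^'n" where
  "eigenvalues A = (SOME l. \<forall>t. det (mat t - A) = (\<Prod>i\<in>UNIV. t - l $ i))"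

definition Sk :: "nat \<Rightarrow> real^'n^'n \<Rightarrow> real" where
  "Sk k A = esym UNIV k (($) (eigenvalues A))"

definition Sigma_cone :: "nat \<Rightarrow> (real^'n^'n) set" where
  "Sigma_cone k = {A. transpose A = A \<and> eigenvalues A \<in> closure (Gamma k)}"


section \<open>Functions of class \<open>C\<^sup>2\<close>\<close>

definition grad :: "(real^'n \<Rightarrow> real) \<Rightarrow> real^'n \<Rightarrow> real^'n" where
  "grad f x = (SOME D. GDERIV f x :> D)"

definition hessian :: "(real^'n \<Rightarrow> real) \<Rightarrow> real^'n \<Rightarrow> real^'n^'n" where
  "hessian f x = jacobian (grad f) (at x)"

definition C2_on :: "(real^'n) set \<Rightarrow> (real^'n \<Rightarrow> real) \<Rightarrow> bool" where
  "C2_on U f \<longleftrightarrow> open U \<and> (\<forall>x\<in>U. f differentiable at x) \<and>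
     (\<forall>x\<in>U. grad f differentiable at x) \<and> continuous_on U (hessian f)"

definition C2_near :: "real^'n \<Rightarrow> (real^'n \<Rightarrow> real) \<Rightarrow> bool" where
  "C2_near x f \<longleftrightarrow> (\<exists>U. x \<in> U \<and> C2_on U f)"


section \<open>Viscosity notions\<close>

definition USC :: "(real^'n) set \<Rightarrow> (real^'n \<Rightarrow> ereal) set" where
  "USC \<Omega> = {\<psi>. \<forall>x\<in>\<Omega>. \<psi> x < \<infinity> \<and> (\<forall>c. \<psi> x < c \<longrightarrow> (\<forall>\<^sub>F y in at x within \<Omega>. \<psi> y < c))}"

text \<open>Read literally for extended-valued \<open>\<psi>\<close>: a function equal to \<open>-\<infinity>\<close> on a nonempty open set
  has a local maximum of \<open>\<psi> - \<phi>\<close> there for every \<open>\<phi>\<close>, so it is not \<open>k\<close>-convex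
  (for \<open>k \<ge> 1\<close>).\<close>

definition touches_above ::
    "(real^'n) set \<Rightarrow> (real^'n \<Rightarrow> ereal) \<Rightarrow> real^'n \<Rightarrow> (real^'n \<Rightarrow> real) \<Rightarrow> bool" where
  "touches_above \<Omega> \<psi> x0 \<phi> \<longleftrightarrow> C2_near x0 \<phi> \<and>
     (\<forall>\<^sub>F x in at x0 within \<Omega>. \<psi> x - ereal (\<phi> x) \<le> \<psi> x0 - ereal (\<phi> x0))"

definition touches_below ::
    "(real^'n) set \<Rightarrow> (real^'n \<Rightarrow> ereal) \<Rightarrow> real^'n \<Rightarrow> (real^'n \<Rightarrow> real) \<Rightarrow> bool" where
  "touches_below \<Omega> \<psi> x0 \<phi> \<longleftrightarrow> C2_near x0 \<phi> \<and>
     (\<forall>\<^sub>F x in at x0 within \<Omega>. \<psi> x - ereal (\<phi> x) \<ge> \<psi> x0 - ereal (\<phi> x0))"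

definition k_convex :: "nat \<Rightarrow> (real^'n) set \<Rightarrow> (real^'n \<Rightarrow> ereal) \<Rightarrow> bool" where
  "k_convex k \<Omega> \<psi> \<longleftrightarrow> \<psi> \<in> USC \<Omega> \<and>
     (\<forall>x0\<in>\<Omega>. \<forall>\<phi>. touches_above \<Omega> \<psi> x0 \<phi> \<longrightarrow> hessian \<phi> x0 \<in> Sigma_cone k)"

definition admissible_solution ::
    "nat \<Rightarrow> (real^'n) set \<Rightarrow> (real^'n \<Rightarrow> real \<Rightarrow> real) \<Rightarrow> (real^'n \<Rightarrow> real) \<Rightarrow> bool" where
  "admissible_solution k \<Omega> g u \<longleftrightarrow> continuous_on (closure \<Omega>) u \<and>
     (\<forall>x0\<in>\<Omega>. \<forall>\<phi>.
        (touches_above \<Omega> (\<lambda>x. ereal (u x)) x0 \<phi> \<longrightarrow>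
           Sk k (hessian \<phi> x0) \<ge> g x0 (u x0) \<and> hessian \<phi> x0 \<in> Sigma_cone k) \<and>
        (touches_below \<Omega> (\<lambda>x. ereal (u x)) x0 \<phi> \<longrightarrow>
           Sk k (hessian \<phi> x0) \<le> g x0 (u x0) \<or> hessian \<phi> x0 \<notin> Sigma_cone k))"


section \<open>The principal eigenvalue\<close>

definition Phi_minus :: "nat \<Rightarrow> (real^'n) set \<Rightarrow> (real^'n \<Rightarrow> ereal) set" where
  "Phi_minus k \<Omega> = {\<psi> \<in> USC \<Omega>. k_convex k \<Omega> \<psi> \<and> (\<forall>x\<in>\<Omega>. \<psi> x < 0)}"

definition Lambda_set :: "nat \<Rightarrow> (real^'n) set \<Rightarrow> real set" where
  "Lambda_set k \<Omega> = {\<mu>. \<exists>\<psi>\<in>Phi_minus k \<Omega>. \<forall>x0\<in>\<Omega>. \<forall>\<phi>. touches_above \<Omega> \<psi> x0 \<phi> \<longrightarrow>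
     ereal (Sk k (hessian \<phi> x0)) + ereal \<mu> * \<psi> x0 * \<bar>\<psi> x0\<bar> ^ (k - 1) \<ge> 0}"

text \<open>Taken in the extended reals, so that no boundedness of the set is presupposed.\<close>

definition lambda1 :: "nat \<Rightarrow> (real^'n) set \<Rightarrow> ereal" where
  "lambda1 k \<Omega> = (SUP \<mu>\<in>Lambda_set k \<Omega>. ereal \<mu>)"


section \<open>Domains with \<open>C\<^sup>2\<close> boundary and their curvatures\<close>

text \<open>Near \<open>y\<close> the set \<open>\<Omega>\<close> is the region above the graph, in direction \<open>\<nu>\<close>, of a \<open>C\<^sup>2\<close> function
  over the hyperplane \<open>y + \<nu>\<^sup>\<bottom>\<close>. The function is written on the whole space, but only its
  restriction to \<open>\<nu>\<^sup>\<bottom>\<close> matters.\<close>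

definition local_graph ::
    "(real^'n) set \<Rightarrow> real^'n \<Rightarrow> real^'n \<Rightarrow> (real^'n \<Rightarrow> real) \<Rightarrow> bool" where
  "local_graph \<Omega> y \<nu> \<phi> \<longleftrightarrow> norm \<nu> = 1 \<and>
     (\<exists>r>0. C2_on (ball 0 r) \<phi> \<and>
        (\<forall>z\<in>ball 0 r. y + z \<in> \<Omega> \<longleftrightarrow> z \<bullet> \<nu> > \<phi> (z - (z \<bullet> \<nu>) *\<^sub>R \<nu>)))"

definition C2_boundary :: "(real^'n) set \<Rightarrow> bool" where
  "C2_boundary \<Omega> \<longleftrightarrow> (\<forall>y\<in>frontier \<Omega>. \<exists>\<nu> \<phi>. local_graph \<Omega> y \<nu> \<phi>)"

text \<open>When the gradient of \<open>\<phi>\<close> along \<open>\<nu>\<^sup>\<bottom>\<close> vanishes at \<open>0\<close>, that is, when the graph is taken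
  over the tangent hyperplane at \<open>y\<close>, \<open>\<nu>\<close> is the inner unit normal and the principal curvatures
  are the eigenvalues of the Hessian of \<open>\<phi>\<close> on \<open>\<nu>\<^sup>\<bottom>\<close>; the orthonormal basis \<open>e\<close> consists of
  principal directions. For the unit ball, \<open>\<phi> z = 1 - sqrt (1 - (norm z)\<^sup>2)\<close> on \<open>\<nu>\<^sup>\<bottom>\<close> and all
  curvatures are \<open>1\<close>.\<close>

definition principal_curvatures :: "(real^'n) set \<Rightarrow> real^'n \<Rightarrow> (nat \<Rightarrow> real) \<Rightarrow> bool" where
  "principal_curvatures \<Omega> y \<kappa> \<longleftrightarrow>
     (\<exists>\<nu> \<phi> e. local_graph \<Omega> y \<nu> \<phi> \<and> (\<forall>v. v \<bullet> \<nu> = 0 \<longrightarrow> grad \<phi> 0 \<bullet> v = 0) \<and>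
        (\<forall>i<CARD('n) - 1. e i \<bullet> \<nu> = 0) \<and>
        (\<forall>i<CARD('n) - 1. \<forall>j<CARD('n) - 1. e i \<bullet> e j = (if i = j then 1 else 0)) \<and>
        (\<forall>i<CARD('n) - 1. \<forall>j<CARD('n) - 1.
           e i \<bullet> (hessian \<phi> 0 *v e j) = (if i = j then \<kappa> i else 0)))"

text \<open>At each point of a \<open>C\<^sup>2\<close> boundary the principal curvatures exist and are unique up to order,
  so the choice of \<open>\<kappa>\<close> is immaterial.\<close>

definition strictly_m_convex :: "nat \<Rightarrow> (real^'n) set \<Rightarrow> bool" where
  "strictly_m_convex m \<Omega> \<longleftrightarrow>
     (\<forall>y\<in>frontier \<Omega>. \<exists>\<kappa>. principal_curvatures \<Omega> y \<kappa> \<and>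
        (\<forall>j\<in>{1..m}. esym {..<CARD('n) - 1} j \<kappa> > 0))"

definition sup_norm :: "(real^'n) set \<Rightarrow> (real^'n \<Rightarrow> real) \<Rightarrow> real" where
  "sup_norm \<Omega> u = (SUP x\<in>\<Omega>. \<bar>u x\<bar>)"

end

theory Submission
  imports Defs "HOL-Computational_Algebra.Fundamental_Theorem_Algebra"
    "HOL-Complex_Analysis.Great_Picard"
begin

text \<open>
  Every \<open>k\<close>-convex function satisfies \<open>\<psi>(x) \<le> \<psi>(y) (1 - (|x - y|/R)\<^sup>\<alpha>)\<close> on a ball of radius \<open>R\<close>
  around \<open>y\<close> where it is nonpositive, for \<open>0 < \<alpha> < 2 - N/k\<close>: the Hessian of \<open>|x - y|\<^sup>\<alpha>\<close> has
  \<open>S\<^sub>k < 0\<close>, so no positive multiple of it can touch \<open>\<psi>\<close> from above. Touching in addition with a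
  paraboloid, this bounds \<open>\<lambda>\<^sub>1\<close>; it also gives interior equicontinuity of the \<open>w\<^sub>n\<close> and the strong
  maximum principle. Since \<open>S\<^sub>k(D\<^sup>2v\<^sub>n) \<ge> 1 + \<lambda>\<^sub>n|v\<^sub>n|\<^sup>k\<close>, the function \<open>v\<^sub>n\<close> itself shows that
  \<open>\<lambda>\<^sub>n + 1/\<parallel>v\<^sub>n\<parallel>\<^sup>k \<le> \<lambda>\<^sub>1\<close>, hence \<open>\<parallel>v\<^sub>n\<parallel> \<rightarrow> \<infinity>\<close> and the equations for \<open>w\<^sub>n\<close> have right-hand sides at most
  \<open>\<lambda>\<^sub>1\<close>. Strict \<open>(k - 1)\<close>-convexity provides a quadratic lower barrier at each boundary point, which
  gives equicontinuity there. Arzela--Ascoli and the stability of viscosity solutions under uniform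
  limits then produce the eigenfunction; it does not vanish identically because its norm is \<open>1\<close>.
\<close>

section \<open>Elementary symmetric functions\<close>

text \<open>Every comparison in the proof is between a viscosity solution and an explicit smooth
  function, so the definition of touching suffices and no comparison principle for two viscosity
  solutions enters. The Hessian of |x - y|^\<alpha> has one radial eigenvalue proportional to
  \<alpha> - 1 and N - 1 tangential ones proportional to 1, so S_k is a positive multiple of N/k - 2
  + \<alpha>. An exponent that is positive, which makes the power continuous at y, and still gives
  S_k < 0 exists exactly when k > N/2. Two features of the definitions shape the rest. The
  eigenvalues are an arbitrary choice, so S_k is evaluated through orthonormal eigenbases or
  determinants. Membership in the cone includes symmetry of the matrix, while symmetry of the
  Hessian of a test function is never derived from its regularity: it is read off from cone
  membership, or the test function is replaced by a quadratic polynomial with symmetric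
  matrix.\<close>

lemma esym_0: "finite I \<Longrightarrow> esym I 0 l = 1"
proof -
  assume "finite I"
  then have "{J. J \<subseteq> I \<and> card J = 0} = {{}}"
    by (auto dest: finite_subset)
  then show ?thesis by (simp add: esym_def)
qed

lemma esym_empty_Suc: "esym {} (Suc j) l = 0"
proof -
  have "{J. J \<subseteq> {} \<and> card J = Suc j} = {}" by auto
  then show ?thesis by (simp add: esym_def)
qed

lemma esym_insert_Suc:
  assumes I: "finite I" and a: "a \<notin> I"
  shows "esym (insert a I) (Suc j) l = esym I (Suc j) l + l a * esym I j l"
proof -
  let ?A = "{J. J \<subseteq> I \<and> card J = Suc j}" and ?B = "{J. J \<subseteq> I \<and> card J = j}"
  have fin: "finite J" if "J \<subseteq> I" for J using that I by (rule finite_subset)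
  have split: "{J. J \<subseteq> insert a I \<and> card J = Suc j} = ?A \<union> insert a ` ?B"
  proof (intro equalityI subsetI)
    fix J assume J: "J \<in> {J. J \<subseteq> insert a I \<and> card J = Suc j}"
    show "J \<in> ?A \<union> insert a ` ?B"
    proof (cases "a \<in> J")
      case True
      then have "J = insert a (J - {a})" "J - {a} \<in> ?B" using J by auto
      then show ?thesis by blast
    next
      case False
      then show ?thesis using J by auto
    qed
  next
    fix J assume "J \<in> ?A \<union> insert a ` ?B"
    then show "J \<in> {J. J \<subseteq> insert a I \<and> card J = Suc j}"
      using a fin by (auto simp: card_insert_if)
  qed
  have inj: "inj_on (insert a) ?B"
  proof (rule inj_onI)
    fix x y assume "x \<in> ?B" "y \<in> ?B" and eq: "insert a x = insert a y"
    then have "a \<notin> x" "a \<notin> y" using a by auto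
    then show "x = y" using eq by (simp add: insert_ident)
  qed
  have "(\<Sum>J\<in>insert a ` ?B. \<Prod>i\<in>J. l i) = (\<Sum>J\<in>?B. \<Prod>i\<in>insert a J. l i)"
    by (subst sum.reindex[OF inj]) simp
  also have "\<dots> = l a * esym I j l"
    unfolding esym_def sum_distrib_left
    by (intro sum.cong refl) (use a fin in \<open>auto intro!: prod.insert\<close>)
  finally have 1: "(\<Sum>J\<in>insert a ` ?B. \<Prod>i\<in>J. l i) = l a * esym I j l" .
  have "?A \<inter> insert a ` ?B = {}" using a by auto
  moreover have "finite ?A" "finite ?B" using I by auto
  ultimately show ?thesis
    using 1 by (simp add: esym_def split sum.union_disjoint)
qed

text \<open>The generating polynomial of the \<sigma>_j. It is stated over any real field because
  the real form identifies symmetric functions and the complex form serves to locate roots.\<close>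

lemma coeff_prod_linear:
  assumes "finite I"
  shows "coeff (\<Prod>i\<in>I. [:1, of_real (l i):]) j = (of_real (esym I j l) :: 'a::real_field)"
  using assms
proof (induction I arbitrary: j rule: finite_induct)
  case empty
  show ?case by (cases j) (simp_all add: esym_0 esym_empty_Suc)
next
  case (insert a I)
  show ?case
  proof (cases j)
    case 0
    have "coeff (\<Prod>i\<in>J. [:1, of_real (l i) :: 'a:]) 0 = 1" for J
      by (simp add: poly_0_coeff_0[symmetric] poly_prod)
    then show ?thesis using 0 insert by (simp add: esym_0)
  next
    case (Suc m)
    then show ?thesis using insert by (simp add: esym_insert_Suc)
  qed
qed

lemma poly_prod_linear: "poly (\<Prod>i\<in>I. [:1, l i:]) t = (\<Prod>i\<in>I. 1 + t * l i)"
  by (simp add: poly_prod)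

text \<open>Equal generating polynomials have equal coefficients. At t = 0 both products are 1;
  leaving this value out allows the passage to -1/t, which leads to characteristic
  polynomials.\<close>

lemma esym_eqI:
  assumes "finite I" "finite J"
    and eq: "\<And>t. t \<noteq> 0 \<Longrightarrow> (\<Prod>i\<in>I. 1 + t * l i) = (\<Prod>i\<in>J. 1 + t * m i)"
  shows "esym I j l = esym J j m"
proof -
  have "(\<Prod>i\<in>I. 1 + t * l i) = (\<Prod>i\<in>J. 1 + t * m i)" for t
    using eq[of t] by (cases "t = 0") auto
  then have "poly (\<Prod>i\<in>I. [:1, l i:]) = poly (\<Prod>i\<in>J. [:1, m i:])"
    by (simp add: fun_eq_iff poly_prod_linear)
  then show ?thesis
    using coeff_prod_linear[OF assms(1), of l j, where 'a=real]
      coeff_prod_linear[OF assms(2), of m j, where 'a=real]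
    by (simp add: poly_eq_poly_eq_iff)
qed

lemma esym_scale: "esym I j (\<lambda>i. c * l i) = c ^ j * esym I j l"
  by (auto simp: esym_def sum_distrib_left prod.distrib intro!: sum.cong)

lemma esym_tendsto:
  assumes "\<And>i. ((\<lambda>x. f x i) \<longlongrightarrow> l i) F"
  shows "((\<lambda>x. esym I j (f x)) \<longlongrightarrow> esym I j l) F"
  unfolding esym_def by (intro tendsto_sum tendsto_prod assms)

lemma esym_const: "finite I \<Longrightarrow> esym I j (\<lambda>i. c) = real (card I choose j) * c ^ j"
  by (auto simp: esym_def n_subsets)

text \<open>Differentiation deletes one index from a (j+1)-subset, and each j-subset arises in this
  way from \<open>card I - j\<close> of them.\<close>

lemma esym_shift_DERIV:
  assumes "finite I"
  shows "((\<lambda>t. esym I (Suc j) (\<lambda>i. l i + t)) has_real_derivative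
           (real (card I) - real j) * esym I j (\<lambda>i. l i + t)) (at t)"
  using assms
proof (induction I arbitrary: j rule: finite_induct)
  case empty
  show ?case by (cases j) (simp_all add: esym_0 esym_empty_Suc)
next
  case (insert a I)
  show ?case
  proof (cases j)
    case 0
    then show ?thesis
      using insert by (auto simp: esym_insert_Suc esym_0 intro!: derivative_eq_intros)
  next
    case (Suc i)
    have "((\<lambda>t. esym I (Suc (Suc i)) (\<lambda>i. l i + t) + (l a + t) * esym I (Suc i) (\<lambda>i. l i + t))
        has_real_derivative (real (card I) - real (Suc i)) * esym I (Suc i) (\<lambda>i. l i + t)
          + ((0 + 1) * esym I (Suc i) (\<lambda>i. l i + t)
          + ((real (card I) - real i) * esym I i (\<lambda>i. l i + t)) * (l a + t))) (at t)"
      by (intro DERIV_add DERIV_mult DERIV_const DERIV_ident insert.IH)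
    then show ?thesis
      using insert(1,2) unfolding Suc by (simp add: esym_insert_Suc algebra_simps)
  qed
qed

text \<open>Induction on j: along the diagonal, the derivative of \<sigma>_(j+1) is a positive
  multiple of \<sigma>_j, which is already positive for every positive shift. A small diagonal shift
  thus moves points satisfying the nonstrict inequalities into the open cone.\<close>

lemma esym_shift_pos:
  assumes I: "finite I" and nonneg: "\<And>i. i \<in> {1..k} \<Longrightarrow> esym I i l \<ge> 0"
    and "k \<le> card I" "j \<le> k" "t > 0"
  shows "esym I j (\<lambda>i. l i + t) > 0"
  using assms(4,5)
proof (induction j arbitrary: t)
  case 0
  then show ?case using I by (simp add: esym_0)
next
  case (Suc j)
  have "esym I (Suc j) (\<lambda>i. l i + 0) < esym I (Suc j) (\<lambda>i. l i + t)"
  proof (rule DERIV_pos_imp_increasing_open[OF \<open>t > 0\<close>])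
    fix s :: real assume "0 < s" "s < t"
    then show "\<exists>y. ((\<lambda>t. esym I (Suc j) (\<lambda>i. l i + t)) has_real_derivative y) (at s) \<and> 0 < y"
      using Suc assms(3)
      by (intro exI[of _ "(real (card I) - real j) * esym I j (\<lambda>i. l i + s)"] conjI
          esym_shift_DERIV[OF I] mult_pos_pos) auto
  next
    show "continuous_on {0..t} (\<lambda>t. esym I (Suc j) (\<lambda>i. l i + t))"
      by (intro continuous_at_imp_continuous_on ballI DERIV_isCont[OF esym_shift_DERIV[OF I]])
  qed
  then show ?case using nonneg[of "Suc j"] Suc by simp
qed

text \<open>Nonstrict inequalities survive limits; conversely, diagonal shifts by 1/(n+1)
  approximate a point satisfying them from inside the cone.\<close>

lemma closure_Gamma:
  assumes k: "k \<le> CARD('n)"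
  shows "closure (Gamma k) = {l::real^'n. \<forall>j\<in>{1..k}. esym UNIV j (($) l) \<ge> 0}"
proof (intro equalityI subsetI)
  fix l :: "real^'n" assume "l \<in> closure (Gamma k)"
  then obtain f where f: "\<And>n. f n \<in> Gamma k" "f \<longlonglongrightarrow> l"
    by (auto simp: closure_sequential)
  have lim: "(\<lambda>n. esym UNIV j (($) (f n))) \<longlonglongrightarrow> esym UNIV j (($) l)" for j
    by (intro esym_tendsto tendsto_vec_nth f)
  have "0 \<le> esym UNIV j (($) l)" if "j \<in> {1..k}" for j
    using f(1) that
    by (intro LIMSEQ_le_const[OF lim] exI[of _ 0] allI impI less_imp_le) (auto simp: Gamma_def)
  then show "l \<in> {l. \<forall>j\<in>{1..k}. esym UNIV j (($) l) \<ge> 0}"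
    by simp
next
  fix l :: "real^'n" assume l: "l \<in> {l. \<forall>j\<in>{1..k}. esym UNIV j (($) l) \<ge> 0}"
  define f where "f n = (\<chi> i. l $ i + inverse (real (Suc n)))" for n
  have "($) (f n) = (\<lambda>i. l $ i + inverse (real (Suc n)))" for n
    by (auto simp: f_def)
  then have "f n \<in> Gamma k" for n
    unfolding Gamma_def mem_Collect_eq using l k
    by (auto intro!: esym_shift_pos[where k=k])
  moreover have "f \<longlonglongrightarrow> l"
    by (rule vec_tendstoI) (use LIMSEQ_inverse_real_of_nat_add in \<open>auto simp: f_def\<close>)
  ultimately show "l \<in> closure (Gamma k)"
    by (auto simp: closure_sequential)
qed

text \<open>As in the Gauss--Lucas theorem, the logarithmic derivative of a product of factors \<open>z - x\<close>
  with real \<open>x\<close> has nonzero imaginary part off the real axis.\<close>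

lemma poly_pderiv_prod_mset:
  fixes z :: complex
  assumes "z \<notin># R"
  shows "poly (pderiv (\<Prod>x\<in>#R. [:-x, 1:])) z =
    poly (\<Prod>x\<in>#R. [:-x, 1:]) z * (\<Sum>x\<in>#R. 1 / (z - x))"
  using assms
proof (induction R)
  case empty
  then show ?case by simp
next
  case (add x R)
  let ?Q = "\<Prod>x\<in>#R. [:-x, 1:]"
  have "poly (pderiv ([:-x, 1:] * ?Q)) z = (z - x) * poly (pderiv ?Q) z + poly ?Q z"
    by (simp add: pderiv_mult pderiv_pCons del: mult_pCons_left)
  also have "\<dots> = (z - x) * (poly ?Q z * (\<Sum>x\<in>#R. 1 / (z - x))) + poly ?Q z"
    using add by simp
  also have "\<dots> = poly ([:-x, 1:] * ?Q) z * (1 / (z - x) + (\<Sum>x\<in>#R. 1 / (z - x)))"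
    using add.prems by (simp add: field_simps)
  finally show ?case
    by (simp del: mult_pCons_left)
qed

lemma pderiv_real_roots:
  fixes p :: "complex poly"
  assumes real: "\<And>z. poly p z = 0 \<Longrightarrow> Im z = 0" and "poly (pderiv p) z = 0" and nz: "pderiv p \<noteq> 0"
  shows "Im z = 0"
proof (rule ccontr)
  assume im: "Im z \<noteq> 0"
  define R where "R = proots p"
  have p0: "p \<noteq> 0" using nz by auto
  have dec: "p = smult (lead_coeff p) (\<Prod>x\<in>#R. [:-x, 1:])"
    unfolding R_def by (rule complex_poly_decompose_multiset[symmetric])
  have R: "Im x = 0" if "x \<in># R" for x
    using that real p0 by (auto simp: R_def)
  have zR: "z \<notin># R" using R im by auto
  then have pz: "poly p z \<noteq> 0" using p0 by (auto simp: R_def)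
  have ne: "R \<noteq> {#}"
  proof
    assume "R = {#}"
    then have "p = [:lead_coeff p:]" using dec by (metis image_mset_empty prod_mset_empty smult_one)
    then show False using nz by (metis pderiv_pCons pderiv_0 mult_zero_left add_0 pCons_0_0)
  qed
  have "poly (pderiv p) z = lead_coeff p * (poly (\<Prod>x\<in>#R. [:-x, 1:]) z * (\<Sum>x\<in>#R. 1 / (z - x)))"
    by (subst dec) (simp add: pderiv_smult poly_pderiv_prod_mset[OF zR])
  also have "\<dots> = poly p z * (\<Sum>x\<in>#R. 1 / (z - x))"
    by (subst (2) dec) simp
  finally have "(\<Sum>x\<in>#R. 1 / (z - x)) = 0" using assms(2) pz by simp
  \<comment> \<open>For real x, Im (1/(z - x)) = - Im z / |z - x|^2, so all summands have the sign
    opposite to Im z and cannot cancel.\<close>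
  moreover have "Im z * Im (\<Sum>x\<in>#R. 1 / (z - x)) < 0"
    using ne R
  proof (induction R rule: multiset_induct)
    case empty
    then show ?case by simp
  next
    case (add x R)
    have zx: "z \<noteq> x" using add.prems(2)[of x] im by auto
    then have "(Re z - Re x)\<^sup>2 + (Im z)\<^sup>2 > 0"
      using im by (simp add: sum_power2_gt_zero_iff)
    then have 1: "Im z * Im (1 / (z - x)) < 0"
      using add.prems(2)[of x] im
      by (simp add: Im_divide power2_eq_square divide_simps mult_less_0_iff zero_less_mult_iff) linarith
    show ?case
    proof (cases "R = {#}")
      case True
      then show ?thesis using 1 by simp
    next
      case False
      then have "Im z * Im (\<Sum>x\<in>#R. 1 / (z - x)) < 0" using add by simp
      then show ?thesis using 1 by (simp add: distrib_left)
    qed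
  qed
  ultimately show False by simp
qed

lemma higher_pderiv_real_roots:
  fixes p :: "complex poly"
  assumes "\<And>z. poly p z = 0 \<Longrightarrow> Im z = 0" "poly ((pderiv ^^ m) p) z = 0" "(pderiv ^^ m) p \<noteq> 0"
  shows "Im z = 0"
  using assms(2,3)
proof (induction m arbitrary: z)
  case 0
  then show ?case using assms(1) by simp
next
  case (Suc m)
  have "(pderiv ^^ m) p \<noteq> 0" using Suc.prems(2) by auto
  then show ?case
    using pderiv_real_roots[of "(pderiv ^^ m) p" z] Suc by simp
qed

text \<open>Factors z - x with x < 0 have positive coefficients, and so do their products. The roots
  come from a factorisation over the complex numbers, hence the separate statement on imaginary
  parts.\<close>

lemma coeff_prod_mset_pos:
  fixes R :: "complex multiset"
  assumes "\<And>x. x \<in># R \<Longrightarrow> Im x = 0 \<and> Re x < 0" "i \<le> size R"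
  shows "Im (coeff (\<Prod>x\<in>#R. [:-x, 1:]) i) = 0 \<and> Re (coeff (\<Prod>x\<in>#R. [:-x, 1:]) i) > 0"
  using assms
proof (induction R arbitrary: i)
  case empty
  then show ?case by simp
next
  case (add x R)
  let ?q = "\<Prod>x\<in>#R. [:-x, 1:]"
  have deg: "degree ?q = size R"
  proof (induction R)
    case (add x R)
    have "(\<Prod>x\<in>#R. [:-x, 1:]) \<noteq> 0" by (auto simp: prod_mset_zero_iff)
    then have "degree ([:-x, 1:] * (\<Prod>x\<in>#R. [:-x, 1:])) = 1 + degree (\<Prod>x\<in>#R. [:-x, 1:])"
      by (subst degree_mult_eq) auto
    then show ?case using add by (simp del: mult_pCons_left)
  qed simp
  have IH: "Im (coeff ?q j) = 0 \<and> Re (coeff ?q j) > 0" if "j \<le> size R" for j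
    using add that by auto
  have x: "Im x = 0" "Re x < 0" using add.prems by auto
  show ?case
  proof (cases i)
    case 0
    then show ?thesis using IH[of 0] x by (simp add: mult_less_0_iff)
  next
    case (Suc j)
    then have j: "j \<le> size R" using add.prems by simp
    show ?thesis
    proof (cases "i \<le> size R")
      case True
      then have "- (Re x * Re (coeff ?q (Suc j))) > 0"
        using IH[of i] x Suc by (simp add: mult_less_0_iff)
      then show ?thesis
        using IH[of i] IH[OF j] x Suc True by (simp add: add_pos_pos)
    next
      case False
      then have "coeff ?q (Suc j) = 0" using Suc deg by (simp add: coeff_eq_0)
      then show ?thesis using IH[OF j] Suc by simp
    qed
  qed
qed

text \<open>After \<open>N - k\<close> differentiations of \<open>\<Prod>(z + l\<^sub>i)\<close> one gets a
  polynomial of degree \<open>k\<close> with only real roots and coefficients proportional to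
  \<open>\<sigma>\<^sub>0, \<dots>, \<sigma>\<^sub>k\<close>; its roots are negative, so all coefficients are positive.\<close>

lemma esym_pos_of_nonneg:
  assumes I: "finite I" and k: "k \<le> card I"
    and nonneg: "\<And>i. i \<in> {1..k} \<Longrightarrow> esym I i l \<ge> 0"
    and pos: "esym I k l > 0" and j: "j \<le> k"
  shows "esym I j l > 0"
proof -
  define N where "N = card I"
  define p where "p = (\<Prod>i\<in>I. [:complex_of_real (l i), 1:])"
  define r where "r = (pderiv ^^ (N - k)) p"
  have degp: "degree p = N"
    unfolding p_def N_def by (subst degree_prod_eq_sum_degree) auto
  have "reflect_poly [:a, 1:] = [:1, a:]" for a :: complex
    by (simp add: reflect_poly_def)
  then have "reflect_poly p = (\<Prod>i\<in>I. [:1, complex_of_real (l i):])"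
    by (simp add: p_def reflect_poly_prod)
  then have coeffp: "coeff p (N - j) = of_real (esym I j l)" if "j \<le> N" for j
    using that coeff_prod_linear[OF I, of l j, where 'a=complex] coeff_reflect_poly[of p j] degp
    by simp
  \<comment> \<open>The product (k-j+1)...(N-j), by which N - k differentiations multiply the
    coefficient of z^(N-j).\<close>
  define c where "c j = pochhammer (real (Suc (k - j))) (N - k)" for j
  have c: "c j > 0" for j
    unfolding c_def by (intro pochhammer_pos) simp
  have coeffr: "coeff r (k - j) = of_real (c j * esym I j l)" if "j \<le> k" for j
  proof -
    have "(k - j) + (N - k) = N - j" using that k by (auto simp: N_def)
    moreover have "pochhammer (of_nat (Suc (k - j))) (N - k) = complex_of_real (c j)"
      unfolding c_def by (simp only: pochhammer_of_real[symmetric] of_real_of_nat_eq)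
    ultimately show ?thesis
      unfolding r_def using coeffp[of j] that k
      by (simp only: coeff_higher_pderiv N_def of_real_mult)
  qed
  have degr: "degree r = k"
    unfolding r_def using k by (simp add: degree_higher_pderiv degp N_def)
  have lead: "coeff r k = of_real (c 0)" using coeffr[of 0] I by (simp add: esym_0)
  then have r0: "r \<noteq> 0" using c[of 0] by auto
  have rcoeff: "\<exists>a\<ge>0. coeff r i = of_real a" if "i \<le> k" for i
  proof -
    have "esym I (k - i) l \<ge> 0"
      using nonneg[of "k - i"] I by (cases "k - i = 0") (auto simp: esym_0)
    then show ?thesis
      using coeffr[of "k - i"] that c[of "k - i"] by (auto intro!: exI[of _ "c (k - i) * esym I (k - i) l"])
  qed
  have neg: "Im z = 0 \<and> Re z < 0" if z: "poly r z = 0" for z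
  proof -
    have "Im z = 0" if "poly p z = 0" for z
    proof -
      have "\<exists>i\<in>I. of_real (l i) + z = 0"
        using that I by (simp add: p_def poly_prod)
      then obtain i where "of_real (l i) + z = 0" by blast
      then have "Im (of_real (l i) + z) = 0" by simp
      then show ?thesis by simp
    qed
    then have im: "Im z = 0"
      using higher_pderiv_real_roots[of p "N - k" z] z r0 unfolding r_def by blast
    have "Re z < 0"
    proof (rule ccontr)
      assume "\<not> Re z < 0"
      then have re: "Re z \<ge> 0" by simp
      have zr: "z = of_real (Re z)" using im by (simp add: complex_eq_iff)
      have nn: "Re (coeff r i * z ^ i) \<ge> 0" if i: "i \<le> k" for i
      proof -
        obtain a where "a \<ge> 0" "coeff r i = of_real a" using rcoeff[OF i] by auto
        moreover have "z ^ i = of_real (Re z ^ i)" by (metis zr of_real_power)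
        ultimately have "coeff r i * z ^ i = of_real (a * Re z ^ i)" by (simp only: of_real_mult)
        then show ?thesis using \<open>a \<ge> 0\<close> re by (simp only: Re_complex_of_real) simp
      qed
      \<comment> \<open>The constant coefficient is a positive multiple of \<sigma>_k, the one
        strict hypothesis; as the other coefficients are nonnegative, r is positive on the
        nonnegative half-line.\<close>
      have "0 < Re (coeff r 0 * z ^ 0)"
        using coeffr[of k] c[of k] pos by simp
      also have "\<dots> \<le> (\<Sum>i\<le>k. Re (coeff r i * z ^ i))"
        by (rule member_le_sum) (use nn in auto)
      also have "\<dots> = Re (poly r z)"
        by (simp add: poly_altdef degr)
      finally show False using z by simp
    qed
    then show ?thesis using im by simp
  qed
  define R where "R = proots r"
  have dec: "r = smult (lead_coeff r) (\<Prod>x\<in>#R. [:-x, 1:])"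
    unfolding R_def by (rule complex_poly_decompose_multiset[symmetric])
  have sz: "size R = k"
    unfolding R_def using degr by (simp add: size_proots_complex)
  have "Re (coeff (\<Prod>x\<in>#R. [:-x, 1:]) (k - j)) > 0"
    using coeff_prod_mset_pos[of R "k - j"] neg r0 sz by (auto simp: R_def)
  moreover have "coeff r (k - j) = coeff r k * coeff (\<Prod>x\<in>#R. [:-x, 1:]) (k - j)"
    by (subst dec) (simp add: degr)
  ultimately have "Re (coeff r (k - j)) > 0"
    using lead c[of 0] by simp
  then show ?thesis
    using coeffr[OF j] c[of j] by (simp add: zero_less_mult_iff)
qed

section \<open>Symmetric matrices\<close>

lemma mat_vec_mult: "mat a *v x = a *\<^sub>R (x :: real^'n)"
proof -
  have "mat a = a *\<^sub>R (mat 1 :: real^'n^'n)" by (simp add: vec_eq_iff mat_def)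
  then show ?thesis by (simp add: scaleR_matrix_vector_assoc[symmetric])
qed

text \<open>Diagonalisation by the orthogonal matrix with columns \<open>e i\<close>. The two
  parameters cover both t - A, the characteristic polynomial, and 1 + tA, the generating polynomial
  of the S_j.\<close>

lemma det_orthonormal_eigenbasis:
  fixes A :: "real^'n^'n" and e :: "'n \<Rightarrow> real^'n"
  assumes on: "\<And>i j. e i \<bullet> e j = (if i = j then 1 else 0)"
    and eig: "\<And>i. A *v e i = l i *\<^sub>R e i"
  shows "det (mat a + b *\<^sub>R A) = (\<Prod>i\<in>UNIV. a + b * l i)"
proof -
  define P :: "real^'n^'n" where "P = (\<chi> i j. e j $ i)"
  define D :: "real^'n^'n" where "D = (\<chi> i j. if i = j then a + b * l i else 0)"
  have col: "column j P = e j" for j by (simp add: column_def P_def vec_eq_iff)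
  have "orthogonal_matrix P"
    using on by (auto simp: orthogonal_matrix_orthonormal_columns col norm_eq_1 orthogonal_def)
  then have dP: "det P \<noteq> 0" using det_orthogonal_matrix[of P] by auto
  have "((mat a + b *\<^sub>R A) ** P) $ i $ j = (P ** D) $ i $ j" for i j
  proof -
    have "((mat a + b *\<^sub>R A) ** P) $ i $ j = ((mat a + b *\<^sub>R A) *v e j) $ i"
      by (simp add: matrix_matrix_mult_def matrix_vector_mult_def P_def)
    also have "\<dots> = (a + b * l j) * e j $ i"
      by (simp add: matrix_vector_mult_add_rdistrib mat_vec_mult scaleR_matrix_vector_assoc[symmetric]
          eig algebra_simps)
    also have "\<dots> = (P ** D) $ i $ j"
      by (simp add: matrix_matrix_mult_def P_def D_def if_distrib if_distribR cong: if_cong)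
    finally show ?thesis .
  qed
  then have "(mat a + b *\<^sub>R A) ** P = P ** D"
    by (simp add: vec_eq_iff)
  then have "det (mat a + b *\<^sub>R A) * det P = det P * det D"
    by (metis det_mul)
  then have "det (mat a + b *\<^sub>R A) = det D" using dP by simp
  also have "\<dots> = (\<Prod>i\<in>UNIV. a + b * l i)"
    by (subst det_diagonal) (auto simp: D_def)
  finally show ?thesis .
qed

lemma symmetric_inner:
  fixes A :: "real^'n^'n"
  assumes "transpose A = A"
  shows "x \<bullet> (A *v y) = (A *v x) \<bullet> y"
  by (metis assms dot_lmul_matrix vector_transpose_matrix)

text \<open>The spectral theorem, on an invariant subspace so that induction on the dimension works:
  a maximiser of the quadratic form on the unit sphere of S is an eigenvector, and its orthogonal
  complement within S is again invariant.\<close>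

lemma symmetric_invariant_subspace_basis:
  fixes A :: "real^'n^'n"
  assumes A: "transpose A = A" and "subspace S" "\<And>x. x \<in> S \<Longrightarrow> A *v x \<in> S"
  shows "\<exists>B\<subseteq>S. finite B \<and> card B = dim S \<and> pairwise orthogonal B \<and>
           (\<forall>b\<in>B. norm b = 1 \<and> (\<exists>c. A *v b = c *\<^sub>R b))"
  using assms(2,3)
proof (induction "dim S" arbitrary: S rule: less_induct)
  case less
  show ?case
  proof (cases "dim S = 0")
    case True
    then show ?thesis by (intro exI[of _ "{}"]) (auto simp: pairwise_def)
  next
    case False
    then obtain w where w: "w \<in> S" "w \<noteq> 0"
      by (metis dim_eq_0 subset_singletonD subsetI singleton_iff empty_iff)
    define K where "K = S \<inter> sphere 0 1"
    have "compact K" unfolding K_def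
      by (metis closed_subspace compact_sphere compact_Int_closed Int_commute less.prems(1))
    moreover have "(1 / norm w) *\<^sub>R w \<in> K"
      using w less.prems(1) by (simp add: K_def subspace_scale)
    moreover have "continuous_on K (\<lambda>x. x \<bullet> (A *v x))"
      by (intro continuous_intros matrix_vector_mult_linear_continuous_on)
    ultimately obtain u where u: "u \<in> K" and max: "\<And>x. x \<in> K \<Longrightarrow> x \<bullet> (A *v x) \<le> u \<bullet> (A *v u)"
      by (metis continuous_attains_sup empty_iff)
    define c where "c = u \<bullet> (A *v u)"
    have uS: "u \<in> S" and uu: "u \<bullet> u = 1" using u by (auto simp: K_def norm_eq_1)
    have max': "x \<bullet> (A *v x) \<le> c * (x \<bullet> x)" if x: "x \<in> S" for x
    proof (cases "x = 0")
      case False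
      define y where "y = (1 / norm x) *\<^sub>R x"
      have "y \<in> K" using x False less.prems(1) by (simp add: K_def y_def subspace_scale)
      then have "y \<bullet> (A *v y) \<le> c" using max by (simp add: c_def)
      moreover have xy: "x = norm x *\<^sub>R y" using False by (simp add: y_def)
      have "x \<bullet> (A *v x) = (norm x)\<^sup>2 * (y \<bullet> (A *v y))"
        by (subst (1 2) xy) (simp add: matrix_vector_mult_scaleR power2_eq_square)
      ultimately show ?thesis
        by (simp add: dot_square_norm mult.commute[of _ "(norm x)\<^sup>2"] mult_left_mono)
    qed simp
    have crit: "v \<bullet> (A *v u) = 0" if v: "v \<in> S" "v \<bullet> u = 0" for v
    proof -
      define \<beta> where "\<beta> = v \<bullet> (A *v u)"
      define \<gamma> where "\<gamma> = c * (v \<bullet> v) - v \<bullet> (A *v v)"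
      have ineq: "2 * t * \<beta> \<le> t\<^sup>2 * \<gamma>" for t
      proof -
        have "u + t *\<^sub>R v \<in> S" using v uS less.prems(1) by (simp add: subspace_add subspace_scale)
        note le = max'[OF this]
        have "u \<bullet> (A *v v) = v \<bullet> (A *v u)"
          by (metis A inner_commute symmetric_inner)
        then have 1: "(u + t *\<^sub>R v) \<bullet> (A *v (u + t *\<^sub>R v)) = c + 2 * t * \<beta> + t\<^sup>2 * (v \<bullet> (A *v v))"
          by (simp add: matrix_vector_right_distrib matrix_vector_mult_scaleR inner_add_left
              inner_add_right \<beta>_def c_def power2_eq_square algebra_simps)
        have "u \<bullet> v = 0" using v by (simp add: inner_commute)
        then have 2: "(u + t *\<^sub>R v) \<bullet> (u + t *\<^sub>R v) = 1 + t\<^sup>2 * (v \<bullet> v)"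
          using v uu by (simp add: inner_add_left inner_add_right power2_eq_square)
        show ?thesis using le unfolding 1 2 by (simp add: \<gamma>_def algebra_simps)
      qed
      \<comment> \<open>For this t the inequality becomes 2t\<beta> \<le> t^2\<gamma> \<le>
        t\<beta>, so t\<beta> \<le> 0 and hence \<beta>^2 \<le> 0; the summand 1 keeps the
        denominator positive.\<close>
      define t where "t = \<beta> / (\<bar>\<gamma>\<bar> + 1)"
      have g: "\<bar>\<gamma>\<bar> + 1 > 0" by (rule add_nonneg_pos) auto
      have tg: "t * (\<bar>\<gamma>\<bar> + 1) = \<beta>"
        unfolding t_def by (simp only: times_divide_eq_left nonzero_mult_div_cancel_right[OF less_imp_neq[OF g, symmetric]])
      have "t\<^sup>2 * \<gamma> \<le> t\<^sup>2 * (\<bar>\<gamma>\<bar> + 1)" by (intro mult_left_mono) auto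
      also have "\<dots> = t * \<beta>" using tg by (simp add: power2_eq_square mult.assoc)
      finally have "t * \<beta> \<le> 0" using ineq[of t] by simp
      then have "(t * \<beta>) * (\<bar>\<gamma>\<bar> + 1) \<le> 0" by (rule mult_nonpos_nonneg[OF _ less_imp_le[OF g]])
      moreover have "(t * \<beta>) * (\<bar>\<gamma>\<bar> + 1) = \<beta>\<^sup>2" using tg by (simp add: power2_eq_square mult_ac)
      ultimately have "\<beta> = 0" by simp
      then show ?thesis by (simp only: \<beta>_def)
    qed
    have eig: "A *v u = c *\<^sub>R u"
    proof -
      define w where "w = A *v u - c *\<^sub>R u"
      have "w \<in> S" using uS less.prems by (simp add: w_def subspace_diff subspace_scale)
      moreover have wu: "w \<bullet> u = 0"
        unfolding w_def inner_diff_left c_def by (simp add: uu inner_commute[of "A *v u"])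
      ultimately have "w \<bullet> (A *v u) = 0" by (rule crit)
      then have "w \<bullet> w = 0" using wu by (subst (2) w_def) (simp add: inner_diff_right)
      then show ?thesis by (simp add: w_def)
    qed
    define S' where "S' = {y \<in> S. \<forall>x\<in>span {u}. orthogonal x y}"
    have S': "S' = {y \<in> S. u \<bullet> y = 0}"
      by (auto simp: S'_def orthogonal_def span_singleton)
    have sub: "subspace S'" unfolding S'
      using less.prems(1) by (auto simp: subspace_def inner_add_right)
    have inv: "A *v x \<in> S'" if "x \<in> S'" for x
      using that less.prems(2) symmetric_inner[OF A, of u x] eig by (auto simp: S')
    have u0: "u \<noteq> 0" using uu by auto
    have "dim S' + dim (span {u}) = dim S"
      unfolding S'_def using span_minimal[of "{u}" S] less.prems(1) uS
      by (intro dim_subspace_orthogonal_to_vectors) auto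
    then have dim: "dim S = Suc (dim S')" using u0 by simp
    then obtain B where B: "B \<subseteq> S'" "finite B" "card B = dim S'" "pairwise orthogonal B"
        "\<forall>b\<in>B. norm b = 1 \<and> (\<exists>c. A *v b = c *\<^sub>R b)"
      using less.hyps[OF _ sub inv] by auto
    have "u \<notin> B" using B(1) uu by (auto simp: S')
    then show ?thesis
      using B dim uS uu eig
      by (intro exI[of _ "insert u B"])
        (auto simp: S' pairwise_insert orthogonal_def inner_commute norm_eq_1)
  qed
qed

lemma symmetric_eigenbasis:
  fixes A :: "real^'n^'n"
  assumes "transpose A = A"
  obtains e :: "'n \<Rightarrow> real^'n" and l :: "'n \<Rightarrow> real"
  where "\<And>i j. e i \<bullet> e j = (if i = j then 1 else 0)" "\<And>i. A *v e i = l i *\<^sub>R e i"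
proof -
  obtain B :: "(real^'n) set" where B: "finite B" "card B = CARD('n)" "pairwise orthogonal B"
      "\<forall>b\<in>B. norm b = 1 \<and> (\<exists>c. A *v b = c *\<^sub>R b)"
    using symmetric_invariant_subspace_basis[OF assms subspace_UNIV] by (auto simp: dim_UNIV)
  obtain e where e: "bij_betw e (UNIV :: 'n set) B"
    using B(1,2) finite_same_card_bij[of "UNIV :: 'n set" B] by auto
  have eB: "e i \<in> B" for i using e by (auto simp: bij_betw_def)
  have "e i \<bullet> e j = (if i = j then 1 else 0)" for i j
  proof (cases "i = j")
    case True
    then show ?thesis using B(4) eB[of j] by (simp add: norm_eq_1)
  next
    case False
    then have "e i \<noteq> e j" using e by (auto simp: bij_betw_def inj_on_def)
    then show ?thesis using B(3) eB[of i] eB[of j] False by (auto simp: pairwise_def orthogonal_def)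
  qed
  moreover have "\<forall>i. \<exists>c. A *v e i = c *\<^sub>R e i" using B(4) eB by auto
  then obtain l where "\<And>i. A *v e i = l i *\<^sub>R e i" using choice[of "\<lambda>i c. A *v e i = c *\<^sub>R e i"] by blast
  ultimately show ?thesis by (rule that)
qed

section \<open>Symmetric functions of the eigenvalues and the characteristic polynomial\<close>

lemma prod_affine_charpoly:
  fixes l :: "'n::finite \<Rightarrow> real"
  assumes "t \<noteq> 0"
  shows "(\<Prod>i\<in>UNIV. 1 + t * l i) = (- t) ^ CARD('n) * (\<Prod>i\<in>UNIV. - 1 / t - l i)"
proof -
  have "(\<Prod>i\<in>UNIV. 1 + t * l i) = (\<Prod>i\<in>UNIV. (- t) * (- 1 / t - l i))"
    using assms by (intro prod.cong) (auto simp: field_simps)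
  also have "\<dots> = (- t) ^ CARD('n) * (\<Prod>i\<in>UNIV. - 1 / t - l i)"
    by (simp only: prod.distrib prod_constant)
  finally show ?thesis .
qed

text \<open>\<open>eigenvalues A\<close> is an unspecified choice, but the characteristic polynomial
  fixes its symmetric functions. The index set is arbitrary because the basis used at a boundary
  point is indexed by natural numbers.\<close>

lemma Sk_eq_esym:
  fixes A :: "real^'n^'n" and e :: "'i \<Rightarrow> real^'n"
  assumes I: "finite I" "card I = CARD('n)"
    and on: "\<And>i j. i \<in> I \<Longrightarrow> j \<in> I \<Longrightarrow> e i \<bullet> e j = (if i = j then 1 else 0)"
    and eig: "\<And>i. i \<in> I \<Longrightarrow> A *v e i = l i *\<^sub>R e i"
  shows "Sk k A = esym I k l"
proof -
  obtain h where h: "bij_betw h (UNIV :: 'n set) I"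
    using I finite_same_card_bij[of "UNIV :: 'n set" I] by auto
  have hI: "h i \<in> I" for i using h by (auto simp: bij_betw_def)
  have hinj: "h i = h j \<longleftrightarrow> i = j" for i j using h by (auto simp: bij_betw_def inj_on_def)
  have det: "det (mat a + b *\<^sub>R A) = (\<Prod>i\<in>UNIV. a + b * l (h i))" for a b
    by (rule det_orthonormal_eigenbasis[where e = "\<lambda>i. e (h i)"])
      (auto simp: on hI hinj eig)
  have charpoly: "det (mat t - A) = (\<Prod>i\<in>UNIV. t - l (h i))" for t
    using det[of t "- 1"] by simp
  have "\<exists>m :: real^'n. \<forall>t. det (mat t - A) = (\<Prod>i\<in>UNIV. t - m $ i)"
    by (intro exI[of _ "\<chi> i. l (h i)"]) (simp add: charpoly)
  then have "\<forall>t. det (mat t - A) = (\<Prod>i\<in>UNIV. t - eigenvalues A $ i)"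
    unfolding eigenvalues_def by (rule someI_ex)
  then have "(\<Prod>i\<in>UNIV. t - eigenvalues A $ i) = (\<Prod>i\<in>UNIV. t - l (h i))" for t
    by (simp add: charpoly)
  then have "Sk k A = esym UNIV k (\<lambda>i. l (h i))"
    unfolding Sk_def by (intro esym_eqI) (auto simp: prod_affine_charpoly)
  also have "\<dots> = esym I k l"
    using I by (intro esym_eqI) (auto intro: prod.reindex_bij_betw[OF h])
  finally show ?thesis .
qed

text \<open>Lagrange interpolation expresses a coefficient through finitely many values; it transfers
  continuity from the determinant to \<open>S\<^sub>k\<close>.\<close>

lemma coeff_interpolation:
  obtains c :: "nat \<Rightarrow> real"
  where "\<And>p. degree p \<le> N \<Longrightarrow> coeff p j = (\<Sum>m\<le>N. c m * poly p (real m))"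
proof
  define L where "L m = (\<Prod>i\<in>{..N} - {m}. smult (1 / (real m - real i)) [:- real i, 1:])" for m
  fix p :: "real poly" assume p: "degree p \<le> N"
  have Lval: "poly (L m) (real r) = (if r = m then 1 else 0)" if "r \<le> N" for m r
    using that by (auto simp: L_def poly_prod diff_divide_distrib[symmetric] intro!: prod.neutral)
  have degL: "degree (L m) \<le> N" if "m \<le> N" for m
  proof -
    have "degree (L m) \<le> (\<Sum>i\<in>{..N} - {m}. degree (smult (1 / (real m - real i)) [:- real i, 1:]))"
      unfolding L_def by (rule order.trans[OF degree_prod_sum_le]) (simp_all add: o_def)
    also have "\<dots> \<le> (\<Sum>i\<in>{..N} - {m}. 1)"
      by (intro sum_mono) (auto intro: order.trans[OF degree_smult_le])
    finally show ?thesis using that by simp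
  qed
  have "p = (\<Sum>m\<le>N. smult (poly p (real m)) (L m))"
  proof (rule poly_eqI_degree)
    fix x assume "x \<in> real ` {..N}"
    then obtain r where r: "r \<le> N" "x = real r" by auto
    then show "poly p x = poly (\<Sum>m\<le>N. smult (poly p (real m)) (L m)) x"
      by (simp add: poly_sum Lval if_distrib cong: if_cong)
  next
    have card: "card (real ` {..N}) = Suc N" by (simp add: card_image inj_on_def)
    then show "degree p < card (real ` {..N})" using p by simp
    have "degree (\<Sum>m\<le>N. smult (poly p (real m)) (L m)) \<le> N"
      by (intro degree_sum_le) (auto intro: order.trans[OF degree_smult_le] degL)
    then show "degree (\<Sum>m\<le>N. smult (poly p (real m)) (L m)) < card (real ` {..N})"
      using card by simp
  qed
  then have "coeff p j = coeff (\<Sum>m\<le>N. smult (poly p (real m)) (L m)) j" by simp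
  then show "coeff p j = (\<Sum>m\<le>N. coeff (L m) j * poly p (real m))"
    by (simp add: coeff_sum mult.commute)
qed

text \<open>S_j(A) is a coefficient of the polynomial det(1 + tA) in t. The weights c do not depend
  on A, so on symmetric matrices S_j is one fixed combination of determinants.\<close>

lemma Sk_interpolation:
  obtains c :: "nat \<Rightarrow> real"
  where "\<And>A :: real^'n^'n. transpose A = A \<Longrightarrow>
    Sk j A = (\<Sum>m\<le>CARD('n). c m * det (mat 1 + real m *\<^sub>R A))"
proof -
  obtain c :: "nat \<Rightarrow> real"
    where c: "\<And>p. degree p \<le> CARD('n) \<Longrightarrow> coeff p j = (\<Sum>m\<le>CARD('n). c m * poly p (real m))"
    using coeff_interpolation[of "CARD('n)" j] by metis
  show ?thesis
  proof
    fix A :: "real^'n^'n" assume "transpose A = A"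
    then obtain e :: "'n \<Rightarrow> real^'n" and l :: "'n \<Rightarrow> real"
      where e: "\<And>i j. e i \<bullet> e j = (if i = j then 1 else 0)" "\<And>i. A *v e i = l i *\<^sub>R e i"
      using symmetric_eigenbasis by blast
    define p where "p = (\<Prod>i\<in>UNIV. [:1, l i:])"
    have "degree p \<le> (\<Sum>i\<in>UNIV. degree [:1, l i:])"
      unfolding p_def by (rule order.trans[OF degree_prod_sum_le]) (simp_all add: o_def)
    also have "\<dots> \<le> (\<Sum>i\<in>(UNIV::'n set). 1)" by (intro sum_mono) auto
    finally have "degree p \<le> CARD('n)" by simp
    moreover have "coeff p j = Sk j A"
      using Sk_eq_esym[of "UNIV::'n set" e A l j] e coeff_prod_linear[of "UNIV::'n set" l j, where 'a=real]
      by (simp add: p_def)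
    moreover have "poly p t = det (mat 1 + t *\<^sub>R A)" for t
      using det_orthonormal_eigenbasis[of e A l 1 t] e by (simp add: p_def poly_prod_linear)
    ultimately show "Sk j A = (\<Sum>m\<le>CARD('n). c m * det (mat 1 + real m *\<^sub>R A))"
      using c[of p] by simp
  qed
qed

lemma Sk_tendsto:
  fixes A :: "real^'n^'n"
  assumes "(f \<longlongrightarrow> A) F" and sym: "\<And>x. transpose (f x) = f x" "transpose A = A"
  shows "((\<lambda>x. Sk j (f x)) \<longlongrightarrow> Sk j A) F"
proof -
  obtain c :: "nat \<Rightarrow> real" where c: "\<And>A :: real^'n^'n. transpose A = A \<Longrightarrow>
      Sk j A = (\<Sum>m\<le>CARD('n). c m * det (mat 1 + real m *\<^sub>R A))"
    using Sk_interpolation by blast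
  have "((\<lambda>x. \<Sum>m\<le>CARD('n). c m * det (mat 1 + real m *\<^sub>R f x)) \<longlongrightarrow>
      (\<Sum>m\<le>CARD('n). c m * det (mat 1 + real m *\<^sub>R A))) F"
    unfolding det_def by (intro tendsto_intros assms(1))
  then show ?thesis by (simp add: c sym)
qed

lemma Sk_scaleR:
  assumes "transpose A = (A :: real^'n^'n)"
  shows "Sk k (c *\<^sub>R A) = c ^ k * Sk k A"
proof -
  obtain e :: "'n \<Rightarrow> real^'n" and l :: "'n \<Rightarrow> real"
    where e: "\<And>i j. e i \<bullet> e j = (if i = j then 1 else 0)" "\<And>i. A *v e i = l i *\<^sub>R e i"
    using symmetric_eigenbasis[OF assms] by blast
  have "Sk k A = esym UNIV k l" "Sk k (c *\<^sub>R A) = esym UNIV k (\<lambda>i. c * l i)"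
    by (rule Sk_eq_esym[where e = e]; use e in \<open>simp add: scaleR_matrix_vector_assoc[symmetric]\<close>)+
  then show ?thesis by (simp add: esym_scale)
qed

lemma Sk_scaleR_mat_1: "Sk k (c *\<^sub>R mat 1 :: real^'n^'n) = real (CARD('n) choose k) * c ^ k"
proof -
  have "Sk k (c *\<^sub>R mat 1 :: real^'n^'n) = esym (UNIV::'n set) k (\<lambda>i. c)"
    by (rule Sk_eq_esym[where e = "\<lambda>i. axis i 1"])
      (auto simp: inner_axis_axis scaleR_matrix_vector_assoc[symmetric])
  then show ?thesis by (simp add: esym_const)
qed

lemma Sigma_cone_iff:
  assumes "k \<le> CARD('n)"
  shows "A \<in> Sigma_cone k \<longleftrightarrow> transpose A = (A :: real^'n^'n) \<and> (\<forall>j\<in>{1..k}. Sk j A \<ge> 0)"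
  using closure_Gamma[OF assms] by (simp add: Sigma_cone_def Sk_def)

lemma Sigma_cone_closed:
  fixes A :: "real^'n^'n"
  assumes k: "k \<le> CARD('n)" and "(f \<longlongrightarrow> A) F" "F \<noteq> bot" "\<And>x. f x \<in> Sigma_cone k"
  shows "A \<in> Sigma_cone k"
proof -
  have f: "transpose (f x) = f x" "\<And>j. j \<in> {1..k} \<Longrightarrow> Sk j (f x) \<ge> 0" for x
    using assms(4)[of x] by (auto simp: Sigma_cone_iff[OF k])
  have "A $ i $ j = A $ j $ i" for i j
  proof (rule tendsto_unique[OF assms(3)])
    show "((\<lambda>x. f x $ i $ j) \<longlongrightarrow> A $ i $ j) F" by (intro tendsto_intros assms)
    have "f x $ i $ j = f x $ j $ i" for x
      using arg_cong[OF f(1)[of x], of "\<lambda>B. B $ i $ j"] by (simp add: transpose_def)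
    then have "(\<lambda>x. f x $ i $ j) = (\<lambda>x. f x $ j $ i)" by simp
    then show "((\<lambda>x. f x $ i $ j) \<longlongrightarrow> A $ j $ i) F"
      by (simp only:) (intro tendsto_intros assms)
  qed
  then have A: "transpose A = A" by (simp add: vec_eq_iff transpose_def)
  have "Sk j A \<ge> 0" if "j \<in> {1..k}" for j
    by (rule tendsto_lowerbound[OF Sk_tendsto[OF assms(2) f(1) A]])
      (use f(2) that assms(3) in auto)
  then show ?thesis using A by (simp add: Sigma_cone_iff[OF k])
qed

lemma symmetric_add_scaleR_mat_1:
  "transpose A = (A::real^'n^'n) \<Longrightarrow> transpose (A + c *\<^sub>R mat 1) = A + c *\<^sub>R mat 1"
  by (simp add: vec_eq_iff transpose_def mat_def)

section \<open>Functions of class \<open>C\<^sup>2\<close>\<close>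

lemma grad_eqI:
  assumes "GDERIV f x :> D"
  shows "grad f x = D"
proof -
  have "D' = D" if "GDERIV f x :> D'" for D'
  proof -
    have "(\<lambda>h. h \<bullet> D') = (\<lambda>h. h \<bullet> D)"
      using assms that unfolding gderiv_def by (rule has_derivative_unique[rotated])
    then have "h \<bullet> D' = h \<bullet> D" for h by metis
    then show ?thesis using vector_eq_ldot by blast
  qed
  then show ?thesis unfolding grad_def using assms by blast
qed

lemma GDERIV_grad:
  assumes "f differentiable (at x)"
  shows "GDERIV f x :> grad f x"
proof -
  obtain f' where f': "(f has_derivative f') (at x)" using assms by (auto simp: differentiable_def)
  then interpret linear f' by (rule has_derivative_linear)
  have "f' h = h \<bullet> (\<Sum>b\<in>Basis. f' b *\<^sub>R b)" for h
  proof -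
    have "f' h = f' (\<Sum>b\<in>Basis. (h \<bullet> b) *\<^sub>R b)" by (simp add: euclidean_representation)
    also have "\<dots> = h \<bullet> (\<Sum>b\<in>Basis. f' b *\<^sub>R b)"
      by (simp add: sum scale inner_sum_right mult.commute)
    finally show ?thesis .
  qed
  then have "f' = (\<lambda>h. h \<bullet> (\<Sum>b\<in>Basis. f' b *\<^sub>R b))" by (rule ext)
  then have "GDERIV f x :> (\<Sum>b\<in>Basis. f' b *\<^sub>R b)"
    unfolding gderiv_def by (rule has_derivative_eq_rhs[OF f'])
  from this grad_eqI[OF this] show ?thesis by simp
qed

text \<open>Transfers explicit derivatives to \<open>grad\<close> and \<open>hessian\<close>, which
  are defined through choices; since U is open, equality of the gradients on U also identifies their
  derivatives.\<close>

lemma C2_onI: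
  fixes f :: "real^'n \<Rightarrow> real"
  assumes U: "open U" and g: "\<And>x. x \<in> U \<Longrightarrow> GDERIV f x :> g x"
    and H: "\<And>x. x \<in> U \<Longrightarrow> (g has_derivative (\<lambda>h. H x *v h)) (at x)"
    and cont: "continuous_on U H"
  shows "C2_on U f" "\<And>x. x \<in> U \<Longrightarrow> hessian f x = H x"
proof -
  have grad: "grad f x = g x" if "x \<in> U" for x
    using g[OF that] by (rule grad_eqI)
  have dgrad: "(grad f has_derivative (\<lambda>h. H x *v h)) (at x)" if "x \<in> U" for x
    by (rule has_derivative_transform_within_open[OF H[OF that] U that]) (simp add: grad)
  show hess: "hessian f x = H x" if "x \<in> U" for x
    using frechet_derivative_at[OF dgrad[OF that]]
    by (metis hessian_def jacobian_def matrix_of_matrix_vector_mul)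
  have "continuous_on U (hessian f)"
    using cont by (rule continuous_on_eq) (simp add: hess)
  moreover have "f differentiable (at x)" if "x \<in> U" for x
    using g[OF that] by (auto simp: gderiv_def differentiable_def)
  moreover have "grad f differentiable (at x)" if "x \<in> U" for x
    using dgrad[OF that] by (auto simp: differentiable_def)
  ultimately show "C2_on U f" using U by (simp add: C2_on_def)
qed

lemma C2_onD:
  assumes "C2_on U f" "x \<in> U"
  shows "GDERIV f x :> grad f x" "(grad f has_derivative (\<lambda>h. hessian f x *v h)) (at x)"
    "continuous_on U (hessian f)" "open U"
  using assms GDERIV_grad by (auto simp: C2_on_def hessian_def jacobian_works[symmetric])

lemma C2_on_continuous: "C2_on U f \<Longrightarrow> continuous_on U f"
  by (auto simp: C2_on_def intro!: continuous_at_imp_continuous_on differentiable_imp_continuous_within)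

lemma C2_on_add:
  assumes "C2_on U f" "C2_on U g"
  shows "C2_on U (\<lambda>x. f x + g x)" "\<And>x. x \<in> U \<Longrightarrow> hessian (\<lambda>x. f x + g x) x = hessian f x + hessian g x"
proof -
  have U: "open U" using assms by (simp add: C2_on_def)
  have 1: "GDERIV (\<lambda>x. f x + g x) x :> grad f x + grad g x" if "x \<in> U" for x
    using assms that by (intro GDERIV_add C2_onD(1))
  have 2: "((\<lambda>x. grad f x + grad g x) has_derivative (\<lambda>h. (hessian f x + hessian g x) *v h)) (at x)"
    if "x \<in> U" for x
    unfolding matrix_vector_mult_add_rdistrib
    by (rule has_derivative_add[OF C2_onD(2)[OF assms(1) that] C2_onD(2)[OF assms(2) that]])
  have 3: "continuous_on U (\<lambda>x. hessian f x + hessian g x)"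
    using assms by (auto simp: C2_on_def intro: continuous_on_add)
  show "C2_on U (\<lambda>x. f x + g x)" "\<And>x. x \<in> U \<Longrightarrow> hessian (\<lambda>x. f x + g x) x = hessian f x + hessian g x"
    by (rule C2_onI[OF U 1 2 3]; assumption)+
qed

lemma C2_on_scale:
  assumes "C2_on U f"
  shows "C2_on U (\<lambda>x. c * f x)" "\<And>x. x \<in> U \<Longrightarrow> hessian (\<lambda>x. c * f x) x = c *\<^sub>R hessian f x"
proof -
  have U: "open U" using assms by (simp add: C2_on_def)
  have 1: "GDERIV (\<lambda>x. c * f x) x :> c *\<^sub>R grad f x" if "x \<in> U" for x
    using C2_onD(1)[OF assms that] has_derivative_mult_right[of f _ "at x" c] by (simp add: gderiv_def)
  have 2: "((\<lambda>x. c *\<^sub>R grad f x) has_derivative (\<lambda>h. (c *\<^sub>R hessian f x) *v h)) (at x)" if "x \<in> U" for x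
    unfolding scaleR_matrix_vector_assoc[symmetric]
    by (rule has_derivative_scaleR_right[OF C2_onD(2)[OF assms that]])
  have 3: "continuous_on U (\<lambda>x. c *\<^sub>R hessian f x)"
    by (intro continuous_intros) (use assms in \<open>simp add: C2_on_def\<close>)
  show "C2_on U (\<lambda>x. c * f x)" "\<And>x. x \<in> U \<Longrightarrow> hessian (\<lambda>x. c * f x) x = c *\<^sub>R hessian f x"
    by (rule C2_onI[OF U 1 2 3]; assumption)+
qed

lemma C2_on_subset: "C2_on U f \<Longrightarrow> open V \<Longrightarrow> V \<subseteq> U \<Longrightarrow> C2_on V f"
  by (auto simp: C2_on_def intro: continuous_on_subset)

text \<open>By symmetry the two halves of the derivative of the quadratic form coincide, so the
  Hessian is A itself and not merely its symmetric part.\<close>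

lemma C2_on_quadratic:
  fixes A :: "real^'n^'n"
  assumes A: "transpose A = A"
  shows "C2_on UNIV (\<lambda>x. a + b \<bullet> (x - z) + ((x - z) \<bullet> (A *v (x - z))) / 2)" (is "C2_on UNIV ?q")
    and "hessian (\<lambda>x. a + b \<bullet> (x - z) + ((x - z) \<bullet> (A *v (x - z))) / 2) x = A"
proof -
  have sub: "((\<lambda>x. x - z) has_derivative (\<lambda>h. h)) (at x)" for x
    by (auto intro!: derivative_eq_intros)
  have lin: "((\<lambda>x. A *v (x - z)) has_derivative (\<lambda>h. A *v h)) (at x)" for x
  proof -
    from bounded_linear.has_derivative[OF matrix_vector_mul_bounded_linear[of A] sub] show ?thesis by simp
  qed
  have 1: "GDERIV ?q x :> b + A *v (x - z)" for x
  proof -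
    have "((\<lambda>x. ((x - z) \<bullet> (A *v (x - z))) / 2) has_derivative
        (\<lambda>h. ((x - z) \<bullet> (A *v h) + h \<bullet> (A *v (x - z))) / 2)) (at x)"
      using bounded_linear.has_derivative[OF bounded_linear_divide has_derivative_inner[OF sub lin]]
      by simp
    moreover have "((\<lambda>x. a + b \<bullet> (x - z)) has_derivative (\<lambda>h. b \<bullet> h)) (at x)"
      using has_derivative_add[OF has_derivative_const has_derivative_inner_right[OF sub]] by simp
    ultimately have "(?q has_derivative
        (\<lambda>h. b \<bullet> h + ((x - z) \<bullet> (A *v h) + h \<bullet> (A *v (x - z))) / 2)) (at x)"
      by (rule has_derivative_add[rotated])
    moreover have "(x - z) \<bullet> (A *v h) = h \<bullet> (A *v (x - z))" for h
      by (metis symmetric_inner[OF A] inner_commute)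
    ultimately show ?thesis
      by (simp add: gderiv_def inner_add_right inner_commute[of b])
  qed
  have 2: "((\<lambda>x. b + A *v (x - z)) has_derivative (\<lambda>h. A *v h)) (at x)" for x
    using has_derivative_add[OF has_derivative_const lin] by simp
  show "C2_on UNIV ?q" "hessian ?q x = A"
    using C2_onI[OF open_UNIV 1 2, OF continuous_on_const] by auto
qed

text \<open>The additive constant belongs to the pattern; later test functions are written as
  \<open>0 + c * ...\<close> in order to match it.\<close>

lemma C2_on_sq_dist:
  fixes z :: "real^'n"
  shows "C2_on UNIV (\<lambda>x. a + c * ((x - z) \<bullet> (x - z)))"
    "hessian (\<lambda>x. a + c * ((x - z) \<bullet> (x - z))) x = (2 * c) *\<^sub>R mat 1"
proof -
  have "transpose ((2 * c) *\<^sub>R mat 1 :: real^'n^'n) = (2 * c) *\<^sub>R mat 1"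
    by (simp add: vec_eq_iff transpose_def mat_def)
  from C2_on_quadratic[OF this, of a 0 z]
  show "C2_on UNIV (\<lambda>x. a + c * ((x - z) \<bullet> (x - z)))"
    "hessian (\<lambda>x. a + c * ((x - z) \<bullet> (x - z))) x = (2 * c) *\<^sub>R mat 1"
    by (simp_all add: scaleR_matrix_vector_assoc[symmetric])
qed

text \<open>Mean value theorem along the segment: the derivative of f minus its second-order
  expansion is the linearisation error of the gradient at z, paired with h, and that error is at
  most e|th|.\<close>

lemma C2_taylor_bound:
  fixes f :: "real^'n \<Rightarrow> real"
  assumes f: "C2_on U f" "z \<in> U" and e: "e > 0"
  shows "\<exists>d>0. ball z d \<subseteq> U \<and> (\<forall>h\<in>ball 0 d.
    \<bar>f (z + h) - (f z + grad f z \<bullet> h + h \<bullet> (hessian f z *v h) / 2)\<bar> \<le> e * (h \<bullet> h))"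
proof -
  let ?H = "hessian f z"
  obtain r where r: "r > 0" "ball z r \<subseteq> U"
    using C2_onD(4)[OF f] f(2) by (meson openE)
  obtain d0 where d0: "d0 > 0" "\<And>y. norm (y - z) < d0 \<Longrightarrow> norm (grad f y - grad f z - ?H *v (y - z)) \<le> e * norm (y - z)"
    using C2_onD(2)[OF f] e unfolding has_derivative_at_alt by blast
  define d where "d = min r d0"
  have d: "d > 0" "ball z d \<subseteq> U" using r d0 by (auto simp: d_def)
  have "\<bar>f (z + h) - (f z + grad f z \<bullet> h + h \<bullet> (?H *v h) / 2)\<bar> \<le> e * (h \<bullet> h)" if h: "h \<in> ball 0 d" for h
  proof -
    define F where "F t = f (z + t *\<^sub>R h) - t * (grad f z \<bullet> h) - t\<^sup>2 * (h \<bullet> (?H *v h)) / 2" for t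
    have hd: "norm h < d" using h by simp
    have dF: "(F has_real_derivative (grad f (z + t *\<^sub>R h) - grad f z - ?H *v (t *\<^sub>R h)) \<bullet> h) (at t)"
      if "0 \<le> t" "t \<le> 1" for t
    proof -
      have "norm (t *\<^sub>R h) \<le> norm h" using that by (simp add: mult_left_le_one_le)
      then have "z + t *\<^sub>R h \<in> U" using d(2) hd by (auto simp: dist_norm)
      then have "(f has_derivative (\<lambda>k. k \<bullet> grad f (z + t *\<^sub>R h))) (at (z + t *\<^sub>R h))"
        using C2_onD(1)[OF f(1)] by (simp add: gderiv_def)
      moreover have "((\<lambda>t. z + t *\<^sub>R h) has_derivative (\<lambda>s. s *\<^sub>R h)) (at t)"
        by (auto intro!: derivative_eq_intros)
      ultimately have "((\<lambda>t. f (z + t *\<^sub>R h)) has_derivative (\<lambda>s. (s *\<^sub>R h) \<bullet> grad f (z + t *\<^sub>R h))) (at t)"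
        by (rule has_derivative_compose[rotated])
      then have "((\<lambda>t. f (z + t *\<^sub>R h)) has_real_derivative (grad f (z + t *\<^sub>R h) \<bullet> h)) (at t)"
        by (simp add: has_field_derivative_def inner_commute mult_commute_abs)
      then show ?thesis
        unfolding F_def
        by (auto intro!: derivative_eq_intros simp: inner_diff_left inner_diff_right matrix_vector_mult_scaleR
              inner_commute)
    qed
    obtain t where t: "0 < t" "t < 1" "F 1 - F 0 = (1 - 0) * ((grad f (z + t *\<^sub>R h) - grad f z - ?H *v (t *\<^sub>R h)) \<bullet> h)"
      using MVT2[of 0 1 F, OF _ dF] by auto
    have th: "norm (t *\<^sub>R h) \<le> norm h" using t by (simp add: mult_left_le_one_le)
    have "\<bar>F 1 - F 0\<bar> \<le> norm (grad f (z + t *\<^sub>R h) - grad f z - ?H *v (t *\<^sub>R h)) * norm h"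
      using t(3) Cauchy_Schwarz_ineq2 by simp
    also have "\<dots> \<le> (e * norm (t *\<^sub>R h)) * norm h"
      using d0(2)[of "z + t *\<^sub>R h"] th hd by (intro mult_right_mono) (auto simp: d_def)
    also have "\<dots> \<le> e * norm h * norm h"
      using th e by (intro mult_right_mono mult_left_mono) auto
    finally show ?thesis
      by (simp add: F_def power2_norm_eq_inner[symmetric] power2_eq_square algebra_simps)
  qed
  then show ?thesis using d by blast
qed

section \<open>Radial Hessians and powers of the distance\<close>

definition outer :: "real^'n \<Rightarrow> real^'n^'n" where
  "outer u = (\<chi> i j. u $ i * u $ j)"

lemma outer_mult: "outer u *v h = (u \<bullet> h) *\<^sub>R u"
  by (simp add: vec_eq_iff outer_def matrix_vector_mult_def inner_vec_def sum_distrib_left mult_ac)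

lemma transpose_outer: "transpose (outer u) = outer u"
  by (simp add: vec_eq_iff transpose_def outer_def)

lemma transpose_add: "transpose (A + B) = transpose A + transpose B"
  and transpose_scaleR: "transpose (c *\<^sub>R A) = c *\<^sub>R transpose (A :: real^'n^'m)"
  by (simp_all add: vec_eq_iff transpose_def)

lemma continuous_on_outer:
  assumes "continuous_on S f"
  shows "continuous_on S (\<lambda>x. outer (f x))"
  unfolding outer_def by (intro continuous_intros assms)

lemma orthonormal_family_extending:
  fixes u :: "real^'n"
  assumes "norm u = 1"
  shows "\<exists>(e :: 'n \<Rightarrow> real^'n) i0. (\<forall>i j. e i \<bullet> e j = (if i = j then 1 else 0)) \<and> e i0 = u"
proof -
  fix i0 :: 'n
  obtain A :: "real^'n^'n" where A: "orthogonal_matrix A" "A *v axis i0 1 = u"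
    by (rule orthogonal_matrix_exists_basis[OF assms])
  have "orthogonal_transformation ((*v) A)" using A(1) by (simp add: orthogonal_transformation_matrix)
  then have "(A *v x) \<bullet> (A *v y) = x \<bullet> y" for x y
    by (simp add: orthogonal_transformation_def)
  then show ?thesis using A(2)
    by (intro exI[of _ "\<lambda>i. A *v axis i 1"] exI[of _ i0]) (auto simp: inner_axis_axis)
qed

text \<open>The eigenvalue is ac along u and a on the orthogonal complement; the two summands
  collect the index sets that avoid or contain the radial direction.\<close>

lemma Sk_radial:
  fixes u :: "real^'n"
  assumes u: "norm u = 1" and j: "j < CARD('n)"
  shows "Sk (Suc j) (a *\<^sub>R (mat 1 + (c - 1) *\<^sub>R outer u)) =
    a ^ Suc j * (real (CARD('n) - 1 choose Suc j) + c * real (CARD('n) - 1 choose j))"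
proof -
  obtain e :: "'n \<Rightarrow> real^'n" and i0
    where e0: "\<forall>i j. e i \<bullet> e j = (if i = j then 1 else 0)" and e2: "e i0 = u"
    using orthonormal_family_extending[OF u] by blast
  note e = e0[rule_format] e2
  define I where "I = UNIV - {i0}"
  define l where "l i = (if i = i0 then a * c else a)" for i
  have I: "UNIV = insert i0 I" "i0 \<notin> I" "finite I" "card I = CARD('n) - 1"
    by (auto simp: I_def card_Diff_singleton)
  have "(a *\<^sub>R (mat 1 + (c - 1) *\<^sub>R outer u)) *v e i = l i *\<^sub>R e i" for i
  proof -
    have "u \<bullet> e i = (if i = i0 then 1 else 0)" using e(1)[of i0 i] e(2) by auto
    then show ?thesis
      using e(2) by (auto simp: scaleR_matrix_vector_assoc[symmetric] matrix_vector_mult_add_rdistrib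
          outer_mult l_def algebra_simps)
  qed
  then have "Sk (Suc j) (a *\<^sub>R (mat 1 + (c - 1) *\<^sub>R outer u)) = esym UNIV (Suc j) l"
    using e(1) by (intro Sk_eq_esym[where e = e]) auto
  also have "\<dots> = esym I (Suc j) l + l i0 * esym I j l"
    unfolding I(1) by (rule esym_insert_Suc[OF I(3,2)])
  also have "esym I m l = esym I m (\<lambda>_. a)" for m
    unfolding esym_def using I(2) by (intro sum.cong prod.cong refl) (auto simp: l_def)
  then have "esym I (Suc j) l + l i0 * esym I j l =
      real (card I choose Suc j) * a ^ Suc j + a * c * (real (card I choose j) * a ^ j)"
    using I(3) by (simp add: esym_const l_def)
  finally show ?thesis by (simp add: I(4) algebra_simps)
qed

text \<open>The power \<open>|x - y|\<^bsup>2\<beta>\<^esup>\<close> is an \<open>S\<^sub>k\<close>-harmonic fundamental solution for \<open>2\<beta> = 2 - N/k\<close>; for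
  smaller exponents its Hessian leaves the cone.\<close>

lemma Sk_power_neg:
  fixes u :: "real^'n"
  assumes "norm u = 1" "a > 0" and k: "1 \<le> k" "k \<le> CARD('n)" and \<alpha>: "\<alpha> < 2 - real CARD('n) / real k"
  shows "Sk k (a *\<^sub>R (mat 1 + (\<alpha> - 2) *\<^sub>R outer u)) < 0"
proof -
  obtain j where j: "k = Suc j" using k by (cases k) auto
  define n where "n = CARD('n) - 1"
  have n: "j \<le> n" "CARD('n) = Suc n" using k by (auto simp: n_def j)
  \<comment> \<open>Absorption combines the two binomial terms of \<open>Sk_radial\<close> into (N/k
    - 2 + \<alpha>) times the binomial coefficient of n = N - 1 over j = k - 1.\<close>
  have "Suc j * (n choose Suc j) = (n - j) * (n choose j)"
    using binomial_absorb_comp[of n j] binomial_absorption[of j n] by simp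
  then have "real (Suc j) * real (n choose Suc j) = real (n - j) * real (n choose j)"
    by (metis of_nat_mult)
  then have ch: "real (n choose Suc j) = real (n - j) / real (Suc j) * real (n choose j)"
    by (simp add: field_simps)
  have q: "real (n - j) / real (Suc j) = real CARD('n) / real k - 1"
    using n by (simp add: j field_simps of_nat_diff)
  then have "real (n choose Suc j) + (\<alpha> - 1) * real (n choose j)
      = (real CARD('n) / real k - 2 + \<alpha>) * real (n choose j)"
    unfolding ch q by (simp add: algebra_simps)
  also have "\<dots> < 0" using \<alpha> n by (intro mult_neg_pos) auto
  finally have "a ^ Suc j * (real (n choose Suc j) + (\<alpha> - 1) * real (n choose j)) < 0"
    using \<open>a > 0\<close> by (intro mult_pos_neg) auto
  then show ?thesis
    using Sk_radial[OF assms(1), of j a "\<alpha> - 1"] n by (simp add: j n_def[symmetric] algebra_simps)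
qed

text \<open>The base is the squared distance, a polynomial, so \<beta> is half of the exponent of
  the distance. The \<open>outer\<close> term arises from differentiating the scalar factor of the
  gradient.\<close>

lemma C2_on_power:
  fixes y :: "real^'n"
  shows "C2_on (- {y}) (\<lambda>x. m + c * ((x - y) \<bullet> (x - y)) powr \<beta>)" (is "C2_on _ ?f")
    and "\<And>x. x \<noteq> y \<Longrightarrow> hessian (\<lambda>x. m + c * ((x - y) \<bullet> (x - y)) powr \<beta>) x = (2 * c * \<beta> * ((x - y) \<bullet> (x - y)) powr (\<beta> - 1)) *\<^sub>R
       (mat 1 + (2 * \<beta> - 2) *\<^sub>R outer ((1 / norm (x - y)) *\<^sub>R (x - y)))"
proof -
  let ?s = "\<lambda>x. (x - y) \<bullet> (x - y)"
  define H where "H x = (2 * c * \<beta> * ?s x powr (\<beta> - 1)) *\<^sub>R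
       (mat 1 + (2 * \<beta> - 2) *\<^sub>R outer ((1 / norm (x - y)) *\<^sub>R (x - y)))" for x
  have spos: "?s x > 0" if "x \<in> - {y}" for x using that by simp
  have sub: "((\<lambda>x. x - y) has_derivative (\<lambda>h. h)) (at x)" for x
    by (auto intro!: derivative_eq_intros)
  have ds: "(?s has_derivative (\<lambda>h. 2 * ((x - y) \<bullet> h))) (at x)" for x
    using has_derivative_inner[OF sub sub] by (simp add: inner_commute)
  have dpow: "((\<lambda>x. ?s x powr b) has_derivative (\<lambda>h. 2 * ((x - y) \<bullet> h) * (b * ?s x powr (b - 1)))) (at x)"
    if "x \<in> - {y}" for x b
  proof -
    have "((\<lambda>s. s powr b) has_real_derivative b * ?s x powr (b - 1)) (at (?s x))"
      using spos[OF that] by (rule has_real_derivative_powr)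
    from DERIV_compose_FDERIV[OF this ds] show ?thesis by simp
  qed
  have 1: "GDERIV ?f x :> (2 * c * \<beta> * ?s x powr (\<beta> - 1)) *\<^sub>R (x - y)" if "x \<in> - {y}" for x
    using has_derivative_add[OF has_derivative_const has_derivative_mult_right[OF dpow[OF that]], of m c \<beta>]
    by (simp add: gderiv_def inner_commute mult_ac)
  have 2: "((\<lambda>x. (2 * c * \<beta> * ?s x powr (\<beta> - 1)) *\<^sub>R (x - y)) has_derivative (\<lambda>h. H x *v h)) (at x)"
    if x: "x \<in> - {y}" for x
  proof -
    let ?p = "?s x powr (\<beta> - 1)"
    have p: "?s x powr (\<beta> - 1 - 1) = ?p / ?s x"
      unfolding powr_diff[of _ "\<beta> - 1" 1] using spos[OF x] by simp
    have nrm: "norm (x - y) * norm (x - y) = ?s x"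
      by (simp add: power2_norm_eq_inner[symmetric] power2_eq_square)
    have "((\<lambda>x. (2 * c * \<beta> * ?s x powr (\<beta> - 1)) *\<^sub>R (x - y)) has_derivative
      (\<lambda>h. (2 * c * \<beta> * ?p) *\<^sub>R h + (2 * c * \<beta> * (2 * ((x - y) \<bullet> h) * ((\<beta> - 1) * (?p / ?s x)))) *\<^sub>R (x - y))) (at x)"
      using has_derivative_scaleR[OF has_derivative_mult_right[OF dpow[OF x, of "\<beta> - 1"], of "2 * c * \<beta>"] sub]
      unfolding p .
    moreover have "(2 * c * \<beta> * ?p) *\<^sub>R h + (2 * c * \<beta> * (2 * ((x - y) \<bullet> h) * ((\<beta> - 1) * (?p / ?s x)))) *\<^sub>R (x - y)
      = H x *v h" for h
    proof -
      have "H x *v h = (2 * c * \<beta> * ?p) *\<^sub>R (h + ((2 * \<beta> - 2) * (((x - y) \<bullet> h) / (norm (x - y) * norm (x - y)))) *\<^sub>R (x - y))"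
        by (simp add: H_def scaleR_matrix_vector_assoc[symmetric] matrix_vector_mult_add_rdistrib outer_mult)
      then show ?thesis unfolding nrm by (simp add: scaleR_add_right algebra_simps)
    qed
    ultimately show ?thesis by simp
  qed
  have 3: "continuous_on (- {y}) H"
    unfolding H_def using spos by (intro continuous_intros continuous_on_outer) auto
  show "C2_on (- {y}) ?f" "\<And>x. x \<noteq> y \<Longrightarrow> hessian ?f x = (2 * c * \<beta> * ((x - y) \<bullet> (x - y)) powr (\<beta> - 1)) *\<^sub>R
       (mat 1 + (2 * \<beta> - 2) *\<^sub>R outer ((1 / norm (x - y)) *\<^sub>R (x - y)))"
    using C2_onI[OF _ 1 2 3] by (auto simp: H_def)
qed

lemma power_hessian_notin_Sigma:
  fixes y :: "real^'n"
  assumes "c > 0" "\<beta> > 0" and k: "1 \<le> k" "k \<le> CARD('n)" and \<beta>: "2 * \<beta> < 2 - real CARD('n) / real k"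
    and "x \<noteq> y"
  shows "hessian (\<lambda>x. m + c * ((x - y) \<bullet> (x - y)) powr \<beta>) x \<notin> Sigma_cone k"
proof -
  have "2 * c * \<beta> * ((x - y) \<bullet> (x - y)) powr (\<beta> - 1) > 0"
    using assms by simp
  moreover have "norm ((1 / norm (x - y)) *\<^sub>R (x - y)) = 1" using assms(6) by simp
  ultimately have "Sk k (hessian (\<lambda>x. m + c * ((x - y) \<bullet> (x - y)) powr \<beta>) x) < 0"
    unfolding C2_on_power(2)[OF assms(6)] using k \<beta> by (intro Sk_power_neg) auto
  then show ?thesis using k Sigma_cone_iff[OF k(2)] by (meson atLeastAtMost_iff linorder_not_less order_refl)
qed

text \<open>The trace S_1 is already negative. Hence a paraboloid opening downwards cannot touch a
  k-convex function from above.\<close>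

lemma neg_mat_notin_Sigma:
  assumes "c < 0" "1 \<le> k" "k \<le> CARD('n)"
  shows "c *\<^sub>R (mat 1 :: real^'n^'n) \<notin> Sigma_cone k"
proof -
  have "Sk 1 (c *\<^sub>R (mat 1 :: real^'n^'n)) < 0"
    using assms by (simp add: Sk_scaleR_mat_1 mult_pos_neg)
  then show ?thesis using assms Sigma_cone_iff[OF assms(3)] by (meson atLeastAtMost_iff linorder_not_less order_refl)
qed

section \<open>Comparison with powers of the distance\<close>

text \<open>Without a maximum, every x has a point \<open>g x\<close> of larger value, and the open
  sets where f < f(g x) cover K. In a finite subcover even the largest of the values f(g x) would be
  exceeded by another one.\<close>

lemma usc_attains_sup:
  fixes f :: "'a::topological_space \<Rightarrow> 'b::linorder"
  assumes K: "compact K" "K \<noteq> {}"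
    and usc: "\<And>x c. x \<in> K \<Longrightarrow> f x < c \<Longrightarrow> \<forall>\<^sub>F y in at x within K. f y < c"
  shows "\<exists>x\<in>K. \<forall>y\<in>K. f y \<le> f x"
proof (rule ccontr)
  assume "\<not> ?thesis"
  then have "\<forall>x\<in>K. \<exists>y\<in>K. f x < f y" by (auto simp: not_le)
  then obtain g where g: "\<And>x. x \<in> K \<Longrightarrow> g x \<in> K" "\<And>x. x \<in> K \<Longrightarrow> f x < f (g x)"
    by metis
  have "\<exists>U. open U \<and> x \<in> U \<and> (\<forall>y\<in>U \<inter> K. f y < f (g x))" if x: "x \<in> K" for x
  proof -
    obtain U where "open U" "x \<in> U" "\<forall>y\<in>U. y \<noteq> x \<longrightarrow> y \<in> K \<longrightarrow> f y < f (g x)"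
      using usc[OF x g(2)[OF x]] by (auto simp: eventually_at_topological)
    then show ?thesis using g(2)[OF x] by (intro exI[of _ U]) auto
  qed
  then obtain U where U: "\<And>x. x \<in> K \<Longrightarrow> open (U x)" "\<And>x. x \<in> K \<Longrightarrow> x \<in> U x"
      "\<And>x y. x \<in> K \<Longrightarrow> y \<in> U x \<Longrightarrow> y \<in> K \<Longrightarrow> f y < f (g x)"
    by (metis IntI)
  obtain C where C: "C \<subseteq> K" "finite C" "K \<subseteq> (\<Union>x\<in>C. U x)"
    by (rule compactE_image[OF K(1), of K U]) (use U in auto)
  have "C \<noteq> {}" using C K(2) by auto
  define M where "M = Max ((\<lambda>x. f (g x)) ` C)"
  have "M \<in> (\<lambda>x. f (g x)) ` C"
    unfolding M_def using C(2) \<open>C \<noteq> {}\<close> by (intro Max_in) auto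
  then obtain j where j: "j \<in> C" "f (g j) = M" by auto
  then obtain i where i: "i \<in> C" "g j \<in> U i" using C g(1) by blast
  have "f (g j) < f (g i)" using U(3) i j C g(1) by blast
  also have "\<dots> \<le> M" unfolding M_def using C(2) i by (intro Max_ge) auto
  finally show False using j by simp
qed

lemma usc_minus_continuous:
  fixes \<psi> :: "'a::topological_space \<Rightarrow> ereal" and \<phi> :: "'a \<Rightarrow> real"
  assumes usc: "\<And>c. \<psi> x < c \<Longrightarrow> \<forall>\<^sub>F y in F. \<psi> y < c"
    and \<phi>: "(\<phi> \<longlongrightarrow> \<phi> x) F" and c: "\<psi> x - ereal (\<phi> x) < c"
  shows "\<forall>\<^sub>F y in F. \<psi> y - ereal (\<phi> y) < c"
proof -
  \<comment> \<open>Real numbers r and s between the extended values leave room on both sides, so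
    that the strict inequalities can be subtracted in the reals even if \<psi>(x) =
    -\<infinity>.\<close>
  obtain r where r: "\<psi> x - ereal (\<phi> x) < ereal r" "ereal r < c"
    using ereal_dense2[OF c] by auto
  have "\<psi> x < ereal (r + \<phi> x)"
    using r(1) by (cases "\<psi> x") auto
  then obtain s where s: "\<psi> x < ereal s" "ereal s < ereal (r + \<phi> x)"
    using ereal_dense2 by blast
  have "\<forall>\<^sub>F y in F. s - r < \<phi> y"
    using s(2) by (intro order_tendstoD(1)[OF \<phi>]) auto
  with usc[OF s(1)] show ?thesis
  proof eventually_elim
    case (elim y)
    have "\<psi> y - ereal (\<phi> y) < ereal r"
      using elim by (cases "\<psi> y") auto
    then show ?case using r(2) by simp
  qed
qed

lemma touches_aboveI:
  assumes "C2_on V \<phi>" "x0 \<in> V" "\<And>y. y \<in> V \<Longrightarrow> y \<in> \<Omega> \<Longrightarrow> \<psi> y - ereal (\<phi> y) \<le> \<psi> x0 - ereal (\<phi> x0)"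
  shows "touches_above \<Omega> \<psi> x0 \<phi>"
proof -
  have "open V" using assms(1) by (simp add: C2_on_def)
  then have "\<forall>\<^sub>F x in at x0 within \<Omega>. \<psi> x - ereal (\<phi> x) \<le> \<psi> x0 - ereal (\<phi> x0)"
    using assms(2,3) unfolding eventually_at_topological by blast
  then show ?thesis using assms(1,2) by (auto simp: touches_above_def C2_near_def)
qed

lemma touches_belowI:
  assumes "C2_on V \<phi>" "x0 \<in> V" "\<And>y. y \<in> V \<Longrightarrow> y \<in> \<Omega> \<Longrightarrow> \<psi> y - ereal (\<phi> y) \<ge> \<psi> x0 - ereal (\<phi> x0)"
  shows "touches_below \<Omega> \<psi> x0 \<phi>"
proof -
  have "open V" using assms(1) by (simp add: C2_on_def)
  then have "\<forall>\<^sub>F x in at x0 within \<Omega>. \<psi> x - ereal (\<phi> x) \<ge> \<psi> x0 - ereal (\<phi> x0)"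
    using assms(2,3) unfolding eventually_at_topological by blast
  then show ?thesis using assms(1,2) by (auto simp: touches_below_def C2_near_def)
qed

lemma USC_minus_attains_sup:
  fixes \<psi> :: "real^'n \<Rightarrow> ereal"
  assumes "\<psi> \<in> USC \<Omega>" "compact K" "K \<noteq> {}" "K \<subseteq> \<Omega>" "continuous_on K \<phi>"
  shows "\<exists>x\<in>K. \<forall>y\<in>K. \<psi> y - ereal (\<phi> y) \<le> \<psi> x - ereal (\<phi> x)"
proof (rule usc_attains_sup[OF assms(2,3)])
  fix x c assume x: "x \<in> K" and c: "\<psi> x - ereal (\<phi> x) < c"
  show "\<forall>\<^sub>F y in at x within K. \<psi> y - ereal (\<phi> y) < c"
  proof (rule usc_minus_continuous[where \<psi> = \<psi> and x = x and \<phi> = \<phi> and c = c, OF _ _ c])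
    show "\<forall>\<^sub>F y in at x within K. \<psi> y < c" if "\<psi> x < c" for c
    proof -
      have "\<forall>\<^sub>F y in at x within \<Omega>. \<psi> y < c" using assms(1,4) x that by (auto simp: USC_def)
      then show ?thesis using at_le[OF assms(4)] by (rule filter_leD[rotated])
    qed
    show "(\<phi> \<longlongrightarrow> \<phi> x) (at x within K)" using assms(5) x by (auto simp: continuous_on_def)
  qed
qed

text \<open>Comparison with the power \<open>|x - y|\<^bsup>2\<beta>\<^esup>\<close>, which no \<open>k\<close>-convex function can touch from below
  away from \<open>y\<close>. It replaces the Harnack inequality, the strong maximum principle and the interior
  Hoelder estimate.\<close>

lemma k_convex_power_bound:
  fixes \<psi> :: "real^'n \<Rightarrow> ereal"
  assumes conv: "k_convex k \<Omega> \<psi>" and k: "1 \<le> k" "k \<le> CARD('n)"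
    and \<beta>: "\<beta> > 0" "2 * \<beta> < 2 - real CARD('n) / real k"
    and R: "R > 0" "cball y R \<subseteq> \<Omega>" and nonpos: "\<And>x. x \<in> cball y R \<Longrightarrow> \<psi> x \<le> 0"
    and m: "m < 0" "\<psi> y \<le> ereal m" and x: "x \<in> cball y R"
  shows "\<psi> x \<le> ereal (m * (1 - ((dist x y)\<^sup>2 / R\<^sup>2) powr \<beta>))"
proof -
  \<comment> \<open>Normalised so that the comparison function equals m at y and 0 on the sphere of
    radius R.\<close>
  define c where "c = - m / (R\<^sup>2) powr \<beta>"
  define \<phi> where "\<phi> = (\<lambda>x. m + c * ((x - y) \<bullet> (x - y)) powr \<beta>)"
  have c: "c > 0" unfolding c_def using m R by (intro divide_pos_pos) auto
  have \<phi>: "\<phi> x = m * (1 - ((dist x y)\<^sup>2 / R\<^sup>2) powr \<beta>)" for x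
  proof -
    have "((dist x y)\<^sup>2 / R\<^sup>2) powr \<beta> = ((x - y) \<bullet> (x - y)) powr \<beta> / (R\<^sup>2) powr \<beta>"
      by (simp add: powr_divide dist_norm power2_norm_eq_inner)
    then show ?thesis by (simp add: \<phi>_def c_def right_diff_distrib)
  qed
  have \<phi>C2: "C2_on (- {y}) \<phi>" unfolding \<phi>_def by (rule C2_on_power)
  have "continuous_on (cball y R) \<phi>"
    unfolding \<phi>_def using \<beta> by (intro continuous_intros continuous_on_powr') auto
  then obtain x0 where x0: "x0 \<in> cball y R"
      and max: "\<And>z. z \<in> cball y R \<Longrightarrow> \<psi> z - ereal (\<phi> z) \<le> \<psi> x0 - ereal (\<phi> x0)"
    using USC_minus_attains_sup[of \<psi> \<Omega> "cball y R" \<phi>] conv R by (auto simp: k_convex_def)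
  have "\<psi> x0 - ereal (\<phi> x0) \<le> 0"
  proof -
    \<comment> \<open>At y and on the sphere the normalisation gives the inequality; anywhere else
      the power is C^2 and would touch \<psi> from above with a Hessian outside the cone.\<close>
    consider "x0 = y" | "dist x0 y = R" | "x0 \<in> ball y R - {y}"
      using x0 by (fastforce simp: dist_commute)
    then show ?thesis
    proof cases
      case 1
      then show ?thesis using m(2) \<beta> by (cases "\<psi> y") (auto simp: \<phi>)
    next
      case 2
      then have "\<phi> x0 = 0" using R by (simp add: \<phi>)
      then show ?thesis using nonpos[OF x0] by (simp add: zero_ereal_def[symmetric])
    next
      case 3
      have "C2_on (ball y R - {y}) \<phi>"
        by (rule C2_on_subset[OF \<phi>C2]) auto
      then have "touches_above \<Omega> \<psi> x0 \<phi>"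
        using 3 max by (intro touches_aboveI[of "ball y R - {y}"]) auto
      then have "hessian \<phi> x0 \<in> Sigma_cone k"
        using conv x0 R by (auto simp: k_convex_def)
      then show ?thesis
        using power_hessian_notin_Sigma[OF c \<beta>(1) k \<beta>(2), of x0 y m] 3 by (auto simp: \<phi>_def)
    qed
  qed
  then have "\<psi> x - ereal (\<phi> x) \<le> 0" using max[OF x] by (rule order.trans[rotated])
  then show ?thesis unfolding \<phi>[symmetric] by (cases "\<psi> x") auto
qed

text \<open>The radius within which the power bound retains half of the central value. It is
  independent of m, so one ball serves all functions regardless of their size.\<close>

lemma k_convex_half_bound:
  assumes \<beta>: "(\<beta>::real) > 0" and R: "R > 0"
  obtains \<rho> where "0 < \<rho>" "\<rho> \<le> R"
    "\<And>d m. 0 \<le> d \<Longrightarrow> d \<le> \<rho> \<Longrightarrow> m < 0 \<Longrightarrow> m * (1 - (d\<^sup>2 / R\<^sup>2) powr \<beta>) \<le> m / 2"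
proof
  define t where "t = (1 / 2 :: real) powr (1 / \<beta>)"
  have t: "0 < t" "t \<le> 1" "t powr \<beta> = 1 / 2"
    using \<beta> powr_mono2[of "1 / \<beta>" "1 / 2" 1] by (auto simp: t_def powr_powr)
  show "0 < R * sqrt t" "R * sqrt t \<le> R" using R t by auto
  fix d m :: real assume d: "0 \<le> d" "d \<le> R * sqrt t" and m: "m < 0"
  have "d\<^sup>2 \<le> (R * sqrt t)\<^sup>2" using d by (intro power_mono)
  then have "d\<^sup>2 / R\<^sup>2 \<le> t" using R t by (simp add: power_mult_distrib divide_le_eq mult.commute)
  then have "(d\<^sup>2 / R\<^sup>2) powr \<beta> \<le> t powr \<beta>" using \<beta> by (intro powr_mono2) auto
  then have "1 - (d\<^sup>2 / R\<^sup>2) powr \<beta> \<ge> 1 / 2" using t by simp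
  from mult_left_mono_neg[OF this, of m] show "m * (1 - (d\<^sup>2 / R\<^sup>2) powr \<beta>) \<le> m / 2" using m by simp
qed

text \<open>With p = -\<psi>(y), compare \<psi> with the paraboloid a|x - y|^2, a = 2p/\<rho>^2. On
  the sphere of radius \<rho> it equals 2p, which excludes a maximum of the difference there, while
  \<psi> \<le> -p/2 in the whole ball. At the interior maximum the inequality yields \<mu>(p/2)^k
  \<le> C(2a)^k, and by homogeneity p cancels.\<close>

lemma Lambda_set_bounded:
  fixes \<Omega> :: "(real^'n) set"
  assumes k: "1 \<le> k" "k \<le> CARD('n)" "real k > real CARD('n) / 2"
    and \<Omega>: "open \<Omega>" "\<Omega> \<noteq> {}"
  shows "\<exists>B. \<forall>\<mu>\<in>Lambda_set k \<Omega>. \<mu> \<le> B"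
proof -
  \<comment> \<open>The exponent 2\<beta> is half of 2 - N/k, hence strictly between 0 and that
    bound.\<close>
  define \<beta> where "\<beta> = (2 - real CARD('n) / real k) / 4"
  have \<beta>: "\<beta> > 0" "2 * \<beta> < 2 - real CARD('n) / real k"
    using k by (auto simp: \<beta>_def field_simps)
  obtain y where y: "y \<in> \<Omega>" using \<Omega> by auto
  then obtain R where R: "R > 0" "cball y R \<subseteq> \<Omega>" using \<Omega> open_contains_cball by blast
  obtain \<rho> where \<rho>: "0 < \<rho>" "\<rho> \<le> R"
    and half: "\<And>d m. 0 \<le> d \<Longrightarrow> d \<le> \<rho> \<Longrightarrow> m < 0 \<Longrightarrow> m * (1 - (d\<^sup>2 / R\<^sup>2) powr \<beta>) \<le> m / 2"
    using k_convex_half_bound[OF \<beta>(1) R(1)] by blast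
  define C where "C = real (CARD('n) choose k)"
  have "\<mu> \<le> C * (8 / \<rho>\<^sup>2) ^ k" if \<mu>: "\<mu> \<in> Lambda_set k \<Omega>" for \<mu>
  proof (cases "\<mu> \<le> 0")
    case True
    then show ?thesis by (rule order.trans) (simp add: C_def)
  next
    case False
    obtain \<psi> where \<psi>: "\<psi> \<in> Phi_minus k \<Omega>"
      and sub: "\<forall>x0\<in>\<Omega>. \<forall>\<phi>. touches_above \<Omega> \<psi> x0 \<phi> \<longrightarrow>
        ereal (Sk k (hessian \<phi> x0)) + ereal \<mu> * \<psi> x0 * \<bar>\<psi> x0\<bar> ^ (k - 1) \<ge> 0"
      using \<mu> unfolding Lambda_set_def by auto
    have usc: "\<psi> \<in> USC \<Omega>" and conv: "k_convex k \<Omega> \<psi>" and neg: "\<And>x. x \<in> \<Omega> \<Longrightarrow> \<psi> x < 0"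
      using \<psi> by (auto simp: Phi_minus_def)
    have nonpos: "\<psi> x \<le> 0" if "x \<in> cball y R" for x using neg[of x] that R by auto
    have cb: "cball y \<rho> \<subseteq> cball y R" using \<rho> by auto
    have hb: "\<psi> x \<le> ereal (m / 2)" if "m < 0" "\<psi> y \<le> ereal m" "x \<in> cball y \<rho>" for x m
    proof -
      have "\<psi> x \<le> ereal (m * (1 - ((dist x y)\<^sup>2 / R\<^sup>2) powr \<beta>))"
        using that cb by (intro k_convex_power_bound[OF conv k(1,2) \<beta> R nonpos]) auto
      also have "\<dots> \<le> ereal (m / 2)"
        using half[of "dist x y" m] that by (simp add: dist_commute)
      finally show ?thesis .
    qed
    \<comment> \<open>If \<psi>(y) were -\<infinity>, the half bound with arbitrarily negative m
      would give \<psi> = -\<infinity> on a whole ball; there every smooth function touches from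
      above, even a concave paraboloid.\<close>
    have "\<psi> y \<noteq> - \<infinity>"
    proof
      assume inf: "\<psi> y = - \<infinity>"
      have "\<psi> x = - \<infinity>" if "x \<in> cball y \<rho>" for x
      proof (rule ereal_bot)
        fix B :: real
        have "\<psi> x \<le> ereal ((2 * min B (-1)) / 2)"
          by (rule hb) (use inf that in auto)
        also have "\<dots> \<le> ereal B" by simp
        finally show "\<psi> x \<le> ereal B" .
      qed
      moreover have "C2_on (ball y \<rho>) (\<lambda>x. 0 + (- 1) * ((x - y) \<bullet> (x - y)))"
        by (rule C2_on_subset[OF C2_on_sq_dist(1)]) auto
      ultimately have "touches_above \<Omega> \<psi> y (\<lambda>x. 0 + (- 1) * ((x - y) \<bullet> (x - y)))"
        using \<rho> by (intro touches_aboveI[of "ball y \<rho>"]) (auto simp: inf)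
      then have "hessian (\<lambda>x. 0 + (- 1) * ((x - y) \<bullet> (x - y))) y \<in> Sigma_cone k"
        using conv y by (auto simp: k_convex_def)
      then show False
        unfolding C2_on_sq_dist(2) using neg_mat_notin_Sigma[of "2 * - 1" k, where 'n='n] k by simp
    qed
    then obtain p where p: "\<psi> y = ereal (- p)" "p > 0"
      using neg[OF y] by (cases "\<psi> y") (auto intro: that[of "- r" for r])
    define a where "a = 2 * p / \<rho>\<^sup>2"
    have a: "a > 0" using p \<rho> by (simp add: a_def)
    define \<phi> where "\<phi> = (\<lambda>x. 0 + a * ((x - y) \<bullet> (x - y)))"
    have "continuous_on (cball y \<rho>) \<phi>"
      unfolding \<phi>_def by (intro continuous_intros)
    then obtain x0 where x0: "x0 \<in> cball y \<rho>"
      and max: "\<And>z. z \<in> cball y \<rho> \<Longrightarrow> \<psi> z - ereal (\<phi> z) \<le> \<psi> x0 - ereal (\<phi> x0)"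
      using USC_minus_attains_sup[OF usc, of "cball y \<rho>" \<phi>] \<rho> cb R by fastforce
    have x0\<Omega>: "x0 \<in> \<Omega>" using x0 cb R by auto
    have le: "ereal (- p) \<le> \<psi> x0 - ereal (\<phi> x0)"
      using max[of y] \<rho> p by (simp add: \<phi>_def)
    have up: "\<psi> x0 \<le> ereal (- p / 2)" using hb[of "- p" x0] p x0 by simp
    obtain q where q: "\<psi> x0 = ereal (- q)"
      using le up by (cases "\<psi> x0") (auto intro: that[of "- r" for r])
    have q2: "q \<ge> p / 2" using up q by simp
    have "dist y x0 < \<rho>"
    proof (rule ccontr)
      assume "\<not> dist y x0 < \<rho>"
      then have "dist y x0 = \<rho>" using x0 by simp
      then have "(x0 - y) \<bullet> (x0 - y) = \<rho>\<^sup>2"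
        by (simp add: power2_norm_eq_inner[symmetric] dist_norm norm_minus_commute)
      then have "\<phi> x0 = 2 * p" using \<rho> by (simp add: \<phi>_def a_def)
      then show False using le q q2 p by simp
    qed
    moreover have "C2_on (ball y \<rho>) \<phi>"
      unfolding \<phi>_def by (rule C2_on_subset[OF C2_on_sq_dist(1)]) auto
    ultimately have "touches_above \<Omega> \<psi> x0 \<phi>"
      using max by (intro touches_aboveI[of "ball y \<rho>"]) auto
    from sub[rule_format, OF x0\<Omega> this] have "0 \<le> C * (2 * a) ^ k + \<mu> * (- q) * \<bar>- q\<bar> ^ (k - 1)"
      unfolding \<phi>_def C2_on_sq_dist(2) Sk_scaleR_mat_1 q C_def by simp
    moreover have "\<mu> * (- q) * \<bar>- q\<bar> ^ (k - 1) = - (\<mu> * q ^ k)"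
      using q2 p k by (cases k) auto
    ultimately have "\<mu> * q ^ k \<le> C * (2 * a) ^ k" by linarith
    moreover have "\<mu> * (p / 2) ^ k \<le> \<mu> * q ^ k"
      using False q2 p by (intro mult_left_mono power_mono) auto
    ultimately have "\<mu> * (p / 2) ^ k \<le> C * (2 * a) ^ k" by linarith
    also have "2 * a = (8 / \<rho>\<^sup>2) * (p / 2)" by (simp add: a_def)
    finally have "\<mu> * (p / 2) ^ k \<le> (C * (8 / \<rho>\<^sup>2) ^ k) * (p / 2) ^ k"
      by (simp only: power_mult_distrib mult.assoc)
    then show ?thesis using p by (simp add: mult_le_cancel_right)
  qed
  then show ?thesis by blast
qed

section \<open>Admissible solutions\<close>

lemma admissible_k_convex:
  assumes "open \<Omega>" "admissible_solution k \<Omega> g u"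
  shows "k_convex k \<Omega> (\<lambda>x. ereal (u x))"
proof -
  have cont: "continuous_on (closure \<Omega>) u" using assms(2) by (simp add: admissible_solution_def)
  have "\<forall>\<^sub>F y in at x within \<Omega>. ereal (u y) < c" if x: "x \<in> \<Omega>" "ereal (u x) < c" for x c
  proof -
    have "(u \<longlongrightarrow> u x) (at x within \<Omega>)"
      using continuous_on_subset[OF cont closure_subset] x by (auto simp: continuous_on_def)
    then have "((\<lambda>y. ereal (u y)) \<longlongrightarrow> ereal (u x)) (at x within \<Omega>)" by simp
    then show ?thesis using x(2) by (rule order_tendstoD(2))
  qed
  then show ?thesis using assms(2)
    by (auto simp: k_convex_def USC_def admissible_solution_def)
qed

text \<open>A positive interior maximum would survive the perturbation by a small multiple of
  \<open>|x - x\<^sub>1|\<^sup>2\<close>, and then be touched by a strictly concave paraboloid.\<close>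

lemma k_convex_max_principle:
  fixes u :: "real^'n \<Rightarrow> real"
  assumes k: "1 \<le> k" "k \<le> CARD('n)" and \<Omega>: "open \<Omega>" "bounded \<Omega>"
    and conv: "k_convex k \<Omega> (\<lambda>x. ereal (u x))" and cont: "continuous_on (closure \<Omega>) u"
    and bdry: "\<And>x. x \<in> frontier \<Omega> \<Longrightarrow> u x \<le> 0" and x1: "x1 \<in> \<Omega>"
  shows "u x1 \<le> 0"
proof (rule ccontr)
  assume "\<not> u x1 \<le> 0"
  then have pos: "u x1 > 0" by simp
  have "compact (closure \<Omega>)" using \<Omega>(2) by simp
  then obtain D where D: "\<And>x. x \<in> closure \<Omega> \<Longrightarrow> dist x1 x \<le> D"
    using bounded_any_center[of "closure \<Omega>" x1] compact_imp_bounded by blast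
  have D0: "D \<ge> 0" using D[of x1] x1 closure_subset by auto
  \<comment> \<open>On the boundary u + e|x - x1|^2 is at most eD^2 < u(x1), so the perturbed
    maximum is interior; the summand 1 keeps the denominator positive.\<close>
  define e where "e = u x1 / (D\<^sup>2 + 1)"
  have e: "e > 0" using pos by (simp add: e_def add_nonneg_pos)
  have eD: "e * D\<^sup>2 < u x1"
  proof -
    have "e * (D\<^sup>2 + 1) = u x1" using add_nonneg_pos[of "D\<^sup>2" 1] by (simp add: e_def)
    then show ?thesis using e by (simp add: distrib_left)
  qed
  define \<phi> where "\<phi> = (\<lambda>x. 0 + (- e) * ((x - x1) \<bullet> (x - x1)))"
  have "continuous_on (closure \<Omega>) (\<lambda>x. u x - \<phi> x)"
    unfolding \<phi>_def by (intro continuous_intros cont)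
  moreover have "closure \<Omega> \<noteq> {}" using x1 by auto
  ultimately have "\<exists>x\<in>closure \<Omega>. \<forall>y\<in>closure \<Omega>. u y - \<phi> y \<le> u x - \<phi> x"
    using continuous_attains_sup[OF \<open>compact (closure \<Omega>)\<close>] by blast
  then obtain x0 where x0: "x0 \<in> closure \<Omega>"
    and max: "\<And>y. y \<in> closure \<Omega> \<Longrightarrow> u y - \<phi> y \<le> u x0 - \<phi> x0" by auto
  have "x0 \<in> \<Omega>"
  proof (rule ccontr)
    assume "x0 \<notin> \<Omega>"
    then have "u x0 \<le> 0" using bdry x0 \<Omega>(1) by (auto simp: frontier_def interior_open)
    moreover have "u x1 \<le> u x0 - \<phi> x0"
      using max[of x1] x1 closure_subset by (auto simp: \<phi>_def)
    moreover have "(dist x1 x0)\<^sup>2 \<le> D\<^sup>2" using D[OF x0] by (intro power_mono) auto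
    then have "e * (dist x1 x0)\<^sup>2 \<le> e * D\<^sup>2" using e by simp
    moreover have "(dist x1 x0)\<^sup>2 = (x0 - x1) \<bullet> (x0 - x1)"
      by (simp add: dist_norm norm_minus_commute power2_norm_eq_inner)
    ultimately show False using eD by (simp add: \<phi>_def)
  qed
  moreover have "C2_on UNIV \<phi>" unfolding \<phi>_def by (rule C2_on_sq_dist)
  ultimately have "touches_above \<Omega> (\<lambda>x. ereal (u x)) x0 \<phi>"
    using max closure_subset[of \<Omega>] by (intro touches_aboveI[of UNIV]) auto
  then have "hessian \<phi> x0 \<in> Sigma_cone k" using conv \<open>x0 \<in> \<Omega>\<close> by (auto simp: k_convex_def)
  then show False
    unfolding \<phi>_def C2_on_sq_dist(2) using neg_mat_notin_Sigma[of "2 * - e" k, where 'n='n] k e by simp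
qed

text \<open>The maximum principle gives u \<le> 0. An interior zero would then be touched from above
  by the constant 0, whose Hessian gives 0 \<ge> g(x,0) > 0.\<close>

lemma admissible_negative:
  fixes u :: "real^'n \<Rightarrow> real"
  assumes k: "1 \<le> k" "k \<le> CARD('n)" and \<Omega>: "open \<Omega>" "bounded \<Omega>"
    and u: "admissible_solution k \<Omega> g u" and g: "\<And>x. x \<in> \<Omega> \<Longrightarrow> g x 0 > 0"
    and bdry: "\<And>x. x \<in> frontier \<Omega> \<Longrightarrow> u x = 0" and x1: "x1 \<in> \<Omega>"
  shows "u x1 < 0"
proof -
  have le: "u x \<le> 0" if "x \<in> \<Omega>" for x
    using k_convex_max_principle[OF k \<Omega> admissible_k_convex[OF \<Omega>(1) u]] u bdry that
    by (auto simp: admissible_solution_def)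
  have "u x1 \<noteq> 0"
  proof
    assume u0: "u x1 = 0"
    let ?\<phi> = "\<lambda>x. 0 + 0 * ((x - x1) \<bullet> (x - x1))"
    have "touches_above \<Omega> (\<lambda>x. ereal (u x)) x1 ?\<phi>"
      by (rule touches_aboveI[OF C2_on_sq_dist(1)]) (use le u0 in auto)
    then have "Sk k (hessian ?\<phi> x1) \<ge> g x1 (u x1)"
      using u x1 unfolding admissible_solution_def by blast
    then show False
      using g[OF x1] k unfolding C2_on_sq_dist(2) Sk_scaleR_mat_1 by (simp add: u0 power_0_left)
  qed
  then show ?thesis using le[OF x1] by simp
qed

text \<open>Since |u| \<le> M, the source term 1 is at least |u|^k / M^k and can be counted as an
  increase of the eigenvalue parameter.\<close>

lemma admissible_Lambda_set:
  assumes "open \<Omega>" "k \<ge> 1" and u: "admissible_solution k \<Omega> (\<lambda>x s. 1 - \<mu> * s * \<bar>s\<bar> ^ (k - 1)) u"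
    and neg: "\<And>x. x \<in> \<Omega> \<Longrightarrow> u x < 0" and M: "\<And>x. x \<in> \<Omega> \<Longrightarrow> \<bar>u x\<bar> \<le> M" "M > 0"
  shows "\<mu> + 1 / M ^ k \<in> Lambda_set k \<Omega>"
proof -
  have conv: "k_convex k \<Omega> (\<lambda>x. ereal (u x))" by (rule admissible_k_convex[OF assms(1) u])
  then have "(\<lambda>x. ereal (u x)) \<in> Phi_minus k \<Omega>"
    using neg by (auto simp: Phi_minus_def k_convex_def)
  moreover have "ereal (Sk k (hessian \<phi> x0)) + ereal (\<mu> + 1 / M ^ k) * ereal (u x0) * \<bar>ereal (u x0)\<bar> ^ (k - 1) \<ge> 0"
    if x0: "x0 \<in> \<Omega>" and t: "touches_above \<Omega> (\<lambda>x. ereal (u x)) x0 \<phi>" for x0 \<phi>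
  proof -
    have pw: "u x0 * \<bar>u x0\<bar> ^ (k - 1) = - (\<bar>u x0\<bar> ^ k)"
      using neg[OF x0] assms(2) by (cases k) auto
    have "Sk k (hessian \<phi> x0) \<ge> 1 - \<mu> * u x0 * \<bar>u x0\<bar> ^ (k - 1)"
      using u x0 t unfolding admissible_solution_def by blast
    then have "Sk k (hessian \<phi> x0) \<ge> 1 + \<mu> * \<bar>u x0\<bar> ^ k"
      by (simp only: mult.assoc pw)
    moreover have "\<bar>u x0\<bar> ^ k / M ^ k \<le> 1"
      using M(1)[OF x0] M(2) by (simp add: power_mono)
    ultimately have "0 \<le> Sk k (hessian \<phi> x0) + (\<mu> + 1 / M ^ k) * (- (\<bar>u x0\<bar> ^ k))"
      by (simp add: algebra_simps)
    then show ?thesis unfolding pw[symmetric] by (simp add: mult.assoc)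
  qed
  ultimately show ?thesis unfolding Lambda_set_def by blast
qed

section \<open>Homogeneity under positive multiples\<close>

lemma touches_above_scale:
  fixes u :: "real^'n \<Rightarrow> real"
  assumes t: "touches_above \<Omega> (\<lambda>x. ereal (c * u x)) x0 \<phi>" and c: "c > 0"
  shows "touches_above \<Omega> (\<lambda>x. ereal (u x)) x0 (\<lambda>x. (1 / c) * \<phi> x)"
proof -
  have "c * (u y - (1 / c) * \<phi> y) = c * u y - \<phi> y" for y
    using c by (simp add: right_diff_distrib)
  then have eq: "u x - (1 / c) * \<phi> x \<le> u x0 - (1 / c) * \<phi> x0 \<longleftrightarrow> c * u x - \<phi> x \<le> c * u x0 - \<phi> x0" for x
    using mult_le_cancel_left_pos[OF c] by metis
  obtain U where "x0 \<in> U" "C2_on U \<phi>" using t unfolding touches_above_def C2_near_def by auto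
  then have "C2_near x0 (\<lambda>x. (1 / c) * \<phi> x)"
    unfolding C2_near_def using C2_on_scale(1) by (intro exI[of _ U] conjI)
  moreover have "\<forall>\<^sub>F x in at x0 within \<Omega>. c * u x - \<phi> x \<le> c * u x0 - \<phi> x0"
    using t by (simp add: touches_above_def)
  ultimately show ?thesis
    unfolding touches_above_def ereal_minus ereal_less_eq(3) eq by (rule conjI)
qed

lemma touches_below_scale:
  fixes u :: "real^'n \<Rightarrow> real"
  assumes t: "touches_below \<Omega> (\<lambda>x. ereal (c * u x)) x0 \<phi>" and c: "c > 0"
  shows "touches_below \<Omega> (\<lambda>x. ereal (u x)) x0 (\<lambda>x. (1 / c) * \<phi> x)"
proof -
  have "c * (u y - (1 / c) * \<phi> y) = c * u y - \<phi> y" for y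
    using c by (simp add: right_diff_distrib)
  then have eq: "u x - (1 / c) * \<phi> x \<ge> u x0 - (1 / c) * \<phi> x0 \<longleftrightarrow> c * u x - \<phi> x \<ge> c * u x0 - \<phi> x0" for x
    using mult_le_cancel_left_pos[OF c] by metis
  obtain U where "x0 \<in> U" "C2_on U \<phi>" using t unfolding touches_below_def C2_near_def by auto
  then have "C2_near x0 (\<lambda>x. (1 / c) * \<phi> x)"
    unfolding C2_near_def using C2_on_scale(1) by (intro exI[of _ U] conjI)
  moreover have "\<forall>\<^sub>F x in at x0 within \<Omega>. c * u x - \<phi> x \<ge> c * u x0 - \<phi> x0"
    using t by (simp add: touches_below_def)
  ultimately show ?thesis
    unfolding touches_below_def ereal_minus ereal_less_eq(3) eq by (rule conjI)
qed

lemma C2_near_hessian_scale: "C2_near x \<phi> \<Longrightarrow> hessian (\<lambda>x. c * \<phi> x) x = c *\<^sub>R hessian \<phi> x"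
  by (auto simp: C2_near_def C2_on_scale(2))

lemma Sigma_cone_scaleR:
  fixes A :: "real^'n^'n"
  assumes "k \<le> CARD('n)" "c > 0"
  shows "c *\<^sub>R A \<in> Sigma_cone k \<longleftrightarrow> A \<in> Sigma_cone k"
proof -
  have 1: "c *\<^sub>R A \<in> Sigma_cone k" if "A \<in> Sigma_cone k" "c > 0" for c and A :: "real^'n^'n"
    using that assms(1) by (auto simp: Sigma_cone_iff Sk_scaleR transpose_scaleR)
  show ?thesis using 1[of A c] 1[of "c *\<^sub>R A" "1 / c"] assms by auto
qed

text \<open>S_k and the zero-order term are both homogeneous of degree k, so only the constant a
  acquires a factor. Dividing by the sup norm M thus turns the source 1 into 1/M^k.\<close>

lemma admissible_scale:
  fixes u :: "real^'n \<Rightarrow> real"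
  assumes k: "1 \<le> k" "k \<le> CARD('n)" and c: "c > 0"
    and u: "admissible_solution k \<Omega> (\<lambda>x s. a - \<mu> * s * \<bar>s\<bar> ^ (k - 1)) u"
  shows "admissible_solution k \<Omega> (\<lambda>x s. a * c ^ k - \<mu> * s * \<bar>s\<bar> ^ (k - 1)) (\<lambda>x. c * u x)"
proof -
  have rhs: "a * c ^ k - \<mu> * (c * s) * \<bar>c * s\<bar> ^ (k - 1) = c ^ k * (a - \<mu> * s * \<bar>s\<bar> ^ (k - 1))" for s
  proof -
    have "c * c ^ (k - 1) = c ^ k" using k by (cases k) auto
    moreover have "\<bar>c * s\<bar> ^ (k - 1) = c ^ (k - 1) * \<bar>s\<bar> ^ (k - 1)"
      using c by (simp add: abs_mult power_mult_distrib)
    ultimately show ?thesis by (simp add: algebra_simps)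
  qed
  have main: "c ^ k * Sk k ((1 / c) *\<^sub>R A) = Sk k A" if "A \<in> Sigma_cone k" for A :: "real^'n^'n"
    using that k c by (simp add: Sigma_cone_iff Sk_scaleR power_divide)
  have ck: "c ^ k > 0" using c by simp
  have ab: "Sk k (hessian \<phi> x0) \<ge> c ^ k * (a - \<mu> * u x0 * \<bar>u x0\<bar> ^ (k - 1)) \<and> hessian \<phi> x0 \<in> Sigma_cone k"
    if x0: "x0 \<in> \<Omega>" and t: "touches_above \<Omega> (\<lambda>x. ereal (c * u x)) x0 \<phi>" for x0 \<phi>
  proof -
    have h: "hessian (\<lambda>x. (1 / c) * \<phi> x) x0 = (1 / c) *\<^sub>R hessian \<phi> x0"
      using t by (intro C2_near_hessian_scale) (simp add: touches_above_def)
    have "Sk k ((1 / c) *\<^sub>R hessian \<phi> x0) \<ge> a - \<mu> * u x0 * \<bar>u x0\<bar> ^ (k - 1) \<and> (1 / c) *\<^sub>R hessian \<phi> x0 \<in> Sigma_cone k"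
      using u x0 touches_above_scale[OF t c] unfolding admissible_solution_def h[symmetric] by blast
    then show ?thesis
      using Sigma_cone_scaleR[OF k(2), of "1 / c" "hessian \<phi> x0"] main[of "hessian \<phi> x0"] c ck
      by (metis divide_pos_pos mult_left_mono less_imp_le zero_less_one)
  qed
  have be: "Sk k (hessian \<phi> x0) \<le> c ^ k * (a - \<mu> * u x0 * \<bar>u x0\<bar> ^ (k - 1)) \<or> hessian \<phi> x0 \<notin> Sigma_cone k"
    if x0: "x0 \<in> \<Omega>" and t: "touches_below \<Omega> (\<lambda>x. ereal (c * u x)) x0 \<phi>" for x0 \<phi>
  proof -
    have h: "hessian (\<lambda>x. (1 / c) * \<phi> x) x0 = (1 / c) *\<^sub>R hessian \<phi> x0"
      using t by (intro C2_near_hessian_scale) (simp add: touches_below_def)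
    have "Sk k ((1 / c) *\<^sub>R hessian \<phi> x0) \<le> a - \<mu> * u x0 * \<bar>u x0\<bar> ^ (k - 1) \<or> (1 / c) *\<^sub>R hessian \<phi> x0 \<notin> Sigma_cone k"
      using u x0 touches_below_scale[OF t c] unfolding admissible_solution_def h[symmetric] by blast
    then show ?thesis
      using Sigma_cone_scaleR[OF k(2), of "1 / c" "hessian \<phi> x0"] main[of "hessian \<phi> x0"] c ck
      by (metis divide_pos_pos mult_left_mono less_imp_le zero_less_one)
  qed
  have "continuous_on (closure \<Omega>) (\<lambda>x. c * u x)"
    using u by (auto simp: admissible_solution_def intro: continuous_intros)
  then show ?thesis using ab be unfolding admissible_solution_def rhs by blast
qed

section \<open>Boundary barriers\<close>

lemma orthonormal_family_expansion:
  fixes f :: "'i \<Rightarrow> real^'n"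
  assumes I: "finite I" "card I = CARD('n)"
    and on: "\<And>i j. i \<in> I \<Longrightarrow> j \<in> I \<Longrightarrow> f i \<bullet> f j = (if i = j then 1 else 0)"
  shows "(\<Sum>i\<in>I. (z \<bullet> f i) *\<^sub>R f i) = z"
proof -
  have inj: "inj_on f I"
  proof (rule inj_onI)
    fix i j assume "i \<in> I" "j \<in> I" "f i = f j"
    then show "i = j" using on[of i j] on[of j j] by (auto split: if_splits)
  qed
  have orth: "pairwise orthogonal (f ` I)"
    using on by (auto simp: pairwise_def orthogonal_def split: if_splits)
  have nz: "0 \<notin> f ` I" using on by force
  have "independent (f ` I)" by (rule pairwise_orthogonal_independent[OF orth nz])
  moreover have "card (f ` I) = CARD('n)" using I inj by (simp add: card_image)
  ultimately have "UNIV \<subseteq> span (f ` I)"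
    by (intro card_ge_dim_independent) auto
  moreover have "norm b = 1" if "b \<in> f ` I" for b using on that by (auto simp: norm_eq_1)
  ultimately have "(\<Sum>b\<in>f ` I. (z \<bullet> b) *\<^sub>R b) = z"
    using orth I(1) by (intro orthonormal_basis_expand) auto
  then show ?thesis by (simp add: sum.reindex[OF inj])
qed

text \<open>The quadratic polynomial \<open>q(z) = -z\<bullet>\<nu> + 1/2 z\<bullet>Az\<close>, with \<open>A\<close> having the principal curvatures and a
  large \<open>s\<close> as eigenvalues up to the shift \<open>-2\<delta>\<close>, lies below \<open>-\<delta>|z|\<^sup>2/2\<close> in the domain. It plays the
  role of the convexified distance function.\<close>

lemma boundary_quadratic:
  fixes \<Omega> :: "(real^'n) set"
  assumes k: "2 \<le> k" "k \<le> CARD('n)" and \<Omega>: "open \<Omega>" "strictly_m_convex (k - 1) \<Omega>"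
    and y: "y \<in> frontier \<Omega>"
  shows "\<exists>\<nu> A \<delta> r. \<delta> > 0 \<and> r > 0 \<and> transpose A = A \<and> (\<forall>j\<in>{1..k}. Sk j A > 0) \<and>
    (\<forall>x\<in>\<Omega> \<inter> ball y r. - \<nu> \<bullet> (x - y) + ((x - y) \<bullet> (A *v (x - y))) / 2 \<le> - \<delta> * ((x - y) \<bullet> (x - y)))"
proof -
  define m where "m = CARD('n) - 1"
  have N: "CARD('n) = Suc m" using k by (simp add: m_def)
  obtain \<kappa> where pc: "principal_curvatures \<Omega> y \<kappa>" and \<kappa>: "\<forall>j\<in>{1..k-1}. esym {..<m} j \<kappa> > 0"
    using \<Omega>(2) y unfolding strictly_m_convex_def m_def by auto
  obtain \<nu> \<phi> e where lg: "local_graph \<Omega> y \<nu> \<phi>" and gr: "\<forall>v. v \<bullet> \<nu> = 0 \<longrightarrow> grad \<phi> 0 \<bullet> v = 0"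
    and e\<nu>: "\<forall>i<m. e i \<bullet> \<nu> = 0" and ee: "\<forall>i<m. \<forall>j<m. e i \<bullet> e j = (if i = j then 1 else 0)"
    and eH: "\<forall>i<m. \<forall>j<m. e i \<bullet> (hessian \<phi> 0 *v e j) = (if i = j then \<kappa> i else 0)"
    using pc unfolding principal_curvatures_def m_def by auto
  obtain r0 where \<nu>: "norm \<nu> = 1" and r0: "r0 > 0" and \<phi>: "C2_on (ball 0 r0) \<phi>"
    and graph: "\<forall>z\<in>ball 0 r0. y + z \<in> \<Omega> \<longleftrightarrow> z \<bullet> \<nu> > \<phi> (z - (z \<bullet> \<nu>) *\<^sub>R \<nu>)"
    using lg unfolding local_graph_def by auto
  have \<nu>\<nu>: "\<nu> \<bullet> \<nu> = 1" using \<nu> by (simp add: norm_eq_1)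
  define S1 S2 where "S1 = esym {..<m} (k - 1) \<kappa>" and "S2 = esym {..<m} k \<kappa>"
  have S1: "S1 > 0" using \<kappa> k by (auto simp: S1_def)
  \<comment> \<open>\<sigma>_k(\<kappa>) may have any sign; this s makes \<sigma>_k of the family
    extended by s, namely S2 + s S1, at least S1 > 0. The lower ones are positive for any s >
    0.\<close>
  define s where "s = 1 + \<bar>S2\<bar> / S1"
  have s: "s > 0" using S1 by (simp add: s_def add_pos_nonneg)
  define L where "L i = (if i < m then \<kappa> i else s)" for i
  define f where "f i = (if i < m then e i else \<nu>)" for i
  define I where "I = {..<Suc m}"
  have I: "finite I" "card I = CARD('n)" "I = insert m {..<m}" by (auto simp: I_def N)
  have on: "f i \<bullet> f j = (if i = j then 1 else 0)" if "i \<in> I" "j \<in> I" for i j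
    using that ee e\<nu> \<nu>\<nu> by (auto simp: f_def I(3) inner_commute)
  have Lpos: "esym I j L > 0" if j: "j \<in> {1..k}" for j
  proof -
    obtain i where i: "j = Suc i" using j by (cases j) auto
    have Le: "esym {..<m} i L = esym {..<m} i \<kappa>" for i
      unfolding esym_def by (intro sum.cong prod.cong refl) (auto simp: L_def)
    have "esym I (Suc i) L = esym {..<m} (Suc i) \<kappa> + s * esym {..<m} i \<kappa>"
      unfolding I(3) by (subst esym_insert_Suc) (auto simp: Le L_def)
    moreover have pos: "esym {..<m} i \<kappa> > 0"
      using \<kappa> j i by (cases "i = 0") (auto simp: esym_0)
    moreover have "esym {..<m} (Suc i) \<kappa> + s * esym {..<m} i \<kappa> > 0"
    proof (cases "j = k")
      case False
      then have "esym {..<m} (Suc i) \<kappa> > 0" using \<kappa> j i by auto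
      then show ?thesis using pos s by (simp add: add_pos_pos)
    next
      case True
      then have "S1 = esym {..<m} i \<kappa>" "S2 = esym {..<m} (Suc i) \<kappa>" using i by (auto simp: S1_def S2_def)
      moreover have "s * S1 = S1 + \<bar>S2\<bar>" using S1 by (simp add: s_def field_simps)
      ultimately show ?thesis using S1 by auto
    qed
    ultimately show ?thesis using i by simp
  qed
  \<comment> \<open>The strict inequalities survive lowering all eigenvalues by a small 2d; this is
    the room that makes the quadratic strictly negative away from y.\<close>
  have "\<forall>\<^sub>F d in at_right (0::real). \<forall>j\<in>{1..k}. esym I j (\<lambda>i. L i - 2 * d) > 0"
  proof (rule eventually_ball_finite, simp, intro ballI)
    fix j assume j: "j \<in> {1..k}"
    have "((\<lambda>d. L i - 2 * d) \<longlongrightarrow> L i) (at_right 0)" for i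
      by (rule tendsto_eq_intros refl | simp)+
    then have "((\<lambda>d. esym I j (\<lambda>i. L i - 2 * d)) \<longlongrightarrow> esym I j L) (at_right 0)"
      by (rule esym_tendsto)
    then show "\<forall>\<^sub>F d in at_right 0. esym I j (\<lambda>i. L i - 2 * d) > 0"
      using Lpos[OF j] by (rule order_tendstoD(1))
  qed
  then have "\<forall>\<^sub>F d in at_right (0::real). d > 0 \<and> (\<forall>j\<in>{1..k}. esym I j (\<lambda>i. L i - 2 * d) > 0)"
    by (intro eventually_conj eventually_at_right_less)
  then have "\<exists>d>0. \<forall>j\<in>{1..k}. esym I j (\<lambda>i. L i - 2 * d) > 0"
    by (rule eventually_happens'[rotated]) simp
  then obtain d where d: "d > 0" "\<forall>j\<in>{1..k}. esym I j (\<lambda>i. L i - 2 * d) > 0" by blast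
  define A where "A = (\<Sum>i\<in>I. (L i - 2 * d) *\<^sub>R outer (f i))"
  have Asym: "transpose A = A"
    unfolding A_def using I(1) by (induction I rule: finite_induct)
      (simp_all add: transpose_add transpose_scaleR transpose_outer, simp add: vec_eq_iff transpose_def)
  have Av: "A *v v = (\<Sum>i\<in>I. ((L i - 2 * d) * (v \<bullet> f i)) *\<^sub>R f i)" for v
    unfolding A_def using I(1)
    by (induction I rule: finite_induct) (simp_all add: matrix_vector_mult_add_rdistrib
      scaleR_matrix_vector_assoc[symmetric] outer_mult inner_commute)
  have eig: "A *v f j = (L j - 2 * d) *\<^sub>R f j" if "j \<in> I" for j
  proof -
    have "A *v f j = (\<Sum>i\<in>I. if i = j then (L j - 2 * d) *\<^sub>R f j else 0)"
      unfolding Av by (intro sum.cong) (auto simp: on that)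
    then show ?thesis using that I(1) by simp
  qed
  have SkA: "Sk j A > 0" if "j \<in> {1..k}" for j
    using Sk_eq_esym[OF I(1,2) on eig, of j] d(2) that by simp
  have expand: "z = (\<Sum>i<m. (z \<bullet> e i) *\<^sub>R e i) + (z \<bullet> \<nu>) *\<^sub>R \<nu>" for z
  proof -
    have "z = (\<Sum>i\<in>I. (z \<bullet> f i) *\<^sub>R f i)" by (rule orthonormal_family_expansion[OF I(1,2) on, symmetric])
    also have "\<dots> = (z \<bullet> \<nu>) *\<^sub>R \<nu> + (\<Sum>i<m. (z \<bullet> f i) *\<^sub>R f i)" unfolding I(3) by (simp add: f_def)
    finally show ?thesis by (simp add: f_def add.commute)
  qed
  define Q where "Q z = (\<Sum>i<m. \<kappa> i * (z \<bullet> e i)\<^sup>2)" for z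
  have zAz: "z \<bullet> (A *v z) = Q z + s * (z \<bullet> \<nu>)\<^sup>2 - 2 * d * (z \<bullet> z)" for z
  proof -
    have "z \<bullet> (A *v z) = (\<Sum>i\<in>I. (L i - 2 * d) * (z \<bullet> f i)\<^sup>2)"
      unfolding Av by (simp add: inner_sum_right power2_eq_square mult_ac)
    also have "\<dots> = (\<Sum>i\<in>I. L i * (z \<bullet> f i)\<^sup>2) - 2 * d * (\<Sum>i\<in>I. (z \<bullet> f i)\<^sup>2)"
      by (simp add: left_diff_distrib sum_subtractf sum_distrib_left mult_ac)
    also have "(\<Sum>i\<in>I. (z \<bullet> f i)\<^sup>2) = z \<bullet> (\<Sum>i\<in>I. (z \<bullet> f i) *\<^sub>R f i)"
      by (simp add: inner_sum_right power2_eq_square)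
    also have "\<dots> = z \<bullet> z" by (simp add: orthonormal_family_expansion[OF I(1,2) on])
    also have "(\<Sum>i\<in>I. L i * (z \<bullet> f i)\<^sup>2) = Q z + s * (z \<bullet> \<nu>)\<^sup>2"
      unfolding I(3) by (simp add: L_def f_def Q_def)
    finally show ?thesis .
  qed
  have Hq: "z' \<bullet> (hessian \<phi> 0 *v z') = Q z" if "z' = z - (z \<bullet> \<nu>) *\<^sub>R \<nu>" for z z'
  proof -
    have z': "z' = (\<Sum>i<m. (z \<bullet> e i) *\<^sub>R e i)" using expand[of z] that by (metis add_diff_cancel_right')
    have "hessian \<phi> 0 *v z' = (\<Sum>j<m. (z \<bullet> e j) *\<^sub>R (hessian \<phi> 0 *v e j))"
      unfolding z' linear_sum[OF matrix_vector_mul_linear] matrix_vector_mult_scaleR ..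
    then have "z' \<bullet> (hessian \<phi> 0 *v z') = (\<Sum>j<m. (z \<bullet> e j) * (\<Sum>i<m. (z \<bullet> e i) * (e i \<bullet> (hessian \<phi> 0 *v e j))))"
      unfolding z' by (simp add: inner_sum_left inner_sum_right)
    also have "\<dots> = (\<Sum>j<m. (z \<bullet> e j) * (\<Sum>i<m. if i = j then (z \<bullet> e i) * \<kappa> i else 0))"
      using eH by (intro sum.cong arg_cong2[where f = "(*)"] refl) auto
    also have "\<dots> = Q z" by (simp add: Q_def power2_eq_square mult_ac)
    finally show ?thesis .
  qed
  \<comment> \<open>As y lies outside the open set \<Omega>, the graph condition at z = 0 gives this
    sign.\<close>
  have \<phi>0: "\<phi> 0 \<ge> 0"
  proof -
    have "y \<notin> \<Omega>" using y \<Omega>(1) by (simp add: frontier_def interior_open)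
    then show ?thesis using graph[rule_format, of 0] r0 by simp
  qed
  \<comment> \<open>Spent twice, on the Taylor remainder and on the term s b^2 / 2, which leaves -d
    + 2\<epsilon> = -d/2.\<close>
  define \<epsilon> where "\<epsilon> = d / 4"
  have \<epsilon>: "\<epsilon> > 0" using d by (simp add: \<epsilon>_def)
  have "0 \<in> ball (0::real^'n) r0" using r0 by simp
  from C2_taylor_bound[OF \<phi> this \<epsilon>] obtain r1 where r1: "r1 > 0"
    and taylor: "\<forall>h\<in>ball 0 r1. \<bar>\<phi> (0 + h) - (\<phi> 0 + grad \<phi> 0 \<bullet> h + h \<bullet> (hessian \<phi> 0 *v h) / 2)\<bar> \<le> \<epsilon> * (h \<bullet> h)"
    by blast
  define K where "K = (\<Sum>i<m. \<bar>\<kappa> i\<bar>) / 2 + \<epsilon>"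
  have K: "K > 0" using \<epsilon> by (simp add: K_def add_nonneg_pos sum_nonneg)
  \<comment> \<open>The last two bounds yield s(\<tau> + b) \<le> 2 and s b^2 \<le> 2\<epsilon>|z|^2
    further down; r \<le> 1 bounds |z|^2 by |z|.\<close>
  define r where "r = min 1 (min r0 (min r1 (min (2 / (s * (1 + K))) (2 * \<epsilon> / (s * K\<^sup>2)))))"
  have r: "r > 0" "r \<le> 1" "r \<le> r0" "r \<le> r1" "s * (1 + K) * r \<le> 2" "s * K\<^sup>2 * r \<le> 2 * \<epsilon>"
  proof -
    have sK: "s * (1 + K) > 0" "s * K\<^sup>2 > 0" using s K by auto
    then show "r > 0" using r0 r1 \<epsilon> by (simp add: r_def)
    show "r \<le> 1" "r \<le> r0" "r \<le> r1" by (simp_all add: r_def)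
    have "r \<le> 2 / (s * (1 + K))" "r \<le> 2 * \<epsilon> / (s * K\<^sup>2)" by (simp_all add: r_def)
    then show "s * (1 + K) * r \<le> 2" "s * K\<^sup>2 * r \<le> 2 * \<epsilon>"
      using sK by (simp_all add: pos_le_divide_eq mult.commute)
  qed
  have main: "- \<nu> \<bullet> z + (z \<bullet> (A *v z)) / 2 \<le> - (d / 2) * (z \<bullet> z)" if z: "y + z \<in> \<Omega>" "norm z < r" for z
  proof -
    define \<tau> where "\<tau> = z \<bullet> \<nu>"
    define z' where "z' = z - \<tau> *\<^sub>R \<nu>"
    \<comment> \<open>The lower bound for the height \<tau> above the tangent plane that the graph
      and its Taylor expansion provide.\<close>
    define b where "b = Q z / 2 - \<epsilon> * (z \<bullet> z)"
    have z'\<nu>: "z' \<bullet> \<nu> = 0" by (simp add: z'_def inner_diff_left \<nu>\<nu> \<tau>_def)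
    have zz: "z \<bullet> z = z' \<bullet> z' + \<tau>\<^sup>2"
    proof -
      have "z = z' + \<tau> *\<^sub>R \<nu>" by (simp add: z'_def)
      then have "z \<bullet> z = (z' + \<tau> *\<^sub>R \<nu>) \<bullet> (z' + \<tau> *\<^sub>R \<nu>)" by simp
      also have "\<dots> = z' \<bullet> z' + \<tau>\<^sup>2"
        using z'\<nu> inner_commute[of \<nu> z'] by (simp add: inner_add_left inner_add_right \<nu>\<nu> power2_eq_square)
      finally show ?thesis .
    qed
    have n2: "z \<bullet> z = (norm z)\<^sup>2" by (simp add: power2_norm_eq_inner)
    have "norm z' \<le> norm z" using zz by (simp add: norm_le)
    then have "z' \<in> ball 0 r1" using z(2) r by simp
    then have "\<phi> z' \<ge> \<phi> 0 + grad \<phi> 0 \<bullet> z' + z' \<bullet> (hessian \<phi> 0 *v z') / 2 - \<epsilon> * (z' \<bullet> z')"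
      using taylor by fastforce
    also have "grad \<phi> 0 \<bullet> z' = 0" using gr z'\<nu> by blast
    also have "z' \<bullet> (hessian \<phi> 0 *v z') = Q z" using Hq[of z' z] by (simp add: z'_def \<tau>_def)
    finally have "\<phi> z' \<ge> Q z / 2 - \<epsilon> * (z' \<bullet> z')" using \<phi>0 by simp
    moreover have "\<epsilon> * (z' \<bullet> z') \<le> \<epsilon> * (z \<bullet> z)" using zz \<epsilon> by simp
    moreover have "\<tau> > \<phi> z'" using graph z r by (auto simp: \<tau>_def z'_def)
    ultimately have \<tau>b: "\<tau> > b" by (simp add: b_def)
    have \<tau>r: "\<bar>\<tau>\<bar> \<le> norm z" using Cauchy_Schwarz_ineq2[of z \<nu>] \<nu> by (simp add: \<tau>_def)
    have "\<bar>Q z\<bar> \<le> (\<Sum>i<m. \<bar>\<kappa> i\<bar> * (z \<bullet> z))"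
    proof -
      have "\<bar>Q z\<bar> \<le> (\<Sum>i<m. \<bar>\<kappa> i * (z \<bullet> e i)\<^sup>2\<bar>)" unfolding Q_def by (rule sum_abs)
      also have "\<dots> \<le> (\<Sum>i<m. \<bar>\<kappa> i\<bar> * (z \<bullet> z))"
      proof (rule sum_mono)
        fix i assume "i \<in> {..<m}"
        then have "e i \<bullet> e i = 1" using ee by auto
        then have "(z \<bullet> e i)\<^sup>2 \<le> z \<bullet> z" using Cauchy_Schwarz_ineq[of z "e i"] by simp
        then show "\<bar>\<kappa> i * (z \<bullet> e i)\<^sup>2\<bar> \<le> \<bar>\<kappa> i\<bar> * (z \<bullet> z)" by (simp add: abs_mult mult_left_mono)
      qed
      finally show ?thesis .
    qed
    then have "\<bar>Q z\<bar> \<le> (\<Sum>i<m. \<bar>\<kappa> i\<bar>) * (norm z)\<^sup>2" by (simp add: sum_distrib_right n2)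
    moreover have "K * (norm z)\<^sup>2 = (\<Sum>i<m. \<bar>\<kappa> i\<bar>) * (norm z)\<^sup>2 / 2 + \<epsilon> * (norm z)\<^sup>2"
      by (simp add: K_def distrib_right)
    moreover have "\<epsilon> * (norm z)\<^sup>2 \<ge> 0" using \<epsilon> by simp
    ultimately have bK: "\<bar>b\<bar> \<le> K * (norm z)\<^sup>2"
      unfolding b_def n2 by linarith
    have nz: "norm z \<le> 1" "(norm z)\<^sup>2 \<le> norm z"
      using z(2) r(2) by (auto simp: power2_eq_square mult_left_le)
    have "s * (\<tau> + b) \<le> 2"
    proof -
      have "\<tau> + b \<le> norm z + K * (norm z)\<^sup>2" using \<tau>r bK by linarith
      also have "\<dots> \<le> norm z + K * norm z" using nz K by simp
      also have "\<dots> \<le> (1 + K) * r" using z(2) K by (simp add: distrib_right add_mono)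
      finally have "s * (\<tau> + b) \<le> s * ((1 + K) * r)" using s by simp
      then show ?thesis using r(5) by (simp add: mult.assoc)
    qed
    \<comment> \<open>This factorisation says that -t + s t^2 / 2 is no larger at \<tau> than at b,
      so the large eigenvalue s costs only s b^2 / 2, which is of fourth order in |z|.\<close>
    then have "(\<tau> - b) * (s * (\<tau> + b) - 2) \<le> 0" using \<tau>b by (intro mult_nonneg_nonpos) auto
    then have 1: "- \<tau> + s / 2 * \<tau>\<^sup>2 \<le> - b + s / 2 * b\<^sup>2"
      by (simp add: power2_eq_square algebra_simps)
    have "b\<^sup>2 \<le> (K * (norm z)\<^sup>2)\<^sup>2" using bK by (metis abs_ge_zero power2_abs power_mono)
    also have "\<dots> = K\<^sup>2 * ((norm z)\<^sup>2 * (norm z)\<^sup>2)" by (simp add: power_mult_distrib power2_eq_square)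
    also have "\<dots> \<le> K\<^sup>2 * (r * (norm z)\<^sup>2)"
      using nz z(2) by (intro mult_left_mono mult_right_mono) auto
    finally have "s * b\<^sup>2 \<le> s * (K\<^sup>2 * (r * (norm z)\<^sup>2))" using s by simp
    also have "\<dots> = (s * K\<^sup>2 * r) * (norm z)\<^sup>2" by (simp add: mult_ac)
    also have "\<dots> \<le> 2 * \<epsilon> * (norm z)\<^sup>2" using r(6) by (intro mult_right_mono) auto
    finally have 2: "s / 2 * b\<^sup>2 \<le> \<epsilon> * (z \<bullet> z)" by (simp add: n2)
    have "- \<nu> \<bullet> z + (z \<bullet> (A *v z)) / 2 = - \<tau> + s / 2 * \<tau>\<^sup>2 + b + \<epsilon> * (z \<bullet> z) - d * (z \<bullet> z)"
      unfolding zAz by (simp add: \<tau>_def b_def inner_commute[of z \<nu>])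
    also have "\<dots> \<le> 2 * \<epsilon> * (z \<bullet> z) - d * (z \<bullet> z)" using 1 2 by simp
    also have "\<dots> = - (d / 2) * (z \<bullet> z)" by (simp add: \<epsilon>_def)
    finally show ?thesis .
  qed
  have "- \<nu> \<bullet> (x - y) + ((x - y) \<bullet> (A *v (x - y))) / 2 \<le> - (d / 2) * ((x - y) \<bullet> (x - y))"
    if "x \<in> \<Omega> \<inter> ball y r" for x
    using main[of "x - y"] that by (auto simp: dist_norm norm_minus_commute)
  then show ?thesis
    using d(1) r(1) Asym SkA by (intro exI[of _ \<nu>] exI[of _ A] exI[of _ "d / 2"] exI[of _ r]) auto
qed

section \<open>Stability under uniform limits\<close>

text \<open>Adding e|y - x0|^2 makes the maximum at x0 strict: if g is within d of f, a maximiser x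
  satisfies e|x - x0|^2 < 2d and so lies close to x0. As d is fixed before g, it serves all
  functions near f at once.\<close>

lemma touching_point_limit:
  fixes f :: "real^'n \<Rightarrow> real"
  assumes \<rho>: "\<rho> > 0" and cont: "continuous_on (cball x0 \<rho>) f" "continuous_on (cball x0 \<rho>) \<phi>"
    and fmax: "\<And>y. y \<in> cball x0 \<rho> \<Longrightarrow> f y - \<phi> y \<le> f x0 - \<phi> x0" and e: "e > 0" and \<eta>: "\<eta> > 0"
  shows "\<exists>d>0. \<forall>g. continuous_on (cball x0 \<rho>) g \<longrightarrow> (\<forall>y\<in>cball x0 \<rho>. \<bar>g y - f y\<bar> < d) \<longrightarrow>
    (\<exists>x\<in>ball x0 \<rho>. dist x0 x < \<eta> \<and> \<bar>g x - f x0\<bar> < \<eta> \<and>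
      (\<forall>y\<in>cball x0 \<rho>. g y - (\<phi> y + e * ((y - x0) \<bullet> (y - x0))) \<le> g x - (\<phi> x + e * ((x - x0) \<bullet> (x - x0)))))"
proof -
  have "isCont f x0"
    using cont(1) by (rule continuous_on_interior) (use \<rho> in simp)
  then have "(f \<longlongrightarrow> f x0) (nhds x0)" by (simp add: isCont_def tendsto_at_iff_tendsto_nhds)
  then have "\<forall>\<^sub>F x in nhds x0. dist (f x) (f x0) < \<eta> / 2"
    using \<eta> by (intro tendstoD) auto
  then obtain t0 where t0: "t0 > 0" "\<forall>x. dist x x0 < t0 \<longrightarrow> dist (f x) (f x0) < \<eta> / 2"
    unfolding eventually_nhds_metric by blast
  define t where "t = min t0 (min \<rho> \<eta>)"
  have t: "t > 0" "t \<le> t0" "t \<le> \<rho>" "t \<le> \<eta>" using t0 \<rho> \<eta> by (auto simp: t_def)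
  define d where "d = min (\<eta> / 2) (e * t\<^sup>2 / 2)"
  have d: "d > 0" "d \<le> \<eta> / 2" "2 * d \<le> e * t\<^sup>2" using \<eta> e t by (auto simp: d_def)
  show ?thesis
  proof (intro exI[of _ d] conjI allI impI d)
    fix g assume g: "continuous_on (cball x0 \<rho>) g" and close: "\<forall>y\<in>cball x0 \<rho>. \<bar>g y - f y\<bar> < d"
    let ?q = "\<lambda>y. \<phi> y + e * ((y - x0) \<bullet> (y - x0))"
    have "continuous_on (cball x0 \<rho>) (\<lambda>y. g y - ?q y)"
      by (intro continuous_intros g cont)
    moreover have "cball x0 \<rho> \<noteq> {}" using \<rho> by auto
    ultimately have "\<exists>x\<in>cball x0 \<rho>. \<forall>y\<in>cball x0 \<rho>. g y - ?q y \<le> g x - ?q x"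
      using continuous_attains_sup[OF compact_cball] by blast
    then obtain x where x: "x \<in> cball x0 \<rho>" and max: "\<forall>y\<in>cball x0 \<rho>. g y - ?q y \<le> g x - ?q x" by blast
    have x00: "x0 \<in> cball x0 \<rho>" using \<rho> by simp
    have "g x0 - \<phi> x0 \<le> g x - \<phi> x - e * ((x - x0) \<bullet> (x - x0))" using max x00 by fastforce
    moreover have "f x - \<phi> x \<le> f x0 - \<phi> x0" by (rule fmax[OF x])
    moreover have "\<bar>g x - f x\<bar> < d" "\<bar>g x0 - f x0\<bar> < d" using close x x00 by auto
    ultimately have "e * ((x - x0) \<bullet> (x - x0)) < 2 * d" by linarith
    then have "e * ((x - x0) \<bullet> (x - x0)) < e * t\<^sup>2" using d by linarith
    then have "(x - x0) \<bullet> (x - x0) < t\<^sup>2" using e by simp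
    then have "(dist x0 x)\<^sup>2 < t\<^sup>2"
      unfolding dist_norm norm_minus_commute[of x0 x] by (simp add: power2_norm_eq_inner)
    then have dx: "dist x0 x < t" by (rule power2_less_imp_less) (use t(1) in simp)
    then have "\<bar>f x - f x0\<bar> < \<eta> / 2"
      using t0(2)[rule_format, of x] t by (simp add: dist_commute[of x x0] dist_real_def)
    then have "\<bar>g x - f x0\<bar> < \<eta>" using \<open>\<bar>g x - f x\<bar> < d\<close> d by linarith
    then show "\<exists>x\<in>ball x0 \<rho>. dist x0 x < \<eta> \<and> \<bar>g x - f x0\<bar> < \<eta> \<and> (\<forall>y\<in>cball x0 \<rho>. g y - ?q y \<le> g x - ?q x)"
      using dx t max by (intro bexI[of _ x]) auto
  qed
qed

text \<open>The tolerances 1/(m+1) tend to 0, but the strengths \<open>e m\<close> of the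
  perturbation are free: they tend to 0 for subsolutions, where the added Hessian must disappear,
  and stay constant for supersolutions, where a quadratic absorbs it.\<close>

lemma touching_point_sequence:
  fixes f :: "real^'n \<Rightarrow> real" and u :: "nat \<Rightarrow> real^'n \<Rightarrow> real"
  assumes \<rho>: "\<rho> > 0" and cont: "continuous_on (cball x0 \<rho>) f" "continuous_on (cball x0 \<rho>) \<phi>"
    and fmax: "\<And>y. y \<in> cball x0 \<rho> \<Longrightarrow> f y - \<phi> y \<le> f x0 - \<phi> x0" and e: "\<And>m. e m > 0"
    and u: "\<And>n. continuous_on (cball x0 \<rho>) (u n)" and lim: "uniform_limit (cball x0 \<rho>) u f sequentially"
  shows "\<exists>n X. filterlim n at_top sequentially \<and> X \<longlonglongrightarrow> x0 \<and> (\<lambda>m. u (n m) (X m)) \<longlonglongrightarrow> f x0 \<and>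
    (\<forall>m. X m \<in> ball x0 \<rho>) \<and>
    (\<forall>m. \<forall>y\<in>cball x0 \<rho>. u (n m) y - (\<phi> y + e m * ((y - x0) \<bullet> (y - x0))) \<le>
       u (n m) (X m) - (\<phi> (X m) + e m * ((X m - x0) \<bullet> (X m - x0))))"
proof -
  define \<eta> where "\<eta> m = 1 / real (Suc m)" for m
  have \<eta>: "\<eta> m > 0" for m by (simp add: \<eta>_def)
  have \<eta>0: "\<eta> \<longlonglongrightarrow> 0" unfolding \<eta>_def using LIMSEQ_inverse_real_of_nat by (simp add: inverse_eq_divide)
  have ex: "\<forall>m. \<exists>p. fst p \<ge> m \<and> snd p \<in> ball x0 \<rho> \<and> dist x0 (snd p) < \<eta> m \<and> \<bar>u (fst p) (snd p) - f x0\<bar> < \<eta> m \<and>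
      (\<forall>y\<in>cball x0 \<rho>. u (fst p) y - (\<phi> y + e m * ((y - x0) \<bullet> (y - x0))) \<le>
        u (fst p) (snd p) - (\<phi> (snd p) + e m * ((snd p - x0) \<bullet> (snd p - x0))))"
  proof
    fix m
    obtain d where d: "d > 0" and touch: "\<forall>g. continuous_on (cball x0 \<rho>) g \<longrightarrow> (\<forall>y\<in>cball x0 \<rho>. \<bar>g y - f y\<bar> < d) \<longrightarrow>
      (\<exists>x\<in>ball x0 \<rho>. dist x0 x < \<eta> m \<and> \<bar>g x - f x0\<bar> < \<eta> m \<and>
      (\<forall>y\<in>cball x0 \<rho>. g y - (\<phi> y + e m * ((y - x0) \<bullet> (y - x0))) \<le> g x - (\<phi> x + e m * ((x - x0) \<bullet> (x - x0)))))"
      using touching_point_limit[OF \<rho> cont fmax e[of m] \<eta>[of m]] by blast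
    have "\<forall>\<^sub>F n in sequentially. \<forall>y\<in>cball x0 \<rho>. dist (u n y) (f y) < d"
      using lim d by (auto simp: uniform_limit_iff)
    then obtain N where N: "\<forall>n\<ge>N. \<forall>y\<in>cball x0 \<rho>. dist (u n y) (f y) < d"
      by (auto simp: eventually_sequentially)
    define n where "n = max N m"
    have close: "\<bar>u n y - f y\<bar> < d" if "y \<in> cball x0 \<rho>" for y
      using N that by (auto simp: n_def dist_real_def)
    obtain x where "x \<in> ball x0 \<rho>" "dist x0 x < \<eta> m" "\<bar>u n x - f x0\<bar> < \<eta> m"
      "\<forall>y\<in>cball x0 \<rho>. u n y - (\<phi> y + e m * ((y - x0) \<bullet> (y - x0))) \<le> u n x - (\<phi> x + e m * ((x - x0) \<bullet> (x - x0)))"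
      using touch[rule_format, OF u close] by blast
    then show "\<exists>p. fst p \<ge> m \<and> snd p \<in> ball x0 \<rho> \<and> dist x0 (snd p) < \<eta> m \<and> \<bar>u (fst p) (snd p) - f x0\<bar> < \<eta> m \<and>
      (\<forall>y\<in>cball x0 \<rho>. u (fst p) y - (\<phi> y + e m * ((y - x0) \<bullet> (y - x0))) \<le>
        u (fst p) (snd p) - (\<phi> (snd p) + e m * ((snd p - x0) \<bullet> (snd p - x0))))"
      by (intro exI[of _ "(n, x)"]) (simp add: n_def)
  qed
  obtain p where p: "\<forall>m. fst (p m) \<ge> m \<and> snd (p m) \<in> ball x0 \<rho> \<and> dist x0 (snd (p m)) < \<eta> m \<and>
      \<bar>u (fst (p m)) (snd (p m)) - f x0\<bar> < \<eta> m \<and>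
      (\<forall>y\<in>cball x0 \<rho>. u (fst (p m)) y - (\<phi> y + e m * ((y - x0) \<bullet> (y - x0))) \<le>
        u (fst (p m)) (snd (p m)) - (\<phi> (snd (p m)) + e m * ((snd (p m) - x0) \<bullet> (snd (p m) - x0))))"
    using choice[OF ex] by blast
  define n X where "n m = fst (p m)" and "X m = snd (p m)" for m
  have nlim: "filterlim n at_top sequentially"
    using p by (intro filterlim_at_top_mono[OF filterlim_ident]) (auto simp: n_def)
  have "(\<lambda>m. dist (X m) x0) \<longlonglongrightarrow> 0"
  proof (rule tendsto_sandwich[OF _ _ tendsto_const \<eta>0])
    show "\<forall>\<^sub>F m in sequentially. dist (X m) x0 \<le> \<eta> m"
      using p by (auto simp: X_def dist_commute less_imp_le)
  qed simp
  then have Xlim: "X \<longlonglongrightarrow> x0" by (simp add: tendsto_dist_iff[symmetric])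
  have "(\<lambda>m. dist (u (n m) (X m)) (f x0)) \<longlonglongrightarrow> 0"
  proof (rule tendsto_sandwich[OF _ _ tendsto_const \<eta>0])
    show "\<forall>\<^sub>F m in sequentially. dist (u (n m) (X m)) (f x0) \<le> \<eta> m"
      using p by (auto simp: X_def n_def dist_real_def less_imp_le)
  qed simp
  then have ulim: "(\<lambda>m. u (n m) (X m)) \<longlonglongrightarrow> f x0" by (simp add: tendsto_dist_iff[symmetric])
  show ?thesis
    using nlim Xlim ulim p by (intro exI[of _ n] exI[of _ X]) (simp add: n_def X_def)
qed

lemma touches_above_cball:
  fixes u :: "real^'n \<Rightarrow> real"
  assumes "open \<Omega>" "x0 \<in> \<Omega>" "touches_above \<Omega> (\<lambda>x. ereal (u x)) x0 \<phi>"
  shows "\<exists>\<rho>>0. \<exists>U. cball x0 \<rho> \<subseteq> \<Omega> \<and> cball x0 \<rho> \<subseteq> U \<and> C2_on U \<phi> \<and>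
    (\<forall>y\<in>cball x0 \<rho>. u y - \<phi> y \<le> u x0 - \<phi> x0)"
proof -
  obtain U where U: "x0 \<in> U" "C2_on U \<phi>" using assms(3) by (auto simp: touches_above_def C2_near_def)
  obtain V where V: "open V" "x0 \<in> V" "\<forall>y\<in>V. y \<noteq> x0 \<longrightarrow> y \<in> \<Omega> \<longrightarrow> u y - \<phi> y \<le> u x0 - \<phi> x0"
    using assms(3) by (auto simp: touches_above_def eventually_at_topological)
  have "open (\<Omega> \<inter> U \<inter> V)" using assms(1) U V by (auto simp: C2_on_def)
  moreover have "x0 \<in> \<Omega> \<inter> U \<inter> V" using assms U V by auto
  ultimately obtain \<rho> where "\<rho> > 0" "cball x0 \<rho> \<subseteq> \<Omega> \<inter> U \<inter> V"
    using open_contains_cball by metis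
  then show ?thesis using U V(3) by (intro exI[of _ \<rho>] conjI exI[of _ U]) auto
qed

lemma touches_below_cball:
  fixes u :: "real^'n \<Rightarrow> real"
  assumes "open \<Omega>" "x0 \<in> \<Omega>" "touches_below \<Omega> (\<lambda>x. ereal (u x)) x0 \<phi>"
  shows "\<exists>\<rho>>0. \<exists>U. cball x0 \<rho> \<subseteq> \<Omega> \<and> cball x0 \<rho> \<subseteq> U \<and> C2_on U \<phi> \<and>
    (\<forall>y\<in>cball x0 \<rho>. u y - \<phi> y \<ge> u x0 - \<phi> x0)"
proof -
  obtain U where U: "x0 \<in> U" "C2_on U \<phi>" using assms(3) by (auto simp: touches_below_def C2_near_def)
  obtain V where V: "open V" "x0 \<in> V" "\<forall>y\<in>V. y \<noteq> x0 \<longrightarrow> y \<in> \<Omega> \<longrightarrow> u y - \<phi> y \<ge> u x0 - \<phi> x0"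
    using assms(3) by (auto simp: touches_below_def eventually_at_topological)
  have "open (\<Omega> \<inter> U \<inter> V)" using assms(1) U V by (auto simp: C2_on_def)
  moreover have "x0 \<in> \<Omega> \<inter> U \<inter> V" using assms U V by auto
  ultimately obtain \<rho> where "\<rho> > 0" "cball x0 \<rho> \<subseteq> \<Omega> \<inter> U \<inter> V"
    using open_contains_cball by metis
  then show ?thesis using U V(3) by (intro exI[of _ \<rho>] conjI exI[of _ U]) auto
qed

text \<open>Test functions for the limit touch from above at \<open>x\<^sub>0\<close>; after adding \<open>|x - x\<^sub>0|\<^sup>2/m\<close> they touch
  \<open>u\<^sub>n\<close>, for some large \<open>n\<close>, at a point close to \<open>x\<^sub>0\<close>.\<close>

lemma subsolution_limit:
  fixes u :: "nat \<Rightarrow> real^'n \<Rightarrow> real"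
  assumes k: "1 \<le> k" "k \<le> CARD('n)" and \<Omega>: "open \<Omega>"
    and u: "\<And>n. admissible_solution k \<Omega> (\<lambda>x s. a n - \<mu> n * s * \<bar>s\<bar> ^ (k - 1)) (u n)"
    and lim: "uniform_limit (closure \<Omega>) u \<psi> sequentially" and cont: "continuous_on (closure \<Omega>) \<psi>"
    and a: "a \<longlonglongrightarrow> a0" and \<mu>: "\<mu> \<longlonglongrightarrow> \<mu>0"
    and x0: "x0 \<in> \<Omega>" and t: "touches_above \<Omega> (\<lambda>x. ereal (\<psi> x)) x0 \<phi>"
  shows "Sk k (hessian \<phi> x0) \<ge> a0 - \<mu>0 * \<psi> x0 * \<bar>\<psi> x0\<bar> ^ (k - 1) \<and> hessian \<phi> x0 \<in> Sigma_cone k"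
proof -
  obtain \<rho> U where \<rho>: "\<rho> > 0" "cball x0 \<rho> \<subseteq> \<Omega>" "cball x0 \<rho> \<subseteq> U" and \<phi>: "C2_on U \<phi>"
      and max: "\<forall>y\<in>cball x0 \<rho>. \<psi> y - \<phi> y \<le> \<psi> x0 - \<phi> x0"
    using touches_above_cball[OF \<Omega> x0 t] by blast
  have sub: "cball x0 \<rho> \<subseteq> closure \<Omega>" using \<rho>(2) closure_subset by blast
  have c\<phi>: "continuous_on (cball x0 \<rho>) \<phi>" using C2_on_continuous[OF \<phi>] \<rho>(3) by (rule continuous_on_subset)
  have c\<psi>: "continuous_on (cball x0 \<rho>) \<psi>" using cont sub by (rule continuous_on_subset)
  have cu: "continuous_on (cball x0 \<rho>) (u n)" for n
    using u[of n] sub by (auto simp: admissible_solution_def intro: continuous_on_subset)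
  define \<eta> where "\<eta> m = 1 / real (Suc m)" for m
  have \<eta>: "\<eta> m > 0" for m by (simp add: \<eta>_def)
  have \<eta>0: "\<eta> \<longlonglongrightarrow> 0" unfolding \<eta>_def using LIMSEQ_inverse_real_of_nat by (simp add: inverse_eq_divide)
  obtain n X where nlim: "filterlim n at_top sequentially" and Xlim: "X \<longlonglongrightarrow> x0"
    and ulim: "(\<lambda>m. u (n m) (X m)) \<longlonglongrightarrow> \<psi> x0" and Xb: "\<forall>m. X m \<in> ball x0 \<rho>"
    and Xmax: "\<forall>m. \<forall>y\<in>cball x0 \<rho>. u (n m) y - (\<phi> y + \<eta> m * ((y - x0) \<bullet> (y - x0))) \<le>
       u (n m) (X m) - (\<phi> (X m) + \<eta> m * ((X m - x0) \<bullet> (X m - x0)))"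
    using touching_point_sequence[where e = \<eta>, OF \<rho>(1) c\<psi> c\<phi> bspec[OF max] \<eta> cu
        uniform_limit_on_subset[OF lim sub]]
    by blast
  define B where "B m = hessian \<phi> (X m) + (2 * \<eta> m) *\<^sub>R mat 1" for m
  have BX: "Sk k (B m) \<ge> a (n m) - \<mu> (n m) * u (n m) (X m) * \<bar>u (n m) (X m)\<bar> ^ (k - 1) \<and> B m \<in> Sigma_cone k" for m
  proof -
    let ?\<phi> = "\<lambda>y. \<phi> y + (0 + \<eta> m * ((y - x0) \<bullet> (y - x0)))"
    have \<phi>b: "C2_on (ball x0 \<rho>) \<phi>" using \<rho>(3) by (intro C2_on_subset[OF \<phi>]) auto
    have sb: "C2_on (ball x0 \<rho>) (\<lambda>y. 0 + \<eta> m * ((y - x0) \<bullet> (y - x0)))"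
      by (rule C2_on_subset[OF C2_on_sq_dist(1)]) auto
    have X: "X m \<in> ball x0 \<rho>" using Xb by blast
    have "touches_above \<Omega> (\<lambda>x. ereal (u (n m) x)) (X m) ?\<phi>"
      by (rule touches_aboveI[OF C2_on_add(1)[OF \<phi>b sb] X]) (use Xmax in auto)
    moreover have "hessian ?\<phi> (X m) = B m"
      unfolding C2_on_add(2)[OF \<phi>b sb X] C2_on_sq_dist(2) B_def ..
    moreover have "X m \<in> \<Omega>" using X \<rho>(2) by auto
    ultimately show ?thesis
      using u[of "n m"] unfolding admissible_solution_def by metis
  qed
  have "x0 \<in> U" using \<rho>(1,3) by (meson centre_in_cball less_imp_le subsetD)
  then have "isCont (hessian \<phi>) x0"
    using \<phi> by (auto simp: C2_on_def continuous_on_eq_continuous_at)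
  then have "(\<lambda>m. hessian \<phi> (X m)) \<longlonglongrightarrow> hessian \<phi> x0" using Xlim by (rule isCont_tendsto_compose)
  then have "B \<longlonglongrightarrow> hessian \<phi> x0 + (2 * 0) *\<^sub>R mat 1"
    unfolding B_def by (intro tendsto_intros \<eta>0)
  then have Blim: "B \<longlonglongrightarrow> hessian \<phi> x0" by simp
  \<comment> \<open>Symmetry of the limit Hessian is part of this membership; it is inherited from
    the matrices \<open>B m\<close>.\<close>
  have H: "hessian \<phi> x0 \<in> Sigma_cone k"
    by (rule Sigma_cone_closed[OF k(2) Blim]) (use BX in auto)
  have sym: "transpose (B m) = B m" "transpose (hessian \<phi> x0) = hessian \<phi> x0" for m
    using BX[of m] H by (auto simp: Sigma_cone_iff[OF k(2)])
  have lim1: "(\<lambda>m. Sk k (B m)) \<longlonglongrightarrow> Sk k (hessian \<phi> x0)" by (rule Sk_tendsto[OF Blim sym])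
  have lim2: "(\<lambda>m. a (n m) - \<mu> (n m) * u (n m) (X m) * \<bar>u (n m) (X m)\<bar> ^ (k - 1)) \<longlonglongrightarrow>
      a0 - \<mu>0 * \<psi> x0 * \<bar>\<psi> x0\<bar> ^ (k - 1)"
    by (intro tendsto_intros ulim filterlim_compose[OF a nlim] filterlim_compose[OF \<mu> nlim])
  have "Sk k (hessian \<phi> x0) \<ge> a0 - \<mu>0 * \<psi> x0 * \<bar>\<psi> x0\<bar> ^ (k - 1)"
    by (rule LIMSEQ_le[OF lim2 lim1]) (use BX in auto)
  then show ?thesis using H by simp
qed

text \<open>For touching from below the test function is first replaced by a quadratic polynomial: its
  Hessian is constant and symmetric, so no symmetry of second derivatives near \<open>x\<^sub>0\<close> is needed. The
  relevant part of the cone is relatively open by \<open>esym_pos_of_nonneg\<close>.\<close>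

lemma supersolution_limit:
  fixes u :: "nat \<Rightarrow> real^'n \<Rightarrow> real"
  assumes k: "1 \<le> k" "k \<le> CARD('n)" and \<Omega>: "open \<Omega>"
    and u: "\<And>n. admissible_solution k \<Omega> (\<lambda>x s. a n - \<mu> n * s * \<bar>s\<bar> ^ (k - 1)) (u n)"
    and lim: "uniform_limit (closure \<Omega>) u \<psi> sequentially" and cont: "continuous_on (closure \<Omega>) \<psi>"
    and a: "a \<longlonglongrightarrow> a0" and \<mu>: "\<mu> \<longlonglongrightarrow> \<mu>0"
    and x0: "x0 \<in> \<Omega>" and t: "touches_below \<Omega> (\<lambda>x. ereal (\<psi> x)) x0 \<phi>"
    and nonneg: "a0 - \<mu>0 * \<psi> x0 * \<bar>\<psi> x0\<bar> ^ (k - 1) \<ge> 0"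
  shows "Sk k (hessian \<phi> x0) \<le> a0 - \<mu>0 * \<psi> x0 * \<bar>\<psi> x0\<bar> ^ (k - 1) \<or> hessian \<phi> x0 \<notin> Sigma_cone k"
proof (rule ccontr)
  define H where "H = hessian \<phi> x0"
  define G where "G = a0 - \<mu>0 * \<psi> x0 * \<bar>\<psi> x0\<bar> ^ (k - 1)"
  assume "\<not> ?thesis"
  then have HG: "Sk k H > G" and H: "H \<in> Sigma_cone k" by (auto simp: H_def G_def)
  have sym: "transpose H = H" and Hn: "\<And>j. j \<in> {1..k} \<Longrightarrow> Sk j H \<ge> 0"
    using H by (auto simp: Sigma_cone_iff[OF k(2)])
  have G0: "G \<ge> 0" using nonneg by (simp add: G_def)
  \<comment> \<open>The sign of the right-hand side enters here: S_k(H) > G \<ge> 0 keeps H off the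
    boundary of the cone, so a small negative shift stays inside.\<close>
  have Hpos: "Sk j H > 0" if "j \<in> {1..k}" for j
    unfolding Sk_def
    by (rule esym_pos_of_nonneg[of UNIV k]) (use that k Hn HG G0 in \<open>auto simp: Sk_def\<close>)
  have symE: "transpose (H + c *\<^sub>R mat 1) = H + c *\<^sub>R mat 1" for c
    by (rule symmetric_add_scaleR_mat_1[OF sym])
  have SkE: "((\<lambda>e. Sk j (H + (- 4 * e) *\<^sub>R mat 1)) \<longlongrightarrow> Sk j H) (at_right 0)" for j
    by (rule Sk_tendsto[OF _ symE sym]) (rule tendsto_eq_intros refl | simp)+
  have "\<forall>\<^sub>F e in at_right (0::real). \<forall>j\<in>{1..k}. Sk j (H + (- 4 * e) *\<^sub>R mat 1) > 0"
    by (intro eventually_ball_finite ballI order_tendstoD(1)[OF SkE] Hpos) auto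
  moreover have "\<forall>\<^sub>F e in at_right (0::real). Sk k (H + (- 4 * e) *\<^sub>R mat 1) > (Sk k H + G) / 2"
    using HG by (intro order_tendstoD(1)[OF SkE]) auto
  ultimately have "\<forall>\<^sub>F e in at_right (0::real). e > 0 \<and> (\<forall>j\<in>{1..k}. Sk j (H + (- 4 * e) *\<^sub>R mat 1) > 0) \<and>
      Sk k (H + (- 4 * e) *\<^sub>R mat 1) > (Sk k H + G) / 2"
    by (intro eventually_conj eventually_at_right_less)
  then have "\<exists>e>0. (\<forall>j\<in>{1..k}. Sk j (H + (- 4 * e) *\<^sub>R mat 1) > 0) \<and>
      Sk k (H + (- 4 * e) *\<^sub>R mat 1) > (Sk k H + G) / 2"
    by (rule eventually_happens'[rotated]) simp
  then obtain e where e: "e > 0" and pos: "\<forall>j\<in>{1..k}. Sk j (H + (- 4 * e) *\<^sub>R mat 1) > 0"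
      and big: "Sk k (H + (- 4 * e) *\<^sub>R mat 1) > (Sk k H + G) / 2" by blast
  \<comment> \<open>The shift by 4e lowers the quadratic by 2e|h|^2: one half pays for the Taylor
    remainder, the other keeps the touching strict.\<close>
  define A where "A = H + (- 4 * e) *\<^sub>R mat 1"
  have A: "A \<in> Sigma_cone k" "transpose A = A"
    using pos symE[of "- 4 * e"] unfolding A_def Sigma_cone_iff[OF k(2)] by (blast intro: less_imp_le)+
  obtain \<rho>0 U where \<rho>0: "\<rho>0 > 0" "cball x0 \<rho>0 \<subseteq> \<Omega>" "cball x0 \<rho>0 \<subseteq> U" and \<phi>: "C2_on U \<phi>"
      and min: "\<forall>y\<in>cball x0 \<rho>0. \<psi> y - \<phi> y \<ge> \<psi> x0 - \<phi> x0"
    using touches_below_cball[OF \<Omega> x0 t] by blast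
  have "x0 \<in> U" using \<rho>0 by auto
  from C2_taylor_bound[OF \<phi> this e] obtain d0 where d0: "d0 > 0"
    and taylor: "\<forall>h\<in>ball 0 d0. \<bar>\<phi> (x0 + h) - (\<phi> x0 + grad \<phi> x0 \<bullet> h + h \<bullet> (hessian \<phi> x0 *v h) / 2)\<bar> \<le> e * (h \<bullet> h)"
    by blast
  define \<rho> where "\<rho> = min \<rho>0 (d0 / 2)"
  have \<rho>: "\<rho> > 0" "\<rho> \<le> \<rho>0" "\<rho> < d0" using \<rho>0 d0 by (auto simp: \<rho>_def)
  have sub\<Omega>: "cball x0 \<rho> \<subseteq> \<Omega>" using \<rho> \<rho>0 by auto
  then have sub: "cball x0 \<rho> \<subseteq> closure \<Omega>" using closure_subset by blast
  define q where "q = (\<lambda>x. \<phi> x0 + grad \<phi> x0 \<bullet> (x - x0) + ((x - x0) \<bullet> (A *v (x - x0))) / 2)"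
  have Ah: "A *v h = H *v h - (4 * e) *\<^sub>R h" for h
    unfolding A_def matrix_vector_mult_add_rdistrib scaleR_matrix_vector_assoc[symmetric] by simp
  have q: "q y + e * ((y - x0) \<bullet> (y - x0)) = \<phi> x0 + grad \<phi> x0 \<bullet> (y - x0) + ((y - x0) \<bullet> (H *v (y - x0))) / 2 - e * ((y - x0) \<bullet> (y - x0))" for y
    by (simp add: q_def Ah inner_diff_right diff_divide_distrib)
  have qmin: "\<psi> y - (q y + e * ((y - x0) \<bullet> (y - x0))) \<ge> \<psi> x0 - (q x0 + e * ((x0 - x0) \<bullet> (x0 - x0)))" if y: "y \<in> cball x0 \<rho>" for y
  proof -
    have "\<phi> y \<ge> q y + e * ((y - x0) \<bullet> (y - x0))"
      unfolding q using taylor[rule_format, of "y - x0"] y \<rho> by (auto simp: H_def dist_norm norm_minus_commute)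
    moreover have "\<psi> y - \<phi> y \<ge> \<psi> x0 - \<phi> x0" using min y \<rho> by auto
    ultimately show ?thesis by (simp add: q_def)
  qed
  have qC2: "C2_on UNIV q" "hessian q x = A" for x
    unfolding q_def by (rule C2_on_quadratic[OF A(2)])+
  \<comment> \<open>With signs reversed, this test function already contains e|y - x0|^2, and the
    perturbation in \<open>touching_point_sequence\<close> cancels it; what touches u_n from below
    is q, with constant Hessian A.\<close>
  have cq: "continuous_on (cball x0 \<rho>) (\<lambda>y. - (q y + e * ((y - x0) \<bullet> (y - x0))))"
    using C2_on_continuous[OF qC2(1)] by (intro continuous_intros) (auto intro: continuous_on_subset)
  have c\<psi>: "continuous_on (cball x0 \<rho>) (\<lambda>x. - \<psi> x)"
    using cont sub by (intro continuous_intros) (rule continuous_on_subset)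
  have cu: "continuous_on (cball x0 \<rho>) (\<lambda>x. - u n x)" for n
    using u[of n] sub by (auto simp: admissible_solution_def intro!: continuous_intros intro: continuous_on_subset)
  have "uniform_limit (cball x0 \<rho>) (\<lambda>n x. - u n x) (\<lambda>x. - \<psi> x) sequentially"
    by (intro uniform_limit_intros uniform_limit_on_subset[OF lim sub])
  note seq = touching_point_sequence[OF \<rho>(1) c\<psi> cq _ e cu this]
  have "\<exists>n X. filterlim n at_top sequentially \<and> X \<longlonglongrightarrow> x0 \<and> (\<lambda>m. - u (n m) (X m)) \<longlonglongrightarrow> - \<psi> x0 \<and>
    (\<forall>m. X m \<in> ball x0 \<rho>) \<and>
    (\<forall>m. \<forall>y\<in>cball x0 \<rho>. - u (n m) y - (- (q y + e * ((y - x0) \<bullet> (y - x0))) + e * ((y - x0) \<bullet> (y - x0))) \<le>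
       - u (n m) (X m) - (- (q (X m) + e * ((X m - x0) \<bullet> (X m - x0))) + e * ((X m - x0) \<bullet> (X m - x0))))"
    by (rule seq) (use qmin in fastforce)
  then obtain n X where nlim: "filterlim n at_top sequentially"
    and ulim: "(\<lambda>m. - u (n m) (X m)) \<longlonglongrightarrow> - \<psi> x0" and Xb: "\<forall>m. X m \<in> ball x0 \<rho>"
    and Xmin: "\<forall>m. \<forall>y\<in>cball x0 \<rho>. - u (n m) y - (- (q y + e * ((y - x0) \<bullet> (y - x0))) + e * ((y - x0) \<bullet> (y - x0))) \<le>
       - u (n m) (X m) - (- (q (X m) + e * ((X m - x0) \<bullet> (X m - x0))) + e * ((X m - x0) \<bullet> (X m - x0)))"
    by blast
  have ulim': "(\<lambda>m. u (n m) (X m)) \<longlonglongrightarrow> \<psi> x0" using tendsto_minus[OF ulim] by simp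
  have AX: "Sk k A \<le> a (n m) - \<mu> (n m) * u (n m) (X m) * \<bar>u (n m) (X m)\<bar> ^ (k - 1)" for m
  proof -
    have X: "X m \<in> ball x0 \<rho>" using Xb by blast
    have qb: "C2_on (ball x0 \<rho>) q" by (rule C2_on_subset[OF qC2(1)]) auto
    have "q y - u (n m) y \<le> q (X m) - u (n m) (X m)" if "y \<in> ball x0 \<rho>" for y
      using Xmin[rule_format, of y m] that by simp
    then have "touches_below \<Omega> (\<lambda>x. ereal (u (n m) x)) (X m) q"
      by (intro touches_belowI[OF qb X]) fastforce
    moreover have "X m \<in> \<Omega>" using X sub\<Omega> by auto
    ultimately show ?thesis
      using u[of "n m"] A(1) qC2(2)[of "X m"] unfolding admissible_solution_def by metis
  qed
  have "(\<lambda>m. a (n m) - \<mu> (n m) * u (n m) (X m) * \<bar>u (n m) (X m)\<bar> ^ (k - 1)) \<longlonglongrightarrow> G"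
    unfolding G_def
    by (intro tendsto_intros ulim' filterlim_compose[OF a nlim] filterlim_compose[OF \<mu> nlim])
  then have "Sk k A \<le> G" by (rule LIMSEQ_le_const) (use AX in auto)
  then show False using big HG by (simp add: A_def)
qed

section \<open>Equicontinuity and the strong maximum principle\<close>

text \<open>A large multiple M of the quadratic from \<open>boundary_quadratic\<close> still
  vanishes at y and has its Hessian in the cone, while S_k grows like M^k and the values on the
  sphere drop below -1, the lower bound of normalised solutions.\<close>

lemma boundary_barrier:
  fixes \<Omega> :: "(real^'n) set"
  assumes k: "2 \<le> k" "k \<le> CARD('n)" and \<Omega>: "open \<Omega>" "strictly_m_convex (k - 1) \<Omega>"
    and y: "y \<in> frontier \<Omega>"
  shows "\<exists>h r. r > 0 \<and> C2_on UNIV h \<and> h y = 0 \<and> (\<forall>x\<in>closure \<Omega> \<inter> cball y r. h x \<le> 0) \<and>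
    (\<forall>x\<in>closure \<Omega>. dist y x = r \<longrightarrow> h x \<le> - 1) \<and>
    (\<forall>x. hessian h x \<in> Sigma_cone k \<and> Sk k (hessian h x) > C)"
proof -
  obtain \<nu> A \<delta> r where \<delta>: "\<delta> > 0" and r: "r > 0" and A: "transpose A = A"
    and Apos: "\<forall>j\<in>{1..k}. Sk j A > 0"
    and low: "\<forall>x\<in>\<Omega> \<inter> ball y r. - \<nu> \<bullet> (x - y) + ((x - y) \<bullet> (A *v (x - y))) / 2 \<le> - \<delta> * ((x - y) \<bullet> (x - y))"
    using boundary_quadratic[OF k \<Omega> y] by auto
  define q where "q = (\<lambda>x. 0 + (- \<nu>) \<bullet> (x - y) + ((x - y) \<bullet> (A *v (x - y))) / 2)"
  have q: "C2_on UNIV q" "hessian q x = A" for x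
    unfolding q_def by (rule C2_on_quadratic[OF A])+
  have Sk: "Sk k A > 0" using Apos k by auto
  \<comment> \<open>The three terms give M^k \<ge> M, the value -1 on the sphere of radius r/2, and
    S_k > C. The radius is halved because the estimate is available in the open ball of radius
    r.\<close>
  define M where "M = max 1 (max (1 / (\<delta> * (r / 2)\<^sup>2)) (\<bar>C\<bar> / Sk k A + 1))"
  have M: "M \<ge> 1" "M \<ge> 1 / (\<delta> * (r / 2)\<^sup>2)" "M \<ge> \<bar>C\<bar> / Sk k A + 1" by (simp_all add: M_def)
  have h: "C2_on UNIV (\<lambda>x. M * q x)" "hessian (\<lambda>x. M * q x) x = M *\<^sub>R A" for x
    using C2_on_scale[OF q(1), where c = M] q(2) by auto
  have bound: "q x \<le> - \<delta> * (dist y x)\<^sup>2" if x: "x \<in> closure \<Omega>" "dist y x < r" for x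
  proof -
    have "closed {x. q x \<le> - \<delta> * (dist y x)\<^sup>2}"
      using C2_on_continuous[OF q(1)] by (intro closed_Collect_le continuous_intros) auto
    moreover have "\<Omega> \<inter> ball y r \<subseteq> {x. q x \<le> - \<delta> * (dist y x)\<^sup>2}"
    proof
      fix x assume x: "x \<in> \<Omega> \<inter> ball y r"
      have "(dist y x)\<^sup>2 = (x - y) \<bullet> (x - y)"
        unfolding dist_norm norm_minus_commute[of y x] by (rule power2_norm_eq_inner)
      then show "x \<in> {x. q x \<le> - \<delta> * (dist y x)\<^sup>2}" using low x by (simp add: q_def)
    qed
    ultimately have "closure (\<Omega> \<inter> ball y r) \<subseteq> {x. q x \<le> - \<delta> * (dist y x)\<^sup>2}"
      by (rule closure_minimal[rotated])
    moreover have "x \<in> closure (ball y r \<inter> \<Omega>)"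
      using open_Int_closure_subset[OF open_ball, of y r \<Omega>] x by auto
    ultimately show ?thesis by (auto simp: Int_commute)
  qed
  show ?thesis
  proof (intro exI[of _ "\<lambda>x. M * q x"] exI[of _ "r / 2"] conjI ballI allI impI)
    show "r / 2 > 0" using r by simp
    show "C2_on UNIV (\<lambda>x. M * q x)" by (rule h)
    show "M * q y = 0" by (simp add: q_def)
  next
    fix x assume "x \<in> closure \<Omega> \<inter> cball y (r / 2)"
    then have "q x \<le> - \<delta> * (dist y x)\<^sup>2" using r by (intro bound) auto
    also have "\<dots> \<le> 0" using \<delta> by simp
    finally show "M * q x \<le> 0" using M by (simp add: mult_le_0_iff)
  next
    fix x assume x: "x \<in> closure \<Omega>" "dist y x = r / 2"
    then have "q x \<le> - \<delta> * (dist y x)\<^sup>2" using r by (intro bound) auto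
    then have "q x \<le> - (\<delta> * (r / 2)\<^sup>2)" using x by simp
    then have "M * q x \<le> M * (- (\<delta> * (r / 2)\<^sup>2))" using M(1) by (intro mult_left_mono) auto
    moreover have "\<delta> * (r / 2)\<^sup>2 > 0" using \<delta> r by simp
    then have "M * (\<delta> * (r / 2)\<^sup>2) \<ge> 1" using M(2) by (simp add: divide_le_eq)
    ultimately show "M * q x \<le> - 1" by simp
  next
    fix x
    have "A \<in> Sigma_cone k" using A Apos by (auto simp: Sigma_cone_iff[OF k(2)] less_imp_le)
    then show "hessian (\<lambda>x. M * q x) x \<in> Sigma_cone k"
      unfolding h(2) using M(1) by (subst Sigma_cone_scaleR[OF k(2)]) auto
    have "C \<le> (\<bar>C\<bar> / Sk k A) * Sk k A" using Sk by simp
    also have "\<dots> < (\<bar>C\<bar> / Sk k A + 1) * Sk k A" using Sk by (intro mult_strict_right_mono) auto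
    also have "\<dots> \<le> M * Sk k A" using M(3) Sk by (intro mult_right_mono) auto
    also have "\<dots> \<le> M ^ k * Sk k A"
      using M(1) Sk k self_le_power[of M k] by (intro mult_right_mono) auto
    finally show "Sk k (hessian (\<lambda>x. M * q x) x) > C"
      unfolding h(2) Sk_scaleR[OF A] .
  qed
qed

text \<open>A negative minimum of u - h lies neither on the boundary, where u = 0 \<ge> h, nor on
  the sphere, where u \<ge> -1 \<ge> h. Inside, h would touch u from below with Hessian in the cone
  and S_k > C \<ge> g.\<close>

lemma barrier_comparison:
  fixes u :: "real^'n \<Rightarrow> real"
  assumes \<Omega>: "open \<Omega>" and u: "admissible_solution k \<Omega> g u"
    and C: "\<And>x. x \<in> \<Omega> \<Longrightarrow> g x (u x) \<le> C" and low: "\<And>x. x \<in> closure \<Omega> \<Longrightarrow> - 1 \<le> u x"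
    and bdry: "\<And>x. x \<in> frontier \<Omega> \<Longrightarrow> u x = 0"
    and h: "C2_on UNIV h" "\<forall>x\<in>closure \<Omega> \<inter> cball y r. h x \<le> 0"
      "\<forall>x\<in>closure \<Omega>. dist y x = r \<longrightarrow> h x \<le> - 1"
      "\<forall>x. hessian h x \<in> Sigma_cone k \<and> Sk k (hessian h x) > C"
    and x: "x \<in> closure \<Omega> \<inter> cball y r"
  shows "h x \<le> u x"
proof -
  let ?K = "closure \<Omega> \<inter> cball y r"
  have "compact ?K" by (intro closed_Int_compact) auto
  moreover have "continuous_on ?K (\<lambda>x. u x - h x)"
    using u C2_on_continuous[OF h(1)]
    by (intro continuous_intros) (auto simp: admissible_solution_def intro: continuous_on_subset)
  moreover have "?K \<noteq> {}" using x by auto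
  ultimately have "\<exists>z\<in>?K. \<forall>w\<in>?K. u z - h z \<le> u w - h w"
    using continuous_attains_inf by blast
  then obtain z where z: "z \<in> ?K" and min: "\<forall>w\<in>?K. u z - h z \<le> u w - h w" by blast
  have "u z - h z \<ge> 0"
  proof (rule ccontr)
    assume neg: "\<not> u z - h z \<ge> 0"
    have "z \<notin> frontier \<Omega>" using bdry[of z] h(2) z neg by force
    then have z\<Omega>: "z \<in> \<Omega>" using z \<Omega> by (auto simp: frontier_def interior_open)
    have "dist y z \<noteq> r" using h(3) low[of z] z neg by force
    then have zb: "z \<in> ball y r" using z by auto
    have "touches_below \<Omega> (\<lambda>x. ereal (u x)) z h"
      using min closure_subset[of \<Omega>]
      by (intro touches_belowI[OF C2_on_subset[OF h(1) open_ball] zb]) auto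
    then have "Sk k (hessian h z) \<le> g z (u z) \<or> hessian h z \<notin> Sigma_cone k"
      using u z\<Omega> unfolding admissible_solution_def by blast
    then show False using h(4) C[OF z\<Omega>] by (meson not_less order.trans)
  qed
  then show ?thesis using min x by force
qed

text \<open>The barrier depends on C but not on the solution, so d is fixed before g and u; then h
  \<le> u \<le> 0 near y, and h is continuous with h(y) = 0.\<close>

lemma boundary_equicontinuity:
  fixes \<Omega> :: "(real^'n) set"
  assumes k: "2 \<le> k" "k \<le> CARD('n)" and \<Omega>: "open \<Omega>" "strictly_m_convex (k - 1) \<Omega>"
    and y: "y \<in> frontier \<Omega>" and e: "e > 0"
  shows "\<exists>d>0. \<forall>g u x. admissible_solution k \<Omega> g u \<longrightarrow> (\<forall>x\<in>\<Omega>. g x (u x) \<le> C) \<longrightarrow>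
    (\<forall>x\<in>closure \<Omega>. - 1 \<le> u x \<and> u x \<le> 0) \<longrightarrow> (\<forall>x\<in>frontier \<Omega>. u x = 0) \<longrightarrow>
    x \<in> closure \<Omega> \<longrightarrow> dist y x < d \<longrightarrow> \<bar>u x\<bar> < e"
proof -
  obtain h r where r: "r > 0" and h: "C2_on UNIV h" and hy: "h y = 0"
    and h2: "\<forall>x\<in>closure \<Omega> \<inter> cball y r. h x \<le> 0"
      "\<forall>x\<in>closure \<Omega>. dist y x = r \<longrightarrow> h x \<le> - 1"
      "\<forall>x. hessian h x \<in> Sigma_cone k \<and> Sk k (hessian h x) > C"
    using boundary_barrier[OF k \<Omega> y, of C] by blast
  have "isCont h y" using C2_on_continuous[OF h] by (simp add: continuous_on_eq_continuous_at)
  then obtain d where d: "d > 0" "\<forall>x. dist x y < d \<longrightarrow> dist (h x) (h y) < e"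
    using e unfolding continuous_at_eps_delta by blast
  show ?thesis
  proof (intro exI[of _ "min d r"] conjI allI impI)
    show "min d r > 0" using d r by simp
    fix g u x
    assume u: "admissible_solution k \<Omega> g u" "\<forall>x\<in>\<Omega>. g x (u x) \<le> C"
      "\<forall>x\<in>closure \<Omega>. - 1 \<le> u x \<and> u x \<le> 0" "\<forall>x\<in>frontier \<Omega>. u x = 0"
      and x: "x \<in> closure \<Omega>" "dist y x < min d r"
    have "h x \<le> u x"
      by (rule barrier_comparison[OF \<Omega>(1) u(1) _ _ _ h h2]) (use u x in auto)
    moreover have "\<bar>h x\<bar> < e" using d(2)[rule_format, of x] x hy by (simp add: dist_commute)
    ultimately show "\<bar>u x\<bar> < e" using u(3) x(1) by force
  qed
qed

text \<open>The power bound centred at p is one-sided: u(z) - u(p) \<le> |u(p)| (|z -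
  p|/R)^(2\<beta>). Exchanging z and p gives the other side; R is half of R0 so that both centres
  admit a ball of radius R.\<close>

lemma interior_equicontinuity:
  fixes \<Omega> :: "(real^'n) set"
  assumes k: "1 \<le> k" "k \<le> CARD('n)" and \<beta>: "\<beta> > 0" "2 * \<beta> < 2 - real CARD('n) / real k"
    and \<Omega>: "open \<Omega>" and x: "x \<in> \<Omega>" and e: "e > 0"
  shows "\<exists>d>0. \<forall>u y. k_convex k \<Omega> (\<lambda>x. ereal (u x)) \<longrightarrow> (\<forall>x\<in>\<Omega>. - 1 \<le> u x \<and> u x \<le> 0) \<longrightarrow>
    dist x y < d \<longrightarrow> \<bar>u x - u y\<bar> < e"
proof -
  obtain R0 where R0: "R0 > 0" "cball x R0 \<subseteq> \<Omega>" using \<Omega> x open_contains_cball by blast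
  define R where "R = R0 / 2"
  have R: "R > 0" using R0 by (simp add: R_def)
  have cb: "cball p R \<subseteq> \<Omega>" if "dist x p \<le> R" for p
  proof
    fix z assume "z \<in> cball p R"
    then have "dist x z \<le> R0" using that dist_triangle[of x z p] by (simp add: R_def)
    then show "z \<in> \<Omega>" using R0 by auto
  qed
  define t where "t = (e / 2) powr (1 / \<beta>)"
  have t: "t > 0" "t powr \<beta> = e / 2" using e \<beta> by (auto simp: t_def powr_powr)
  define d where "d = min R (R * sqrt t)"
  have d: "d > 0" "d \<le> R" using R t by (auto simp: d_def)
  have one: "u z - u p \<le> e / 2" if conv: "k_convex k \<Omega> (\<lambda>x. ereal (u x))"
    and ub: "\<forall>x\<in>\<Omega>. - 1 \<le> u x \<and> u x \<le> 0" and p: "dist x p \<le> R" and zp: "dist z p < d" for u z p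
  proof -
    have z: "z \<in> cball p R" using zp d by (simp add: dist_commute)
    have "p \<in> \<Omega>" "z \<in> \<Omega>" using cb[OF p] R z by auto
    show ?thesis
    proof (cases "u p = 0")
      case True
      then show ?thesis using ub \<open>z \<in> \<Omega>\<close> e by force
    next
      case False
      then have up: "u p < 0" "- 1 \<le> u p" using ub \<open>p \<in> \<Omega>\<close> by force+
      define s where "s = ((dist z p)\<^sup>2 / R\<^sup>2) powr \<beta>"
      have "ereal (u z) \<le> ereal (u p * (1 - s))"
        unfolding s_def
        by (rule k_convex_power_bound[OF conv k \<beta> R cb[OF p] _ up(1) _ z]) (use ub cb[OF p] in auto)
      then have "u z - u p \<le> - u p * s" by (simp add: right_diff_distrib)
      also have "\<dots> \<le> 1 * s" using up by (intro mult_right_mono) (auto simp: s_def)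
      also have "s \<le> t powr \<beta>"
        unfolding s_def
      proof (rule powr_mono2)
        have "dist z p \<le> R * sqrt t" using zp by (simp add: d_def)
        then have "(dist z p)\<^sup>2 \<le> (R * sqrt t)\<^sup>2" by (intro power_mono) auto
        then show "(dist z p)\<^sup>2 / R\<^sup>2 \<le> t"
          using R t by (simp add: power_mult_distrib divide_le_eq mult.commute)
      qed (use \<beta> in auto)
      finally show ?thesis using t by simp
    qed
  qed
  show ?thesis
  proof (intro exI[of _ d] conjI allI impI d)
    fix u y assume u: "k_convex k \<Omega> (\<lambda>x. ereal (u x))" "\<forall>x\<in>\<Omega>. - 1 \<le> u x \<and> u x \<le> 0" and y: "dist x y < d"
    have "u y - u x \<le> e / 2" "u x - u y \<le> e / 2"
      using one[OF u, of x y] one[OF u, of y x] y d R by (auto simp: dist_commute)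
    then show "\<bar>u x - u y\<bar> < e" using e by linarith
  qed
qed

text \<open>The power bound spreads negativity from a point through any ball around it inside
  \<Omega>. Hence u < 0 holds on an open set, and so does u = 0, since a negative point near x would
  spread to x; connectedness decides.\<close>

lemma k_convex_strong_max_principle:
  fixes u :: "real^'n \<Rightarrow> real"
  assumes k: "1 \<le> k" "k \<le> CARD('n)" and \<beta>: "\<beta> > 0" "2 * \<beta> < 2 - real CARD('n) / real k"
    and \<Omega>: "open \<Omega>" "connected \<Omega>" and conv: "k_convex k \<Omega> (\<lambda>x. ereal (u x))"
    and nonpos: "\<And>x. x \<in> \<Omega> \<Longrightarrow> u x \<le> 0" and x1: "x1 \<in> \<Omega>" "u x1 < 0" and x2: "x2 \<in> \<Omega>"
  shows "u x2 < 0"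
proof -
  have spread: "u z < 0" if p: "cball p R \<subseteq> \<Omega>" "u p < 0" "R > 0" and z: "dist p z < R" for p z R
  proof -
    have "ereal (u z) \<le> ereal (u p * (1 - ((dist z p)\<^sup>2 / R\<^sup>2) powr \<beta>))"
      by (rule k_convex_power_bound[OF conv k \<beta> p(3,1)]) (use p z nonpos in auto)
    moreover have "(dist z p)\<^sup>2 < R\<^sup>2" using z by (intro power_strict_mono) (auto simp: dist_commute)
    then have "((dist z p)\<^sup>2 / R\<^sup>2) powr \<beta> < 1 powr \<beta>"
      using p(3) \<beta> by (intro powr_less_mono2) auto
    then have "u p * (1 - ((dist z p)\<^sup>2 / R\<^sup>2) powr \<beta>) < 0"
      using p(2) by (intro mult_neg_pos) auto
    ultimately show ?thesis by simp
  qed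
  define S T where "S = {x \<in> \<Omega>. u x < 0}" and "T = {x \<in> \<Omega>. u x = 0}"
  have "open S"
    unfolding open_contains_ball
  proof
    fix p assume p: "p \<in> S"
    then have "p \<in> \<Omega>" by (simp add: S_def)
    then obtain R where R: "R > 0" "cball p R \<subseteq> \<Omega>" using \<Omega>(1) open_contains_cball by blast
    then have "ball p R \<subseteq> S" using spread[of p R] p by (auto simp: S_def)
    then show "\<exists>e>0. ball p e \<subseteq> S" using R by blast
  qed
  moreover have "open T"
    unfolding open_contains_ball
  proof
    fix x assume x: "x \<in> T"
    then have "x \<in> \<Omega>" by (simp add: T_def)
    then obtain R where R: "R > 0" "cball x R \<subseteq> \<Omega>" using \<Omega>(1) open_contains_cball by blast
    \<comment> \<open>Half the radius ensures that the ball of radius R/2 around p contains x and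
      stays in \<Omega>.\<close>
    have "p \<in> T" if "p \<in> ball x (R / 2)" for p
    proof (rule ccontr)
      assume "p \<notin> T"
      moreover have p\<Omega>: "p \<in> \<Omega>" using that R by auto
      ultimately have "u p < 0" using nonpos[of p] by (simp add: T_def)
      moreover have "cball p (R / 2) \<subseteq> \<Omega>"
      proof
        fix z assume "z \<in> cball p (R / 2)"
        then have "dist x z \<le> R" using that dist_triangle[of x z p] by simp
        then show "z \<in> \<Omega>" using R by auto
      qed
      ultimately have "u x < 0" using spread[of p "R / 2" x] R that by (auto simp: dist_commute)
      then show False using x by (simp add: T_def)
    qed
    then show "\<exists>e>0. ball x e \<subseteq> T" using R by (intro exI[of _ "R / 2"]) auto
  qed
  moreover have "\<Omega> \<subseteq> S \<union> T" using nonpos by (force simp: S_def T_def)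
  moreover have "S \<inter> T \<inter> \<Omega> = {}" by (auto simp: S_def T_def)
  ultimately have "S \<inter> \<Omega> = {} \<or> T \<inter> \<Omega> = {}" using connectedD[OF \<Omega>(2)] by blast
  then have "x2 \<notin> T" using x1 x2 by (auto simp: S_def)
  then show ?thesis using nonpos[OF x2] x2 by (auto simp: T_def)
qed

section \<open>Normalisation, compactness and the limit equation\<close>

theorem theorem6p6:
  fixes \<Omega> :: "(real^'n) set" and k :: nat
    and l :: "nat \<Rightarrow> real" and v :: "nat \<Rightarrow> real^'n \<Rightarrow> real"
  assumes "k \<in> {2..CARD('n)}" and "real k > real CARD('n) / 2"
    and "open \<Omega>" and "connected \<Omega>" and "\<Omega> \<noteq> {}" and "bounded \<Omega>"
    and "C2_boundary \<Omega>" and "strictly_m_convex (k - 1) \<Omega>"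
    and "\<And>n. 0 < l n" and "\<And>n. ereal (l n) < lambda1 k \<Omega>"
    and "incseq l" and "(\<lambda>n. ereal (l n)) \<longlonglongrightarrow> lambda1 k \<Omega>"
    and "\<And>n. continuous_on (closure \<Omega>) (v n)"
    and "\<And>n. admissible_solution k \<Omega> (\<lambda>x s. 1 - l n * s * \<bar>s\<bar> ^ (k - 1)) (v n)"
    and "\<And>n x. x \<in> frontier \<Omega> \<Longrightarrow> v n x = 0"
  shows "\<exists>r \<psi>1 l1. strict_mono r \<and>
      uniform_limit (closure \<Omega>) (\<lambda>n x. v (r n) x / sup_norm \<Omega> (v (r n))) \<psi>1 sequentially \<and>
      lambda1 k \<Omega> = ereal l1 \<and>
      continuous_on (closure \<Omega>) \<psi>1 \<and>
      admissible_solution k \<Omega> (\<lambda>x s. - l1 * s * \<bar>s\<bar> ^ (k - 1)) \<psi>1 \<and>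
      (\<forall>x\<in>frontier \<Omega>. \<psi>1 x = 0) \<and>
      (\<forall>x\<in>\<Omega>. \<psi>1 x < 0)"
proof -
  note \<Omega> = assms(3-6) and l_pos = assms(9) and l_lim = assms(12)
    and v_cont = assms(13) and v_adm = assms(14) and v_bdry = assms(15)
  have k: "2 \<le> k" "1 \<le> k" "k \<le> CARD('n)" using assms(1) by auto
  define \<beta> where "\<beta> = (2 - real CARD('n) / real k) / 4"
  have \<beta>: "\<beta> > 0" "2 * \<beta> < 2 - real CARD('n) / real k"
    using k assms(2) by (auto simp: \<beta>_def field_simps)
  have clos: "closure \<Omega> = \<Omega> \<union> frontier \<Omega>"
    using \<Omega>(1) closure_subset[of \<Omega>] by (auto simp: frontier_def interior_open)

  obtain B where B: "\<forall>\<mu>\<in>Lambda_set k \<Omega>. \<mu> \<le> B"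
    using Lambda_set_bounded[OF k(2,3) assms(2) \<Omega>(1,3)] by blast
  \<comment> \<open>The supremum is finite: bounded above a priori, and not -\<infinity> because it
    exceeds \<open>l 0\<close>.\<close>
  have "lambda1 k \<Omega> \<le> ereal B" unfolding lambda1_def using B by (intro SUP_least) auto
  then obtain l1 where l1: "lambda1 k \<Omega> = ereal l1"
    using assms(10)[of 0] by (cases "lambda1 k \<Omega>") auto
  have l_to: "l \<longlonglongrightarrow> l1" using l_lim by (simp add: l1)
  have l_less: "l n < l1" for n using assms(10)[of n] by (simp add: l1)
  have l1_pos: "l1 > 0" using l_pos[of 0] l_less[of 0] by linarith
  have le_l1: "\<mu> \<le> l1" if "\<mu> \<in> Lambda_set k \<Omega>" for \<mu>
  proof -
    have "ereal \<mu> \<le> lambda1 k \<Omega>" unfolding lambda1_def using that by (rule SUP_upper)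
    then show ?thesis by (simp add: l1)
  qed

  have v_neg: "v n x < 0" if "x \<in> \<Omega>" for n x
    by (rule admissible_negative[OF k(2,3) \<Omega>(1,4) v_adm[of n] _ v_bdry that]) simp
  define M where "M n = sup_norm \<Omega> (v n)" for n
  have bdd: "bdd_above ((\<lambda>x. \<bar>v n x\<bar>) ` \<Omega>)" for n
  proof -
    have "compact (v n ` closure \<Omega>)"
      using \<Omega>(4) v_cont by (intro compact_continuous_image) auto
    then obtain b where "\<forall>y\<in>v n ` closure \<Omega>. norm y \<le> b"
      using compact_imp_bounded bounded_iff by metis
    then show ?thesis using closure_subset by (intro bdd_aboveI[of _ b]) auto
  qed
  have M_ge: "\<bar>v n x\<bar> \<le> M n" if "x \<in> \<Omega>" for n x
    unfolding M_def sup_norm_def by (rule cSUP_upper[OF that bdd])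
  have M_pos: "M n > 0" for n
  proof -
    obtain x where "x \<in> \<Omega>" using \<Omega>(3) by auto
    then show ?thesis using M_ge[of x n] v_neg[of x n] by linarith
  qed
  define a where "a n = 1 * (1 / M n) ^ k" for n
  have a_le: "l n + a n \<le> l1" for n
    using le_l1[OF admissible_Lambda_set[OF \<Omega>(1) k(2) v_adm v_neg M_ge M_pos], of n]
    by (simp add: a_def power_one_over)
  have a_pos: "a n > 0" for n using M_pos by (simp add: a_def)
  \<comment> \<open>The divergence of the norms in the form needed: \<open>a n\<close> = 1/M^k is
    squeezed between 0 and \<open>l1 - l n\<close>.\<close>
  have a_lim: "a \<longlonglongrightarrow> 0"
  proof (rule tendsto_sandwich[OF _ _ tendsto_const])
    show "(\<lambda>n. l1 - l n) \<longlonglongrightarrow> 0" using tendsto_diff[OF tendsto_const[of l1] l_to] by simp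
    show "\<forall>\<^sub>F n in sequentially. 0 \<le> a n" using a_pos by (simp add: less_imp_le)
    show "\<forall>\<^sub>F n in sequentially. a n \<le> l1 - l n" using a_le by (simp add: algebra_simps)
  qed

  define w where "w n x = (1 / M n) * v n x" for n x
  have w_adm: "admissible_solution k \<Omega> (\<lambda>x s. a n - l n * s * \<bar>s\<bar> ^ (k - 1)) (w n)" for n
    unfolding a_def w_def by (rule admissible_scale[OF k(2,3) _ v_adm]) (use M_pos in simp)
  have w_conv: "k_convex k \<Omega> (\<lambda>x. ereal (w n x))" for n
    by (rule admissible_k_convex[OF \<Omega>(1) w_adm])
  have w_bdry: "w n x = 0" if "x \<in> frontier \<Omega>" for n x using v_bdry[OF that] by (simp add: w_def)
  have w_bd: "- 1 \<le> w n x \<and> w n x \<le> 0" if "x \<in> closure \<Omega>" for n x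
  proof (cases "x \<in> \<Omega>")
    case True
    then show ?thesis
      using M_ge[OF True, of n] v_neg[OF True, of n] M_pos[of n] by (simp add: w_def field_simps)
  next
    case False
    then show ?thesis using that clos w_bdry by auto
  qed
  \<comment> \<open>One constant for all n, since |w_n| \<le> 1 and \<open>l n + a n\<close> \<le>
    l1; it is the C of the boundary barriers.\<close>
  have w_rhs: "a n - l n * w n x * \<bar>w n x\<bar> ^ (k - 1) \<le> l1" if "x \<in> closure \<Omega>" for n x
  proof -
    have "\<bar>w n x\<bar> ^ (k - 1) \<le> 1" using w_bd[OF that, of n] by (intro power_le_one) auto
    then have "(- w n x) * \<bar>w n x\<bar> ^ (k - 1) \<le> 1 * 1" using w_bd[OF that, of n] by (intro mult_mono) auto
    then have "l n * ((- w n x) * \<bar>w n x\<bar> ^ (k - 1)) \<le> l n * 1" using l_pos[of n] by (intro mult_left_mono) auto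
    then show ?thesis using a_le[of n] by (simp add: mult.assoc)
  qed
  have w_equi: "\<exists>d>0. \<forall>n y. y \<in> closure \<Omega> \<and> norm (x - y) < d \<longrightarrow> norm (w n x - w n y) < e"
    if x: "x \<in> closure \<Omega>" and e: "0 < e" for x e
  proof (cases "x \<in> \<Omega>")
    case True
    obtain d where "d > 0" and d: "\<forall>u y. k_convex k \<Omega> (\<lambda>x. ereal (u x)) \<longrightarrow> (\<forall>x\<in>\<Omega>. - 1 \<le> u x \<and> u x \<le> 0) \<longrightarrow>
        dist x y < d \<longrightarrow> \<bar>u x - u y\<bar> < e"
      using interior_equicontinuity[OF k(2,3) \<beta> \<Omega>(1) True e] by blast
    have "\<bar>w n x - w n y\<bar> < e" if "dist x y < d" for n y
      using d[rule_format, OF w_conv _ that] w_bd clos by auto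
    then show ?thesis using \<open>d > 0\<close> by (intro exI[of _ d]) (auto simp: dist_norm)
  next
    case False
    then have xf: "x \<in> frontier \<Omega>" using x clos by auto
    obtain d where "d > 0" and d: "\<forall>g u z. admissible_solution k \<Omega> g u \<longrightarrow> (\<forall>x\<in>\<Omega>. g x (u x) \<le> l1) \<longrightarrow>
        (\<forall>x\<in>closure \<Omega>. - 1 \<le> u x \<and> u x \<le> 0) \<longrightarrow> (\<forall>x\<in>frontier \<Omega>. u x = 0) \<longrightarrow>
        z \<in> closure \<Omega> \<longrightarrow> dist x z < d \<longrightarrow> \<bar>u z\<bar> < e"
      using boundary_equicontinuity[OF k(1,3) \<Omega>(1) assms(8) xf e, of l1] by blast
    have "\<bar>w n y\<bar> < e" if "y \<in> closure \<Omega>" "dist x y < d" for n y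
      using d[rule_format, OF w_adm[of n] _ _ _ that] w_rhs w_bd w_bdry clos by blast
    then show ?thesis using \<open>d > 0\<close> w_bdry[OF xf] by (intro exI[of _ d]) (auto simp: dist_norm)
  qed

  obtain \<psi> r where \<psi>_cont: "continuous_on (closure \<Omega>) \<psi>" and r: "strict_mono (r :: nat \<Rightarrow> nat)"
    and conv: "\<And>e. 0 < e \<Longrightarrow> \<exists>N. \<forall>n x. n \<ge> N \<and> x \<in> closure \<Omega> \<longrightarrow> norm (w (r n) x - \<psi> x) < e"
  proof (rule Arzela_Ascoli[of "closure \<Omega>" w 1])
    show "compact (closure \<Omega>)" using \<Omega>(4) by simp
    show "norm (w n x) \<le> 1" if "x \<in> closure \<Omega>" for n x using w_bd[OF that, of n] by simp
  qed (use w_equi in blast)+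
  have lim: "uniform_limit (closure \<Omega>) (\<lambda>n. w (r n)) \<psi> sequentially"
    unfolding uniform_limit_iff eventually_sequentially dist_norm using conv by blast
  have pw: "(\<lambda>n. w (r n) x) \<longlonglongrightarrow> \<psi> x" if "x \<in> closure \<Omega>" for x
    using lim that by (rule tendsto_uniform_limitI)
  have \<psi>_bdry: "\<psi> x = 0" if "x \<in> frontier \<Omega>" for x
    using pw[of x] that clos w_bdry[OF that] by (auto dest: LIMSEQ_unique[OF tendsto_const])
  have \<psi>_nonpos: "\<psi> x \<le> 0" if "x \<in> closure \<Omega>" for x
    by (rule LIMSEQ_le_const2[OF pw[OF that]]) (use w_bd[OF that] in auto)
  have ar: "(\<lambda>n. a (r n)) \<longlonglongrightarrow> 0" and lr: "(\<lambda>n. l (r n)) \<longlonglongrightarrow> l1"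
    using LIMSEQ_subseq_LIMSEQ[OF a_lim r] LIMSEQ_subseq_LIMSEQ[OF l_to r] by (simp_all add: o_def)
  \<comment> \<open>The sign condition that \<open>supersolution_limit\<close> imposes; it rests on
    \<psi> \<le> 0 and l1 > 0.\<close>
  have rhs_nonneg: "0 - l1 * \<psi> x * \<bar>\<psi> x\<bar> ^ (k - 1) \<ge> 0" if "x \<in> closure \<Omega>" for x
    using \<psi>_nonpos[OF that] l1_pos by (simp add: mult_nonneg_nonpos mult_nonpos_nonneg)
  have \<psi>_adm: "admissible_solution k \<Omega> (\<lambda>x s. - l1 * s * \<bar>s\<bar> ^ (k - 1)) \<psi>"
    unfolding admissible_solution_def
  proof (intro conjI ballI allI impI \<psi>_cont)
    fix x0 \<phi> assume x0: "x0 \<in> \<Omega>" and t: "touches_above \<Omega> (\<lambda>x. ereal (\<psi> x)) x0 \<phi>"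
    note sub = subsolution_limit[OF k(2,3) \<Omega>(1) w_adm lim \<psi>_cont ar lr x0 t]
    show "- l1 * \<psi> x0 * \<bar>\<psi> x0\<bar> ^ (k - 1) \<le> Sk k (hessian \<phi> x0)" using sub by simp
    show "hessian \<phi> x0 \<in> Sigma_cone k" using sub by simp
  next
    fix x0 \<phi> assume x0: "x0 \<in> \<Omega>" and t: "touches_below \<Omega> (\<lambda>x. ereal (\<psi> x)) x0 \<phi>"
    have "x0 \<in> closure \<Omega>" using x0 clos by auto
    from supersolution_limit[OF k(2,3) \<Omega>(1) w_adm lim \<psi>_cont ar lr x0 t rhs_nonneg[OF this]]
    show "Sk k (hessian \<phi> x0) \<le> - l1 * \<psi> x0 * \<bar>\<psi> x0\<bar> ^ (k - 1) \<or> hessian \<phi> x0 \<notin> Sigma_cone k" by simp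
  qed
  \<comment> \<open>Uniform convergence preserves nontriviality: some |w_n(x)| exceeds 1/2 while
    |w_n - \<psi>| < 1/4. The supremum in the norm is taken over the open set, so it is approached
    up to a factor 1/2.\<close>
  obtain x1 where x1: "x1 \<in> \<Omega>" "\<psi> x1 < 0"
  proof -
    obtain N where N: "\<forall>n x. n \<ge> N \<and> x \<in> closure \<Omega> \<longrightarrow> norm (w (r n) x - \<psi> x) < 1 / 4"
      using conv[of "1 / 4"] by auto
    have "M (r N) / 2 < (SUP x\<in>\<Omega>. \<bar>v (r N) x\<bar>)"
      using M_pos[of "r N"] by (simp add: M_def sup_norm_def)
    then obtain x where x: "x \<in> \<Omega>" "M (r N) / 2 < \<bar>v (r N) x\<bar>"
      using less_cSUP_iff[OF \<Omega>(3) bdd] by blast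
    then have "\<bar>w (r N) x\<bar> > 1 / 2"
      using M_pos[of "r N"] by (simp add: w_def abs_mult field_simps)
    moreover have "\<bar>w (r N) x - \<psi> x\<bar> < 1 / 4" using N x clos by auto
    ultimately have "\<psi> x \<noteq> 0" by auto
    then show ?thesis using \<psi>_nonpos[of x] x(1) clos that[of x] by force
  qed
  have "\<psi> x < 0" if "x \<in> \<Omega>" for x
    by (rule k_convex_strong_max_principle[OF k(2,3) \<beta> \<Omega>(1,2) admissible_k_convex[OF \<Omega>(1) \<psi>_adm] _ x1 that])
      (use \<psi>_nonpos clos in auto)
  moreover have "(\<lambda>n x. v (r n) x / sup_norm \<Omega> (v (r n))) = (\<lambda>n. w (r n))"
    by (simp add: fun_eq_iff w_def M_def)
  ultimately show ?thesis
    using r lim l1 \<psi>_cont \<psi>_adm \<psi>_bdry by (intro exI[of _ r] exI[of _ \<psi>] exI[of _ l1]) auto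
qed

end
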